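(* Let $f$ be a Hecke-Maass cusp form for $SL_2(\mathbb{Z})$ and let $q$ be an odd prime. For any integer $N\ge 1$ we have \[ \mathop{{\sum}^{+}}_{\chi\bmod q } \frac{\tau(\chi)}{q^{1/2}} L(\tfrac{1}{2}, f\times \overline{\chi}) = 2 L(\tfrac{1}{2}, f)\, q^{1/2} - \lambda_f(q) L(\tfrac{1}{2}, f) + \sum_{n=1 }^{N} c_{n,f}\, q^{-n/2}+O_{N,f}\Big(q^{-(N+1)/2}\Big), \] \[ \mathop{{\sum}^{-}}_{\chi\bmod q } \frac{\tau(\chi)}{q^{1/2}} L(\tfrac{1}{2}, f\times \overline{\chi}) = \sum_{n=1 }^{N} c_{n,f}'\, q^{-n/2}+O_{N,f}\Big(q^{-(N+1)/2}\Big), \] for some constants $c_{n,f}, c_{n,f}'$ (independent of $q$).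
   Context: $f$ is a Hecke-Maass cusp form for $SL_2(\mathbb{Z})$ with Hecke eigenvalues $\lambda_f(n)$ (normalized with $\lambda_f(1)=1$), and $L(s,f)=\sum_{n\ge1}\lambda_f(n)n^{-s}$ is its $L$-function (analytically continued). For a primitive Dirichlet character $\chi$ mod $q$, $L(s,f\times\chi)$ is defined for $\Re(s)>1$ by $\sum_{n\ge 1}\lambda_f(n)\chi(n)n^{-s}$ and elsewhere by analytic continuation. $\tau(\chi)=\sum_{k=1}^{q-1}e^{2\pi i k/q}\chi(k)$ is the Gauss sum. $\mathop{{\sum}^{+}}_{\chi\bmod q}$ denotes the sum over even primitive Dirichlet characters mod $q$ (those with $\chi(-1)=1$), and $\mathop{{\sum}^{-}}_{\chi\bmod q}$ the sum over odd primitive Dirichlet characters mod $q$ (those with $\chi(-1)=-1$). *)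

theory Defs
  imports "HOL-Complex_Analysis.Complex_Analysis" "HOL-Number_Theory.Number_Theory"
begin

section \<open>Hecke-Maass cusp forms for the full modular group\<close>

text \<open>
  A form is a function on all of \<^typ>\<open>complex\<close>, of which only the values on the upper half
  plane matter.
\<close>

definition upper_half_plane :: "complex set" where
  "upper_half_plane = {z. Im z > 0}"

definition partial_x :: "(complex \<Rightarrow> complex) \<Rightarrow> complex \<Rightarrow> complex" where
  "partial_x f z = vector_derivative (\<lambda>t. f (z + of_real t)) (at 0)"

definition partial_y :: "(complex \<Rightarrow> complex) \<Rightarrow> complex \<Rightarrow> complex" where
  "partial_y f z = vector_derivative (\<lambda>t. f (z + \<i> * of_real t)) (at 0)"

text \<open>
  Differentiability is meant in the real sense here (\<^const>\<open>differentiable_on\<close> refers to the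
  Frechet derivative over the reals); the set is intended to be open.
\<close>

primrec C_k_on :: "nat \<Rightarrow> complex set \<Rightarrow> (complex \<Rightarrow> complex) \<Rightarrow> bool" where
  "C_k_on 0 S f \<longleftrightarrow> continuous_on S f"
| "C_k_on (Suc k) S f \<longleftrightarrow>
     f differentiable_on S \<and> C_k_on k S (partial_x f) \<and> C_k_on k S (partial_y f)"

definition smooth_on :: "complex set \<Rightarrow> (complex \<Rightarrow> complex) \<Rightarrow> bool" where
  "smooth_on S f \<longleftrightarrow> (\<forall>k. C_k_on k S f)"

definition hyperbolic_laplacian :: "(complex \<Rightarrow> complex) \<Rightarrow> complex \<Rightarrow> complex" where
  "hyperbolic_laplacian f z =
     - of_real ((Im z)\<^sup>2) * (partial_x (partial_x f) z + partial_y (partial_y f) z)"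

definition SL2Z_invariant :: "(complex \<Rightarrow> complex) \<Rightarrow> bool" where
  "SL2Z_invariant f \<longleftrightarrow>
     (\<forall>a b c d :: int. a * d - b * c = 1 \<longrightarrow>
       (\<forall>z\<in>upper_half_plane.
          f ((of_int a * z + of_int b) / (of_int c * z + of_int d)) = f z))"

definition maass_cusp_form :: "(complex \<Rightarrow> complex) \<Rightarrow> bool" where
  "maass_cusp_form f \<longleftrightarrow>
     smooth_on upper_half_plane f \<and>
     (\<exists>z\<in>upper_half_plane. f z \<noteq> 0) \<and>
     SL2Z_invariant f \<and>
     (\<exists>\<mu>. \<forall>z\<in>upper_half_plane. hyperbolic_laplacian f z = \<mu> * f z) \<and>
     (\<exists>C A. \<forall>z. Im z \<ge> 1 \<longrightarrow> norm (f z) \<le> C * Im z powr A) \<and>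
     (\<forall>y>0. integral {0..1} (\<lambda>x. f (Complex x y)) = 0)"

text \<open>
  The Hecke operator $T_n f(z) = n^{-1/2} \sum_{ad = n} \sum_{b \bmod d} f((az+b)/d)$.
\<close>

definition hecke_operator :: "nat \<Rightarrow> (complex \<Rightarrow> complex) \<Rightarrow> complex \<Rightarrow> complex" where
  "hecke_operator n f z =
     (\<Sum>d | d dvd n. \<Sum>b<d. f ((of_nat (n div d) * z + of_nat b) / of_nat d)) / of_real (sqrt (real n))"

definition hecke_maass_cusp_form :: "(complex \<Rightarrow> complex) \<Rightarrow> bool" where
  "hecke_maass_cusp_form f \<longleftrightarrow>
     maass_cusp_form f \<and>
     (\<forall>n\<ge>1. \<exists>l. \<forall>z\<in>upper_half_plane. hecke_operator n f z = l * f z)"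

definition hecke_eigenvalue :: "(complex \<Rightarrow> complex) \<Rightarrow> nat \<Rightarrow> complex" where
  "hecke_eigenvalue f n = (THE l. \<forall>z\<in>upper_half_plane. hecke_operator n f z = l * f z)"

lemma hecke_operator_eigenvalue:
  assumes "hecke_maass_cusp_form f" "n \<ge> 1" "z \<in> upper_half_plane"
  shows "hecke_operator n f z = hecke_eigenvalue f n * f z"
proof -
  obtain w where w: "w \<in> upper_half_plane" "f w \<noteq> 0"
    using assms(1) by (auto simp: hecke_maass_cusp_form_def maass_cusp_form_def)
  obtain l where l: "\<forall>z\<in>upper_half_plane. hecke_operator n f z = l * f z"
    using assms by (auto simp: hecke_maass_cusp_form_def)
  have "hecke_eigenvalue f n = l"
    unfolding hecke_eigenvalue_def
  proof (rule the_equality)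
    show "m = l" if "\<forall>z\<in>upper_half_plane. hecke_operator n f z = m * f z" for m
      using that l w by (metis mult_right_cancel)
  qed (use l in blast)
  thus ?thesis using l assms(3) by simp
qed

lemma hecke_eigenvalue_1:
  assumes "hecke_maass_cusp_form f"
  shows "hecke_eigenvalue f 1 = 1"
proof -
  obtain w where w: "w \<in> upper_half_plane" "f w \<noteq> 0"
    using assms by (auto simp: hecke_maass_cusp_form_def maass_cusp_form_def)
  have "hecke_operator 1 f w = f w"
    by (simp add: hecke_operator_def)
  thus ?thesis using hecke_operator_eigenvalue[OF assms, of 1 w] w by simp
qed


section \<open>Dirichlet characters and Gauss sums\<close>

definition dirichlet_char :: "nat \<Rightarrow> (int \<Rightarrow> complex) \<Rightarrow> bool" where
  "dirichlet_char q \<xi> \<longleftrightarrow>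
     (\<forall>m n. \<xi> (m * n) = \<xi> m * \<xi> n) \<and>
     (\<forall>n. \<xi> (n + int q) = \<xi> n) \<and>
     (\<forall>n. \<xi> n \<noteq> 0 \<longleftrightarrow> coprime n (int q))"

text \<open>Primitive: not induced from a character modulo a proper divisor of the modulus.\<close>

definition primitive_char :: "nat \<Rightarrow> (int \<Rightarrow> complex) \<Rightarrow> bool" where
  "primitive_char q \<xi> \<longleftrightarrow>
     dirichlet_char q \<xi> \<and>
     (\<forall>d. d dvd q \<and> d < q \<longrightarrow>
        \<not> (\<exists>\<psi>. dirichlet_char d \<psi> \<and> (\<forall>n. coprime n (int q) \<longrightarrow> \<xi> n = \<psi> n)))"

definition even_primitive_chars :: "nat \<Rightarrow> (int \<Rightarrow> complex) set" where
  "even_primitive_chars q = {\<xi>. primitive_char q \<xi> \<and> \<xi> (- 1) = 1}"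

definition odd_primitive_chars :: "nat \<Rightarrow> (int \<Rightarrow> complex) set" where
  "odd_primitive_chars q = {\<xi>. primitive_char q \<xi> \<and> \<xi> (- 1) = - 1}"

definition gauss_sum :: "nat \<Rightarrow> (int \<Rightarrow> complex) \<Rightarrow> complex" where
  "gauss_sum q \<xi> =
     (\<Sum>k = 1..q - 1. exp (2 * of_real pi * \<i> * of_nat k / of_nat q) * \<xi> (int k))"

text \<open>Finiteness ensures that sums over sets of characters have their usual meaning.\<close>

lemma finite_dirichlet_chars:
  assumes "q > 0"
  shows "finite {\<xi>. dirichlet_char q \<xi>}"
proof -
  define R where "R = insert 0 {z :: complex. z ^ totient q = 1}"
  have tot: "totient q > 0" using assms by simp
  have "finite R"
    unfolding R_def using finite_roots_unity[of "totient q"] tot by auto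
  have mod: "\<xi> n = \<xi> (n mod int q)" if "dirichlet_char q \<xi>" for \<xi> n
  proof -
    have per: "\<xi> (m + int q) = \<xi> m" for m using that by (simp add: dirichlet_char_def)
    have nat: "\<xi> (m + int k * int q) = \<xi> m" for m k
    proof (induction k)
      case (Suc k)
      have "\<xi> (m + int (Suc k) * int q) = \<xi> ((m + int k * int q) + int q)"
        by (simp add: algebra_simps)
      thus ?case using Suc per by simp
    qed simp
    show ?thesis
    proof (cases "n div int q \<ge> 0")
      case True
      thus ?thesis using nat[of "n mod int q" "nat (n div int q)"] by simp
    next
      case False
      have "n + int (nat (- (n div int q))) * int q = n mod int q"
        using False by (simp add: minus_div_mult_eq_mod [symmetric])
      thus ?thesis using nat[of n "nat (- (n div int q))"] by simp
    qed
  qed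
  have range: "\<xi> n \<in> R" if \<xi>: "dirichlet_char q \<xi>" for \<xi> n
  proof (cases "coprime n (int q)")
    case True
    have mult: "\<xi> (a * b) = \<xi> a * \<xi> b" for a b using \<xi> by (simp add: dirichlet_char_def)
    have "\<xi> 1 \<noteq> 0" using \<xi> by (simp add: dirichlet_char_def)
    hence one: "\<xi> 1 = 1" using mult[of 1 1] by simp
    have pow: "\<xi> (n ^ k) = \<xi> n ^ k" for k by (induction k) (simp_all add: one mult)
    define m where "m = nat (n mod int q)"
    have m: "int m = n mod int q" using assms by (simp add: m_def)
    have "coprime (int m) (int q)" using True assms m by simp
    hence "coprime m q" by simp
    hence "[m ^ totient q = 1] (mod q)" by (rule euler_theorem)
    hence "[int m ^ totient q = 1] (mod int q)"
      by (metis cong_int_iff of_nat_1 of_nat_power)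
    hence "[n ^ totient q = 1] (mod int q)"
      unfolding m by (simp add: cong_def power_mod)
    hence "\<xi> (n ^ totient q) = \<xi> 1"
      using mod[OF \<xi>, of "n ^ totient q"] mod[OF \<xi>, of 1] by (simp add: cong_def)
    thus ?thesis using pow one by (simp add: R_def)
  next
    case False
    thus ?thesis using \<xi> by (auto simp: dirichlet_char_def R_def)
  qed
  define F where "F = (\<lambda>\<xi> :: int \<Rightarrow> complex. restrict \<xi> {0..<int q})"
  have "inj_on F {\<xi>. dirichlet_char q \<xi>}"
  proof (rule inj_onI, rule ext)
    fix \<xi> \<psi> n
    assume "\<xi> \<in> {\<xi>. dirichlet_char q \<xi>}" "\<psi> \<in> {\<xi>. dirichlet_char q \<xi>}" and eq: "F \<xi> = F \<psi>"
    moreover have "\<xi> (n mod int q) = \<psi> (n mod int q)"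
      using fun_cong[OF eq, of "n mod int q"] assms by (simp add: F_def)
    ultimately show "\<xi> n = \<psi> n" using mod[of \<xi> n] mod[of \<psi> n] by simp
  qed
  moreover have "F ` {\<xi>. dirichlet_char q \<xi>} \<subseteq> {0..<int q} \<rightarrow>\<^sub>E R"
    using range by (auto simp: F_def)
  moreover have "finite ({0..<int q} \<rightarrow>\<^sub>E R)"
    using \<open>finite R\<close> by (intro finite_PiE) auto
  ultimately show ?thesis by (meson finite_imageD finite_subset)
qed


section \<open>\<open>L\<close>-functions\<close>

definition entire_continuation :: "(nat \<Rightarrow> complex) \<Rightarrow> (complex \<Rightarrow> complex) \<Rightarrow> bool" where
  "entire_continuation a F \<longleftrightarrow>
     F holomorphic_on UNIV \<and>
     (\<forall>s. Re s > 1 \<longrightarrow> (\<lambda>n. a (Suc n) / of_nat (Suc n) powr s) sums F s)"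

lemma entire_continuation_unique:
  assumes "entire_continuation a F" "entire_continuation a G"
  shows "F = G"
proof
  fix s
  have "F z = G z" if "Re z > 1" for z
    using assms that sums_unique2 unfolding entire_continuation_def by blast
  moreover have "open {z. Re z > 1}" by (simp add: open_halfspace_Re_gt)
  moreover have "{z. Re z > 1} \<noteq> {}"
    using exI[of "\<lambda>z. Re z > 1" 2] by simp
  ultimately show "F s = G s"
    using assms
    by (intro analytic_continuation_open[of "{z. Re z > 1}" UNIV F G s])
       (auto simp: entire_continuation_def)
qed

text \<open>
  The \<open>L\<close>-functions of cusp forms and of their twists by primitive characters are entire, so the
  analytic continuation is taken to the whole plane.
\<close>

definition L_series :: "(nat \<Rightarrow> complex) \<Rightarrow> complex \<Rightarrow> complex" where
  "L_series a = (THE F. entire_continuation a F)"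

definition L_form :: "(complex \<Rightarrow> complex) \<Rightarrow> complex \<Rightarrow> complex" where
  "L_form f s = L_series (hecke_eigenvalue f) s"

definition L_twist :: "(complex \<Rightarrow> complex) \<Rightarrow> (int \<Rightarrow> complex) \<Rightarrow> complex \<Rightarrow> complex" where
  "L_twist f \<xi> s = L_series (\<lambda>n. hecke_eigenvalue f n * \<xi> (int n)) s"

definition conj_char :: "(int \<Rightarrow> complex) \<Rightarrow> int \<Rightarrow> complex" where
  "conj_char \<xi> n = cnj (\<xi> n)"

end

theory Submission
  imports Defs
begin

text \<open>
  Orthogonality of characters turns the sum of \<open>\<tau>(\<chi>) L(1/2, f \<times> cnj \<chi>)\<close> over the characters of one
  parity into the additive twist of the \<open>L\<close>-series of \<open>f\<close> by \<open>e(n/q) + \<nu> e(-n/q)\<close>, where \<open>\<nu> = \<plusminus>1\<close>, up to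
  the contributions of the principal character and of the multiples of \<open>q\<close>, which the Hecke relations
  evaluate. Up to the reciprocal of the archimedean factor, the additive twist at \<open>1/2\<close> is the integral of
  \<open>f\<close> or of \<open>y f\<^sub>x\<close> against \<open>dy/y\<close> over the vertical line above \<open>1/q\<close>. The element of \<open>SL\<^sub>2(\<int>)\<close> that maps \<open>1/q\<close>
  to \<open>\<i>\<infinity>\<close> exchanges the lower half of this line with the upper half \<open>y \<ge> 1/q\<close> of the line above \<open>-1/q\<close>. On
  the upper halves Taylor's theorem at \<open>x = 0\<close> with an integrated remainder, controlled by the rapid decay of
  all derivatives of \<open>f\<close> inside the cone \<open>\<bar>x\<bar> \<le> y\<close>, gives the expansion in powers of \<open>1/q\<close>.

  The archimedean factor is the Mellin transform of \<open>\<surd>y K\<^sub>s(2\<pi>y)\<close>, a product of two Gamma functions, so its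
  reciprocal is entire and the twists continue analytically to the whole plane.
\<close>

section \<open>Fourier series on the circle\<close>

definition fourier_coeff :: "(real \<Rightarrow> complex) \<Rightarrow> int \<Rightarrow> complex" where
  "fourier_coeff g n = integral {0..1} (\<lambda>x. g x * cis (- 2 * pi * of_int n * x))"

lemma cis_2pi_eq_1_iff: "cis (2 * pi * x) = 1 \<longleftrightarrow> x \<in> \<int>"
proof -
  have "cis (2 * pi * x) = exp (\<i> * of_real (2 * pi * x))"
    by (simp add: cis_conv_exp)
  also have "\<dots> = 1 \<longleftrightarrow> (\<exists>n::int. 2 * pi * x = of_int (2 * n) * pi)"
    by (subst exp_eq_1) (auto simp: mult_ac)
  also have "\<dots> \<longleftrightarrow> x \<in> \<int>"
    by (auto simp: Ints_def)
  finally show ?thesis .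
qed

lemma has_vector_derivative_cis_mult:
  "((\<lambda>x. cis (c * x)) has_vector_derivative (\<i> * of_real c * cis (c * x))) (at x within S)"
proof -
  have "((\<lambda>z. exp (\<i> * of_real c * z)) has_field_derivative (\<i> * of_real c * exp (\<i> * of_real c * of_real x)))
          (at (of_real x))"
    by (rule derivative_eq_intros refl | simp)+
  from has_vector_derivative_real_field[OF this, of S] show ?thesis
    by (simp add: cis_conv_exp mult_ac)
qed

lemma integral_cis_2pi:
  fixes m :: int
  shows "integral {0..1} (\<lambda>x. cis (2 * pi * of_int m * x)) = (if m = 0 then 1 else 0)"
proof (cases "m = 0")
  case False
  define c where "c = 2 * pi * of_int m"
  have c: "c \<noteq> 0" using False by (simp add: c_def)
  have "((\<lambda>x. cis (c * x)) has_integral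
          (cis (c * 1) / (\<i> * of_real c) - cis (c * 0) / (\<i> * of_real c))) {0..1}"
  proof (rule fundamental_theorem_of_calculus)
    show "((\<lambda>x. cis (c * x) / (\<i> * of_real c)) has_vector_derivative cis (c * x)) (at x within {0..1})" for x
      using has_vector_derivative_divide[OF has_vector_derivative_cis_mult[of c x "{0..1}"], of "\<i> * of_real c"] c
      by simp
  qed simp
  moreover have "cis (c * 1) = 1"
    using cis_2pi_eq_1_iff[of "of_int m"] by (simp add: c_def)
  ultimately show ?thesis using False by (simp add: integral_unique c_def)
qed simp

lemma integrable_mult_cis:
  fixes g :: "real \<Rightarrow> complex"
  assumes "continuous_on {0..1} g"
  shows "(\<lambda>x. g x * cis (c * x)) integrable_on {0..1}"
  by (intro integrable_continuous_interval continuous_intros assms)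

lemma norm_fourier_coeff_le:
  assumes "continuous_on {0..1} g" "\<And>x. x \<in> {0..1} \<Longrightarrow> norm (g x) \<le> B"
  shows "norm (fourier_coeff g n) \<le> B"
proof -
  have "norm (fourier_coeff g n) \<le> integral {0..1} (\<lambda>x::real. B)"
    unfolding fourier_coeff_def
    by (intro Henstock_Kurzweil_Integration.integral_norm_bound_integral integrable_mult_cis assms)
       (auto simp: norm_mult assms)
  thus ?thesis by simp
qed

definition trig_poly :: "int set \<Rightarrow> (int \<Rightarrow> complex) \<Rightarrow> real \<Rightarrow> complex" where
  "trig_poly S c x = (\<Sum>n\<in>S. c n * cis (2 * pi * of_int n * x))"

lemma continuous_on_trig_poly: "continuous_on A (trig_poly S c)"
  unfolding trig_poly_def by (intro continuous_intros)

lemma integral_mult_cnj_trig_poly: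
  assumes "continuous_on {0..1} g" "finite S"
  shows "integral {0..1} (\<lambda>x. g x * cnj (trig_poly S c x)) = (\<Sum>n\<in>S. fourier_coeff g n * cnj (c n))"
proof -
  have "integral {0..1} (\<lambda>x. g x * cnj (trig_poly S c x)) =
          integral {0..1} (\<lambda>x. \<Sum>n\<in>S. cnj (c n) * (g x * cis (- 2 * pi * of_int n * x)))"
    by (simp add: trig_poly_def sum_distrib_left mult_ac cis_cnj)
  also have "\<dots> = (\<Sum>n\<in>S. integral {0..1} (\<lambda>x. cnj (c n) * (g x * cis (- 2 * pi * of_int n * x))))"
    using assms by (intro integral_sum integrable_on_mult_right integrable_mult_cis)
  finally show ?thesis by (simp add: fourier_coeff_def mult.commute)
qed

lemma fourier_coeff_trig_poly:
  assumes "finite S" "m \<in> S"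
  shows "fourier_coeff (trig_poly S c) m = c m"
proof -
  have shift: "cis (2 * pi * of_int n * x) * cis (- 2 * pi * of_int m * x) = cis (2 * pi * of_int (n - m) * x)"
    for n x
    by (simp add: cis_mult algebra_simps)
  have "fourier_coeff (trig_poly S c) m =
          integral {0..1} (\<lambda>x. \<Sum>n\<in>S. c n * cis (2 * pi * of_int (n - m) * x))"
    by (simp only: fourier_coeff_def trig_poly_def sum_distrib_right shift mult.assoc[of "c _"])
  also have "\<dots> = (\<Sum>n\<in>S. integral {0..1} (\<lambda>x. c n * cis (2 * pi * of_int (n - m) * x)))"
    using assms by (intro integral_sum integrable_continuous_interval continuous_intros)
  also have "\<dots> = (\<Sum>n\<in>S. c n * (if n - m = 0 then 1 else 0))"
    unfolding integral_mult_right integral_cis_2pi ..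
  also have "\<dots> = c m"
    using assms by (simp add: if_distrib sum.delta cong: if_cong)
  finally show ?thesis .
qed

lemma bessel_inequality:
  assumes g: "continuous_on {0..1} g" and S: "finite S"
  shows "(\<Sum>n\<in>S. (norm (fourier_coeff g n))\<^sup>2) \<le> integral {0..1} (\<lambda>x. (norm (g x))\<^sup>2)"
proof -
  define P where "P = trig_poly S (fourier_coeff g)"
  define E where "E = (\<Sum>n\<in>S. (norm (fourier_coeff g n))\<^sup>2)"
  have P: "continuous_on {0..1} P" by (simp add: P_def continuous_on_trig_poly)
  have "integral {0..1} (\<lambda>x. g x * cnj (P x)) = of_real E"
    unfolding P_def integral_mult_cnj_trig_poly[OF g S] by (simp add: E_def complex_norm_square del: of_real_power)
  moreover have "(\<lambda>x. g x * cnj (P x)) integrable_on {0..1}"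
    by (intro integrable_continuous_interval continuous_intros g P)
  ultimately have gP: "((\<lambda>x. g x * cnj (P x)) has_integral of_real E) {0..1}"
    by (metis integrable_integral)
  have "integral {0..1} (\<lambda>x. P x * cnj (P x)) = of_real E"
    unfolding P_def integral_mult_cnj_trig_poly[OF continuous_on_trig_poly S] using S
    by (simp add: E_def complex_norm_square fourier_coeff_trig_poly del: of_real_power)
  moreover have "(\<lambda>x. P x * cnj (P x)) integrable_on {0..1}"
    by (intro integrable_continuous_interval continuous_intros P)
  ultimately have PP: "((\<lambda>x. P x * cnj (P x)) has_integral of_real E) {0..1}"
    by (metis integrable_integral)
  have square: "(norm (g x - P x))\<^sup>2 = (norm (g x))\<^sup>2 - 2 * Re (g x * cnj (P x)) + Re (P x * cnj (P x))" for x
    unfolding cmod_power2 by (simp add: power2_eq_square algebra_simps)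
  have gg: "(\<lambda>x. (norm (g x))\<^sup>2) integrable_on {0..1}"
    by (intro integrable_continuous_interval continuous_intros g)
  have "0 \<le> integral {0..1} (\<lambda>x. (norm (g x - P x))\<^sup>2)"
    by (intro integral_nonneg integrable_continuous_interval continuous_intros g P) auto
  also have "\<dots> = integral {0..1} (\<lambda>x. (norm (g x))\<^sup>2) - 2 * E + E"
    unfolding square
    by (intro integral_unique has_integral_add has_integral_diff has_integral_mult_right integrable_integral gg)
       (use has_integral_Re[OF gP] has_integral_Re[OF PP] in simp_all)
  finally show ?thesis by (simp add: E_def)
qed

lemma riemann_lebesgue:
  fixes \<phi> :: "nat \<Rightarrow> int"
  assumes h: "continuous_on {0..1} h" and "inj \<phi>"
  shows "(\<lambda>N. fourier_coeff h (\<phi> N)) \<longlonglongrightarrow> 0"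
proof -
  have "summable (\<lambda>N. (norm (fourier_coeff h (\<phi> N)))\<^sup>2)"
  proof (rule bounded_imp_summable)
    fix n
    have "(\<Sum>N\<le>n. (norm (fourier_coeff h (\<phi> N)))\<^sup>2) = (\<Sum>k\<in>\<phi> ` {..n}. (norm (fourier_coeff h k))\<^sup>2)"
      using assms(2) by (subst sum.reindex) (auto intro: inj_on_subset)
    also have "\<dots> \<le> integral {0..1} (\<lambda>x. (norm (h x))\<^sup>2)"
      by (intro bessel_inequality h) auto
    finally show "(\<Sum>N\<le>n. (norm (fourier_coeff h (\<phi> N)))\<^sup>2) \<le> integral {0..1} (\<lambda>x. (norm (h x))\<^sup>2)" .
  qed auto
  hence "(\<lambda>N. sqrt ((norm (fourier_coeff h (\<phi> N)))\<^sup>2)) \<longlonglongrightarrow> sqrt 0"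
    by (intro tendsto_real_sqrt summable_LIMSEQ_zero)
  thus ?thesis by (simp add: tendsto_norm_zero_iff)
qed

lemma fourier_coeff_cis_minus_1_mult:
  assumes h: "continuous_on {0..1} h"
  shows "fourier_coeff (\<lambda>x. (cis (2 * pi * x) - 1) * h x) n = fourier_coeff h (n - 1) - fourier_coeff h n"
proof -
  have "(cis (2 * pi * x) - 1) * h x * cis (- 2 * pi * of_int n * x) =
          h x * cis (- 2 * pi * of_int (n - 1) * x) - h x * cis (- 2 * pi * of_int n * x)" for x
  proof -
    have "cis (- 2 * pi * of_int (n - 1) * x) = cis (2 * pi * x) * cis (- 2 * pi * of_int n * x)"
      by (simp add: cis_mult algebra_simps)
    thus ?thesis by (simp only: left_diff_distrib mult_1 mult.assoc mult.left_commute[of "h x"])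
  qed
  thus ?thesis
    unfolding fourier_coeff_def by (simp only:) (intro integral_diff integrable_mult_cis h)
qed

lemma isCont_difference_quotient_cis:
  assumes g: "(g has_vector_derivative d) (at 0)" "g 0 = 0"
  shows "isCont (\<lambda>x. if x \<in> \<int> then d / (2 * of_real pi * \<i>) else g x / (cis (2 * pi * x) - 1)) 0"
proof -
  have difference_quotient: "((\<lambda>x. k x / of_real x) \<longlongrightarrow> k') (at 0)"
    if "(k has_vector_derivative k') (at 0)" "k 0 = 0" for k :: "real \<Rightarrow> complex" and k'
  proof -
    have "((\<lambda>x. norm ((k x - x *\<^sub>R k') / of_real x)) \<longlongrightarrow> 0) (at 0)"
      using that unfolding has_vector_derivative_def has_derivative_at by (simp add: norm_divide)
    hence "((\<lambda>x. (k x - x *\<^sub>R k') / of_real x) \<longlongrightarrow> 0) (at 0)"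
      by (rule tendsto_norm_zero_cancel)
    moreover have "\<forall>\<^sub>F x in at 0. (k x - x *\<^sub>R k') / of_real x = k x / of_real x - k'"
      by (auto simp: eventually_at_filter scaleR_conv_of_real field_simps)
    ultimately have "((\<lambda>x. k x / of_real x - k') \<longlongrightarrow> 0) (at 0)"
      by (rule Lim_transform_eventually)
    thus ?thesis by (simp add: LIM_zero_iff)
  qed
  have "((\<lambda>x. cis (2 * pi * x) - 1) has_vector_derivative (\<i> * of_real (2 * pi) * cis (2 * pi * 0))) (at 0)"
    by (intro has_vector_derivative_diff_const[THEN iffD2] has_vector_derivative_cis_mult)
  hence "((\<lambda>x. (cis (2 * pi * x) - 1) / of_real x) \<longlongrightarrow> 2 * of_real pi * \<i>) (at 0)"
    using difference_quotient[of "\<lambda>x. cis (2 * pi * x) - 1"] by (simp add: mult_ac)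
  from tendsto_divide[OF difference_quotient[OF g] this]
  have "((\<lambda>x. (g x / of_real x) / ((cis (2 * pi * x) - 1) / of_real x)) \<longlongrightarrow> d / (2 * of_real pi * \<i>)) (at 0)"
    by simp
  moreover have "\<forall>\<^sub>F x in at (0::real). x \<notin> \<int>"
    unfolding eventually_at by (rule exI[of _ 1]) (auto elim!: Ints_cases simp: dist_norm)
  hence "\<forall>\<^sub>F x in at 0. (g x / of_real x) / ((cis (2 * pi * x) - 1) / of_real x) =
           (if x \<in> \<int> then d / (2 * of_real pi * \<i>) else g x / (cis (2 * pi * x) - 1))"
    by eventually_elim (auto split: if_splits)
  ultimately show ?thesis
    unfolding isCont_def by (simp add: Lim_transform_eventually del: divide_divide_eq_left divide_divide_eq_right)
qed

lemma ex_continuous_cis_minus_1_mult: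
  assumes g: "continuous_on UNIV g" and per: "\<And>x. g (x + 1) = g x"
    and d: "(g has_vector_derivative d) (at 0)" and zero: "g 0 = 0"
  shows "\<exists>h. continuous_on UNIV h \<and> (\<forall>x. g x = (cis (2 * pi * x) - 1) * h x)"
proof (intro exI conjI allI)
  define h where "h = (\<lambda>x. if x \<in> \<int> then d / (2 * of_real pi * \<i>) else g x / (cis (2 * pi * x) - 1))"
  interpret g: periodic_fun_simple' g by unfold_locales (rule per)
  show "g x = (cis (2 * pi * x) - 1) * h x" for x
    using g.of_int zero cis_2pi_eq_1_iff[of x] by (auto simp: h_def elim!: Ints_cases)
  interpret h: periodic_fun_simple' h
  proof
    fix x :: real
    have "x + 1 \<in> \<int> \<longleftrightarrow> x \<in> \<int>" by (metis Ints_1 Ints_add Ints_diff add_diff_cancel)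
    moreover have "cis (2 * pi * (x + 1)) = cis (2 * pi * x)"
      by (simp add: ring_distribs flip: cis_mult)
    ultimately show "h (x + 1) = h x" by (simp add: h_def per)
  qed
  have "isCont h x" for x
  proof (cases "x \<in> \<int>")
    case True
    then obtain k where k: "x = of_int k" by (elim Ints_cases)
    have "isCont h 0" unfolding h_def by (rule isCont_difference_quotient_cis[OF d zero])
    hence "isCont (\<lambda>u. h (u - x)) x" by (intro isCont_o2[of x "\<lambda>u. u - x" h]) auto
    thus ?thesis by (simp add: k h.minus_of_int)
  next
    case False
    have "eventually (\<lambda>u. u \<in> - \<int>) (nhds x)"
      using False closed_Ints by (intro eventually_nhds_in_open) (auto simp: open_Compl)
    hence "eventually (\<lambda>u. h u = g u / (cis (2 * pi * u) - 1)) (nhds x)"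
      by eventually_elim (simp add: h_def)
    moreover have "isCont (\<lambda>u. g u / (cis (2 * pi * u) - 1)) x"
      using g False cis_2pi_eq_1_iff[of x]
        has_vector_derivative_continuous[OF has_vector_derivative_cis_mult[of "2 * pi" x UNIV]]
      by (intro continuous_intros) (auto simp: continuous_on_eq_continuous_at)
    ultimately show ?thesis by (simp add: isCont_cong)
  qed
  thus "continuous_on UNIV h" by (intro continuous_at_imp_continuous_on) auto
qed

lemma sum_symmetric_int_Suc:
  "(\<Sum>n=-int (Suc N)..int (Suc N). F n) = F (- int (Suc N)) + F (int (Suc N)) + (\<Sum>n=-int N..int N. F n)"
proof -
  have "{-int (Suc N)..int (Suc N)} = insert (-int (Suc N)) (insert (int (Suc N)) {-int N..int N})"
    by auto
  thus ?thesis by (simp add: add.assoc)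
qed

text \<open>Chernoff's argument: writing \<open>g x = (e(x) - 1) h x\<close> makes the Fourier series at \<open>0\<close> telescope.\<close>

lemma fourier_series_0:
  assumes "continuous_on UNIV g" "\<And>x. g (x + 1) = g x"
    and "(g has_vector_derivative d) (at 0)" "g 0 = 0"
  shows "(\<lambda>N. \<Sum>n=-int N..int N. fourier_coeff g n) \<longlonglongrightarrow> 0"
proof -
  obtain h where "continuous_on UNIV h" and gh: "\<And>x. g x = (cis (2 * pi * x) - 1) * h x"
    using ex_continuous_cis_minus_1_mult[OF assms] by blast
  hence h: "continuous_on {0..1} h" by (auto intro: continuous_on_subset)
  have coeff: "fourier_coeff g n = fourier_coeff h (n - 1) - fourier_coeff h n" for n
    using fourier_coeff_cis_minus_1_mult[OF h] by (simp flip: gh)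
  have telescope: "(\<Sum>n=-int N..int N. fourier_coeff g n) =
      fourier_coeff h (- int (Suc N)) - fourier_coeff h (int N)" for N
  proof (induction N)
    case (Suc N)
    thus ?case unfolding sum_symmetric_int_Suc by (simp add: coeff)
  qed (simp add: coeff)
  have "(\<lambda>N. fourier_coeff h (- int (Suc N)) - fourier_coeff h (int N)) \<longlonglongrightarrow> 0 - 0"
    by (intro tendsto_diff riemann_lebesgue h) (auto simp: inj_def)
  thus ?thesis by (simp only: telescope diff_self)
qed

lemma integral_periodic_shift:
  fixes g :: "real \<Rightarrow> complex"
  assumes g: "continuous_on UNIV g" and per: "\<And>x. g (x + 1) = g x"
  shows "integral {0..1} (\<lambda>u. g (u + a)) = integral {0..1} g"
proof -
  interpret periodic_fun_simple' g by unfold_locales (rule per)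
  have cont: "continuous_on A g" for A using g continuous_on_subset by blast
  have shift: "integral {c..d} (\<lambda>u. g (u + a)) = integral {c+a..d+a} g" for c d a
    using integral_shift[of c a d g] cont by (simp add: o_def)
  define k where "k = \<lfloor>a\<rfloor>"
  have k: "of_int k \<le> a" "a \<le> of_int k + 1" unfolding k_def by linarith+
  have "integral {0..1} (\<lambda>u. g (u + a)) = integral {a..a+1} g"
    using shift[of 0 1 a] by (simp add: add_ac)
  also have "\<dots> = integral {a..of_int k + 1} g + integral {of_int k + 1..a+1} g"
    using k by (intro Henstock_Kurzweil_Integration.integral_combine[symmetric] integrable_continuous_interval
      cont) auto
  also have "integral {of_int k + 1..a+1} g = integral {of_int k..a} g"
    using shift[of "of_int k" a 1] by (simp add: per)
  also have "integral {a..of_int k + 1} g + integral {of_int k..a} g = integral {of_int k..of_int k + 1} g"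
    using k by (subst add.commute, intro Henstock_Kurzweil_Integration.integral_combine
      integrable_continuous_interval cont) auto
  also have "\<dots> = integral {0..1} g"
    using shift[of 0 1 "of_int k"] by (simp add: plus_of_int add_ac)
  finally show ?thesis .
qed

lemma fourier_coeff_shift:
  assumes g: "continuous_on UNIV g" and per: "\<And>x. g (x + 1) = g x"
  shows "fourier_coeff (\<lambda>u. g (u + a)) n = cis (2 * pi * of_int n * a) * fourier_coeff g n"
proof -
  define \<psi> where "\<psi> = (\<lambda>x. g x * cis (- 2 * pi * of_int n * x))"
  have "cis (- 2 * pi * of_int n) = 1"
    using cis_2pi_eq_1_iff[of "- of_int n"] by (simp add: Ints_minus)
  hence per': "\<psi> (x + 1) = \<psi> x" for x
    by (simp only: \<psi>_def per distrib_left mult_1_right cis_mult[symmetric])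
  have cont: "continuous_on UNIV \<psi>"
    unfolding \<psi>_def by (intro continuous_intros g)
  have "fourier_coeff (\<lambda>u. g (u + a)) n =
        integral {0..1} (\<lambda>u. cis (2 * pi * of_int n * a) * \<psi> (u + a))"
    unfolding fourier_coeff_def
    by (rule integral_cong) (simp add: \<psi>_def cis_mult algebra_simps)
  also have "\<dots> = cis (2 * pi * of_int n * a) * integral {0..1} \<psi>"
    using integral_periodic_shift[OF cont per', of a] by simp
  finally show ?thesis by (simp add: \<psi>_def fourier_coeff_def)
qed

theorem fourier_series:
  assumes g: "continuous_on UNIV g" and per: "\<And>x. g (x + 1) = g x"
    and d: "(g has_vector_derivative d) (at x)"
  shows "(\<lambda>N. \<Sum>n=-int N..int N. fourier_coeff g n * cis (2 * pi * of_int n * x)) \<longlonglongrightarrow> g x"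
proof -
  define k where "k = (\<lambda>u. g (u + x) - g x)"
  have cont: "continuous_on UNIV (\<lambda>u. g (u + x))"
    by (intro continuous_on_compose2[OF g] continuous_intros) auto
  have "(\<lambda>N. \<Sum>n=-int N..int N. fourier_coeff k n) \<longlonglongrightarrow> 0"
  proof (rule fourier_series_0)
    show "continuous_on UNIV k" unfolding k_def by (intro continuous_intros cont)
    show "k (u + 1) = k u" for u using per[of "u + x"] by (simp add: k_def add_ac)
    have "(g \<circ> (\<lambda>u. u + x) has_vector_derivative 1 *\<^sub>R d) (at 0)"
      using d by (intro vector_diff_chain_at) (auto intro!: derivative_eq_intros)
    thus "(k has_vector_derivative d) (at 0)"
      unfolding k_def by (auto intro!: derivative_eq_intros simp: o_def)
  qed (simp add: k_def)
  moreover have "fourier_coeff k n = fourier_coeff g n * cis (2 * pi * of_int n * x) - (if n = 0 then g x else 0)"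
    for n
  proof -
    have "fourier_coeff k n = fourier_coeff (\<lambda>u. g (u + x)) n - integral {0..1}
        (\<lambda>u. g x * cis (2 * pi * of_int (- n) * u))"
      unfolding fourier_coeff_def k_def left_diff_distrib
      by (subst integral_diff; (intro integrable_mult_cis continuous_on_subset[OF cont] continuous_intros)?) simp_all
    thus ?thesis
      unfolding integral_mult_right integral_cis_2pi by (simp add: fourier_coeff_shift[OF g per] mult.commute)
  qed
  ultimately have "(\<lambda>N. (\<Sum>n=-int N..int N. fourier_coeff g n * cis (2 * pi * of_int n * x)) - g x) \<longlonglongrightarrow> 0"
    by (simp add: sum_subtractf sum.delta)
  thus ?thesis by (simp add: LIM_zero_iff)
qed

lemma sum_cis_roots:
  fixes m :: int
  assumes a: "a > 0"
  shows "(\<Sum>b<a. cis (2 * pi * (of_int m * real b / real a))) = (if int a dvd m then of_nat a else 0)"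
proof -
  define z where "z = cis (2 * pi * (of_int m / real a))"
  have pow: "cis (2 * pi * (of_int m * real b / real a)) = z ^ b" for b
    by (simp add: z_def Complex.DeMoivre field_simps)
  have "z = 1 \<longleftrightarrow> of_int m / real a \<in> \<int>" unfolding z_def by (rule cis_2pi_eq_1_iff)
  hence z1: "z = 1 \<longleftrightarrow> int a dvd m" using a of_int_div_of_int_in_Ints_iff[of m "int a", where ?'a = real] by simp
  have "z ^ a = 1"
    using a cis_2pi_eq_1_iff[of "of_int m"] by (simp add: z_def Complex.DeMoivre)
  thus ?thesis unfolding pow using z1 a by (auto simp: geometric_sum)
qed

lemma sum_integral_affine:
  fixes \<psi> :: "real \<Rightarrow> complex"
  assumes \<psi>: "continuous_on {0..1} \<psi>" and d: "d > 0"
  shows "(\<Sum>b<d. integral {0..1} (\<lambda>t. \<psi> ((t + real b) / real d))) = of_nat d * integral {0..1} \<psi>"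
proof -
  define F where "F = (\<lambda>u. integral {0..u} \<psi>)"
  have F: "(F has_vector_derivative \<psi> x) (at x within {0..1})" if "x \<in> {0..1}" for x
    unfolding F_def using \<psi> that by (rule integral_has_vector_derivative)
  have pieces: "((\<lambda>t. \<psi> ((t + real b) / real d)) has_integral
          (of_nat d * F ((1 + real b) / real d) - of_nat d * F ((0 + real b) / real d))) {0..1}" if b: "b < d" for b
  proof (rule fundamental_theorem_of_calculus)
    fix x :: real assume x: "x \<in> {0..1}"
    have sub: "(\<lambda>t. (t + real b) / real d) ` {0..1} \<subseteq> {0..1}"
      using b by (auto simp: field_simps)
    hence "(x + real b) / real d \<in> {0..1}" using x by blast
    moreover have "((\<lambda>t. (t + real b) / real d) has_vector_derivative (1 / real d)) (at x within {0..1})"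
      by (rule derivative_eq_intros refl | use d in simp)+
    ultimately have "(F \<circ> (\<lambda>t. (t + real b) / real d) has_vector_derivative (1 / real d) *\<^sub>R \<psi>
        ((x + real b) / real d))
             (at x within {0..1})"
      by (intro vector_diff_chain_within has_vector_derivative_within_subset[OF F sub])
    from has_vector_derivative_mult_right[OF this, of "of_nat d"]
    show "((\<lambda>t. of_nat d * F ((t + real b) / real d)) has_vector_derivative \<psi> ((x + real b) / real d))
        (at x within {0..1})"
      using d by (simp add: o_def scaleR_conv_of_real)
  qed simp
  have "(\<Sum>b<d. integral {0..1} (\<lambda>t. \<psi> ((t + real b) / real d))) =
        (\<Sum>b<d. of_nat d * F (real (Suc b) / real d) - of_nat d * F (real b / real d))"
    using pieces by (intro sum.cong refl) (auto simp: integral_unique add_ac)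
  also have "\<dots> = of_nat d * F 1 - of_nat d * F 0"
    using d sum_lessThan_telescope[of "\<lambda>b. of_nat d * F (real b / real d)" d] by simp
  finally show ?thesis by (simp add: F_def)
qed

lemma fourier_coeff_average:
  assumes g: "continuous_on UNIV g" and d: "d > 0"
  shows "fourier_coeff (\<lambda>t. \<Sum>b<d. g ((t + real b) / real d)) k = of_nat d * fourier_coeff g (k * int d)"
proof -
  define \<psi> where "\<psi> = (\<lambda>u. g u * cis (- 2 * pi * of_int (k * int d) * u))"
  have cont: "continuous_on {0..1} \<psi>"
    unfolding \<psi>_def by (intro continuous_intros continuous_on_subset[OF g]) auto
  have \<psi>: "\<psi> ((t + real b) / real d) = g ((t + real b) / real d) * cis (- 2 * pi * of_int k * t)" for t b
  proof -
    have "cis (- 2 * pi * of_int (k * int d) * ((t + real b) / real d)) =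
          cis (- 2 * pi * of_int k * t) * cis (2 * pi * of_int (- k * int b))"
      unfolding cis_mult by (rule arg_cong[of _ _ cis]) (use d in \<open>simp add: field_simps\<close>)
    also have "cis (2 * pi * of_int (- k * int b)) = 1"
      by (subst cis_2pi_eq_1_iff) (rule Ints_of_int)
    finally show ?thesis by (simp add: \<psi>_def)
  qed
  have "fourier_coeff (\<lambda>t. \<Sum>b<d. g ((t + real b) / real d)) k =
        integral {0..1} (\<lambda>t. \<Sum>b<d. \<psi> ((t + real b) / real d))"
    unfolding fourier_coeff_def \<psi> by (simp add: sum_distrib_right)
  also have "\<dots> = (\<Sum>b<d. integral {0..1} (\<lambda>t. \<psi> ((t + real b) / real d)))"
    unfolding \<psi>
    by (intro integral_sum integrable_mult_cis continuous_on_compose2[OF g] continuous_intros) (use d in auto)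
  also have "\<dots> = of_nat d * integral {0..1} \<psi>"
    by (rule sum_integral_affine[OF cont d])
  finally show ?thesis by (simp add: \<psi>_def fourier_coeff_def)
qed

lemma fourier_coeff_dilate:
  assumes g: "continuous_on UNIV g" and per: "\<And>x. g (x + 1) = g x" and a: "a > 0"
  shows "fourier_coeff (\<lambda>x. g (real a * x)) m = (if int a dvd m then fourier_coeff g (m div int a) else 0)"
proof -
  interpret periodic_fun_simple' g by unfold_locales (rule per)
  define \<psi> where "\<psi> = (\<lambda>u. g (real a * u) * cis (- 2 * pi * of_int m * u))"
  have cont: "continuous_on {0..1} \<psi>"
    unfolding \<psi>_def by (intro continuous_intros continuous_on_compose2[OF g]) auto
  define I where "I = integral {0..1} (\<lambda>t. g t * cis (- 2 * pi * of_int m / real a * t))"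
  have \<psi>: "\<psi> ((t + real b) / real a) =
      cis (2 * pi * (of_int (- m) * real b / real a)) * (g t * cis (- 2 * pi * of_int m / real a * t))" for t b
  proof -
    have "g (real a * ((t + real b) / real a)) = g t"
      using a plus_of_nat[of t b] by simp
    moreover have "cis (- 2 * pi * of_int m * ((t + real b) / real a)) =
       cis (2 * pi * (of_int (- m) * real b / real a)) * cis (- 2 * pi * of_int m / real a * t)"
      unfolding cis_mult by (rule arg_cong[of _ _ cis]) (use a in \<open>simp add: field_simps\<close>)
    ultimately show ?thesis by (simp add: \<psi>_def)
  qed
  have "of_nat a * integral {0..1} \<psi> = (\<Sum>b<a. integral {0..1} (\<lambda>t. \<psi> ((t + real b) / real a)))"
    by (rule sum_integral_affine[OF cont a, symmetric])
  also have "\<dots> = (\<Sum>b<a. cis (2 * pi * (of_int (- m) * real b / real a))) * I"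
    unfolding \<psi> integral_mult_right I_def sum_distrib_right ..
  also have "\<dots> = (if int a dvd m then of_nat a else 0) * I"
    using sum_cis_roots[OF a, of "-m"] by simp
  finally have "of_nat a * integral {0..1} \<psi> = (if int a dvd m then of_nat a else 0) * I" .
  moreover have "I = fourier_coeff g (m div int a)" if "int a dvd m"
    using that a unfolding I_def fourier_coeff_def by (auto simp: dvd_def mult_ac)
  moreover have "fourier_coeff (\<lambda>x. g (real a * x)) m = integral {0..1} \<psi>"
    by (simp add: fourier_coeff_def \<psi>_def)
  ultimately show ?thesis using a by (cases "int a dvd m") simp_all
qed

lemma sum_lessThan_shift_periodic:
  fixes G :: "nat \<Rightarrow> 'a :: ab_group_add"
  assumes "G d = G 0"
  shows "(\<Sum>b<d. G (Suc b)) = (\<Sum>b<d. G b)"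
proof -
  have "(\<Sum>b<d. G (Suc b)) + G 0 = (\<Sum>b<d. G b) + G d"
    by (metis add.commute sum.lessThan_Suc sum.lessThan_Suc_shift)
  thus ?thesis using assms by simp
qed

lemma fourier_coeff_hecke_average:
  assumes g: "continuous_on UNIV g" and per: "\<And>x. g (x + 1) = g x" and "a > 0" and d: "d > 0"
  shows "fourier_coeff (\<lambda>x. \<Sum>b<d. g ((real a * x + real b) / real d)) m =
           (if int a dvd m then of_nat d * fourier_coeff g (m div int a * int d) else 0)"
proof -
  define \<phi> where "\<phi> = (\<lambda>t. \<Sum>b<d. g ((t + real b) / real d))"
  have "continuous_on UNIV \<phi>"
    unfolding \<phi>_def by (intro continuous_intros continuous_on_compose2[OF g]) (use d in auto)
  moreover have "\<phi> (t + 1) = \<phi> t" for t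
  proof -
    have "(t + real d) / real d = t / real d + 1" using d by (simp add: field_simps)
    hence "(\<Sum>b<d. g ((t + real (Suc b)) / real d)) = (\<Sum>b<d. g ((t + real b) / real d))"
      using per[of "t / real d"] by (intro sum_lessThan_shift_periodic) simp
    thus ?thesis by (simp add: \<phi>_def add_ac)
  qed
  ultimately have "fourier_coeff (\<lambda>x. \<phi> (real a * x)) m = (if int a dvd m then fourier_coeff \<phi> (m div int a) else 0)"
    using \<open>a > 0\<close> by (rule fourier_coeff_dilate)
  thus ?thesis by (simp add: \<phi>_def fourier_coeff_average[OF g d])
qed

section \<open>Recessive solutions of the radial equation\<close>

lemma gronwall:
  fixes n n' :: "real \<Rightarrow> real"
  assumes deriv: "\<And>t. t \<in> {a..b} \<Longrightarrow> (n has_real_derivative n' t) (at t)"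
    and bound: "\<And>t. t \<in> {a..b} \<Longrightarrow> \<bar>n' t\<bar> \<le> K * n t"
    and xy: "x \<in> {a..b}" "y \<in> {a..b}"
  shows "n y \<le> n x * exp (K * \<bar>y - x\<bar>)"
proof (cases "x \<le> y")
  case True
  have "n y * exp (- K * y) \<le> n x * exp (- K * x)"
  proof (rule DERIV_nonpos_imp_nonincreasing[OF True])
    fix t assume "x \<le> t" "t \<le> y"
    hence t: "t \<in> {a..b}" using xy by auto
    have "((\<lambda>t. n t * exp (- K * t)) has_real_derivative (n' t - K * n t) * exp (- K * t)) (at t)"
      by (rule derivative_eq_intros deriv[OF t] refl)+ (simp add: algebra_simps)
    moreover have "(n' t - K * n t) * exp (- K * t) \<le> 0"
      using bound[OF t] by (simp add: mult_nonpos_nonneg abs_le_iff)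
    ultimately show "\<exists>d. ((\<lambda>t. n t * exp (- K * t)) has_real_derivative d) (at t) \<and> d \<le> 0" by blast
  qed
  thus ?thesis using True by (simp add: exp_minus exp_diff field_simps)
next
  case False
  hence "y \<le> x" by simp
  have "n y * exp (K * y) \<le> n x * exp (K * x)"
  proof (rule DERIV_nonneg_imp_nondecreasing[OF \<open>y \<le> x\<close>])
    fix t assume "y \<le> t" "t \<le> x"
    hence t: "t \<in> {a..b}" using xy by auto
    have "((\<lambda>t. n t * exp (K * t)) has_real_derivative (n' t + K * n t) * exp (K * t)) (at t)"
      by (rule derivative_eq_intros deriv[OF t] refl)+ (simp add: algebra_simps)
    moreover have "0 \<le> (n' t + K * n t) * exp (K * t)"
      using bound[OF t] by (simp add: abs_le_iff)
    ultimately show "\<exists>d. ((\<lambda>t. n t * exp (K * t)) has_real_derivative d) (at t) \<and> 0 \<le> d" by blast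
  qed
  thus ?thesis using False by (simp add: exp_diff field_simps)
qed

lemma linear_ode2_unique:
  fixes W W' k :: "real \<Rightarrow> complex"
  assumes W: "\<And>t. t \<in> {a..b} \<Longrightarrow> (W has_vector_derivative W' t) (at t)"
    and W': "\<And>t. t \<in> {a..b} \<Longrightarrow> (W' has_vector_derivative k t * W t) (at t)"
    and k: "\<And>t. t \<in> {a..b} \<Longrightarrow> norm (k t) \<le> K"
    and zero: "W x = 0" "W' x = 0" and xy: "x \<in> {a..b}" "y \<in> {a..b}"
  shows "W y = 0"
proof -
  define n where "n = (\<lambda>t. W t \<bullet> W t + W' t \<bullet> W' t)"
  define n' where "n' = (\<lambda>t. 2 * (W t \<bullet> W' t) + 2 * (W' t \<bullet> (k t * W t)))"
  have "n y \<le> n x * exp ((1 + K) * \<bar>y - x\<bar>)"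
  proof (rule gronwall[OF _ _ xy])
    fix t assume t: "t \<in> {a..b}"
    have square: "((\<lambda>t. Z t \<bullet> Z t) has_real_derivative 2 * (Z t \<bullet> z)) (at t)"
      if "(Z has_vector_derivative z) (at t)" for Z z
      using bounded_bilinear.has_vector_derivative[OF bounded_bilinear_inner that that]
      by (simp add: has_real_derivative_iff_has_vector_derivative inner_commute)
    show "(n has_real_derivative n' t) (at t)"
      unfolding n_def n'_def by (intro DERIV_add square W W' t)
    define p q where "p = norm (W t)" and "q = norm (W' t)"
    have "\<bar>W t \<bullet> W' t\<bar> \<le> p * q" unfolding p_def q_def by (rule Cauchy_Schwarz_ineq2)
    moreover have "\<bar>W' t \<bullet> (k t * W t)\<bar> \<le> q * (K * p)"
      using k[OF t] by (intro order.trans[OF Cauchy_Schwarz_ineq2])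
        (auto simp: p_def q_def norm_mult intro!: mult_left_mono mult_right_mono)
    ultimately have "\<bar>n' t\<bar> \<le> (1 + K) * (2 * p * q)"
      by (simp add: n'_def algebra_simps)
    also have "\<dots> \<le> (1 + K) * (p\<^sup>2 + q\<^sup>2)"
      using sum_squares_bound[of p q] order.trans[OF norm_ge_zero k[OF t]] by (intro mult_left_mono) auto
    finally show "\<bar>n' t\<bar> \<le> (1 + K) * n t" by (simp add: n_def p_def q_def power2_norm_eq_inner)
  qed
  hence "W y \<bullet> W y + W' y \<bullet> W' y \<le> 0" by (simp add: n_def zero)
  thus ?thesis by (smt (verit) inner_ge_zero inner_eq_zero_iff)
qed

definition radial_solution :: "real \<Rightarrow> complex \<Rightarrow> (real \<Rightarrow> complex) \<Rightarrow> (real \<Rightarrow> complex) \<Rightarrow> bool" where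
  "radial_solution \<omega> \<mu> W W' \<longleftrightarrow>
     (\<forall>y>0. (W has_vector_derivative W' y) (at y) \<and>
            (W' has_vector_derivative (of_real (\<omega>\<^sup>2) - \<mu> / of_real (y\<^sup>2)) * W y) (at y))"

lemma radial_solutionD:
  assumes "radial_solution \<omega> \<mu> W W'" "y > 0"
  shows "(W has_vector_derivative W' y) (at y)"
    and "(W' has_vector_derivative (of_real (\<omega>\<^sup>2) - \<mu> / of_real (y\<^sup>2)) * W y) (at y)"
  using assms by (auto simp: radial_solution_def)

lemma radial_solution_diff_cmult:
  assumes "radial_solution \<omega> \<mu> W W'" "radial_solution \<omega> \<mu> B B'"
  shows "radial_solution \<omega> \<mu> (\<lambda>y. W y - c * B y) (\<lambda>y. W' y - c * B' y)"
  unfolding radial_solution_def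
proof (intro allI impI conjI)
  fix y :: real assume y: "y > 0"
  show "((\<lambda>y. W y - c * B y) has_vector_derivative W' y - c * B' y) (at y)"
    by (intro has_vector_derivative_diff has_vector_derivative_mult_right radial_solutionD(1)[OF assms(1)]
          radial_solutionD(1)[OF assms(2)] y)
  have "((\<lambda>y. W' y - c * B' y) has_vector_derivative
      (of_real (\<omega>\<^sup>2) - \<mu> / of_real (y\<^sup>2)) * W y - c * ((of_real (\<omega>\<^sup>2) - \<mu> / of_real (y\<^sup>2)) * B y)) (at y)"
    by (intro has_vector_derivative_diff has_vector_derivative_mult_right radial_solutionD(2)[OF assms(1)]
          radial_solutionD(2)[OF assms(2)] y)
  thus "((\<lambda>y. W' y - c * B' y) has_vector_derivative (of_real (\<omega>\<^sup>2) - \<mu> / of_real (y\<^sup>2)) * (W y - c * B y)) (at y)"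
    by (simp add: right_diff_distrib mult.left_commute)
qed

lemma norm_radial_coefficient_le:
  assumes "c > 0" "y \<ge> c"
  shows "norm (complex_of_real (\<omega>\<^sup>2) - \<mu> / of_real (y\<^sup>2)) \<le> \<omega>\<^sup>2 + norm \<mu> / c\<^sup>2"
proof -
  have "norm (complex_of_real (\<omega>\<^sup>2) - \<mu> / of_real (y\<^sup>2)) \<le> \<omega>\<^sup>2 + norm \<mu> / y\<^sup>2"
    by (rule order.trans[OF norm_triangle_ineq4]) (simp add: norm_divide norm_power)
  also have "\<dots> \<le> \<omega>\<^sup>2 + norm \<mu> / c\<^sup>2"
    using assms by (intro add_left_mono divide_left_mono power_mono) auto
  finally show ?thesis .
qed

lemma radial_solution_unique:
  assumes W: "radial_solution \<omega> \<mu> W W'" and zero: "W x = 0" "W' x = 0" and pos: "x > 0" "y > 0"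
  shows "W y = 0"
proof (rule linear_ode2_unique)
  fix t assume t: "t \<in> {min x y..max x y}"
  hence "t > 0" using pos by (auto simp: min_def split: if_splits)
  show "(W has_vector_derivative W' t) (at t)"
    "(W' has_vector_derivative (of_real (\<omega>\<^sup>2) - \<mu> / of_real (t\<^sup>2)) * W t) (at t)"
    using radial_solutionD[OF W \<open>t > 0\<close>] .
  show "norm (of_real (\<omega>\<^sup>2) - \<mu> / of_real (t\<^sup>2)) \<le> \<omega>\<^sup>2 + norm \<mu> / (min x y)\<^sup>2"
    using t pos by (intro norm_radial_coefficient_le) auto
qed (use zero in auto)

lemma power_mult_exp_minus_le:
  fixes a x :: real
  assumes "a > 0" "x \<ge> 0"
  shows "x ^ B * exp (- a * x) \<le> (real B / a) ^ B"
proof (cases "B = 0")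
  case False
  have "x ^ B = (real B / a) ^ B * (a * x / real B) ^ B"
    using assms False by (simp add: power_mult_distrib[symmetric])
  also have "\<dots> \<le> (real B / a) ^ B * (exp (a * x / real B)) ^ B"
    using assms by (intro mult_left_mono power_mono) (auto intro: order.trans[OF _ exp_ge_add_one_self])
  also have "(exp (a * x / real B)) ^ B = exp (a * x)"
    using False by (simp flip: exp_of_nat_mult)
  finally have "x ^ B * exp (- a * x) \<le> (real B / a) ^ B * exp (a * x) * exp (- a * x)"
    by (intro mult_right_mono) auto
  thus ?thesis by (simp add: mult.assoc flip: exp_add)
qed (use assms in auto)

lemma radial_solution_deriv_growth:
  assumes W: "radial_solution \<omega> \<mu> W W'" and growth: "\<And>y. y \<ge> 1 \<Longrightarrow> norm (W y) \<le> C * y ^ m"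
  shows "\<exists>D\<ge>0. \<forall>y\<ge>1. norm (W' y) \<le> D * y ^ Suc m"
proof -
  have C: "C \<ge> 0" using order.trans[OF norm_ge_zero growth[of 1]] by simp
  define k where "k = \<omega>\<^sup>2 + norm \<mu>"
  have "norm (W' y) \<le> (norm (W' 1) + k * C) * y ^ Suc m" if y: "y \<ge> 1" for y
  proof -
    have "norm (W' y - W' 1) \<le> k * (C * y ^ m) * norm (y - 1)"
    proof (rule differentiable_bound[of "{1..y}"])
      fix t assume t: "t \<in> {1..y}"
      have "(W' has_vector_derivative (of_real (\<omega>\<^sup>2) - \<mu> / of_real (t\<^sup>2)) * W t) (at t)"
        using t by (intro radial_solutionD(2)[OF W]) auto
      thus "(W' has_derivative (\<lambda>h. h *\<^sub>R ((of_real (\<omega>\<^sup>2) - \<mu> / of_real (t\<^sup>2)) * W t))) (at t within {1..y})"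
        unfolding has_vector_derivative_def by (rule has_derivative_at_withinI)
      have "C * t ^ m \<le> C * y ^ m" using C t by (intro mult_left_mono power_mono) auto
      hence "norm (W t) \<le> C * y ^ m" using growth[of t] t by simp
      hence "norm ((of_real (\<omega>\<^sup>2) - \<mu> / of_real (t\<^sup>2)) * W t) \<le> k * (C * y ^ m)"
        using norm_radial_coefficient_le[of 1 t \<omega> \<mu>] t unfolding norm_mult k_def by (intro mult_mono) auto
      thus "onorm (\<lambda>h. h *\<^sub>R ((of_real (\<omega>\<^sup>2) - \<mu> / of_real (t\<^sup>2)) * W t)) \<le> k * (C * y ^ m)"
        by (intro onorm_le) (simp only: norm_scaleR real_norm_def mult.commute[of "\<bar>_\<bar>"] mult_right_mono abs_ge_zero)
    qed (use y in auto)
    also have "\<dots> \<le> k * (C * y ^ m) * y"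
      using y C by (intro mult_left_mono) (auto simp: k_def)
    finally have "norm (W' y - W' 1) \<le> k * C * y ^ Suc m" by (simp add: mult_ac)
    moreover have "norm (W' 1) * 1 \<le> norm (W' 1) * y ^ Suc m" using y by (intro mult_left_mono one_le_power) auto
    ultimately show ?thesis using norm_triangle_sub[of "W' y" "W' 1"] by (simp only: distrib_right)
  qed
  moreover have "norm (W' 1) + k * C \<ge> 0" using C by (simp add: k_def)
  ultimately show ?thesis by blast
qed

lemma radial_wronskian_constant:
  assumes W: "radial_solution \<omega> \<mu> W W'" and B: "radial_solution \<omega> \<mu> B B'"
  shows "\<exists>w. \<forall>y>0. W y * B' y - W' y * B y = w"
proof -
  have "((\<lambda>y. W y * B' y - W' y * B y) has_vector_derivative 0) (at y within {0<..})" if "y \<in> {0<..}" for y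
  proof -
    have y: "y > 0" using that by simp
    define k where "k = of_real (\<omega>\<^sup>2) - \<mu> / complex_of_real (y\<^sup>2)"
    note derivs = radial_solutionD[OF W y, folded k_def] radial_solutionD[OF B y, folded k_def]
    have "((\<lambda>y. W y * B' y - W' y * B y) has_vector_derivative
        (W y * (k * B y) + W' y * B' y) - (W' y * B' y + k * W y * B y)) (at y)"
      by (intro has_vector_derivative_diff has_vector_derivative_mult derivs)
    thus ?thesis by (auto simp: algebra_simps intro: has_vector_derivative_at_within)
  qed
  then obtain w where "\<And>y. y > 0 \<Longrightarrow> W y * B' y - W' y * B y = w"
    using has_vector_derivative_zero_constant[of "{0<..}" "\<lambda>y. W y * B' y - W' y * B y"] by auto
  thus ?thesis by blast
qed

lemma radial_wronskian_eq_0: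
  assumes W: "radial_solution \<omega> \<mu> W W'" and B: "radial_solution \<omega> \<mu> B B'"
    and growth: "\<And>y. y \<ge> 1 \<Longrightarrow> norm (W y) \<le> C * y ^ m" and "\<delta> > 0"
    and decay: "\<And>y. y \<ge> 1 \<Longrightarrow> norm (B y) \<le> K * exp (- \<delta> * y)" "\<And>y. y \<ge> 1 \<Longrightarrow> norm (B' y) \<le> K * exp (- \<delta> * y)"
    and "y > 0"
  shows "W y * B' y = W' y * B y"
proof -
  obtain D where D: "D \<ge> 0" "\<And>y. y \<ge> 1 \<Longrightarrow> norm (W' y) \<le> D * y ^ Suc m"
    using radial_solution_deriv_growth[OF W growth] by blast
  have C: "C \<ge> 0" using order.trans[OF norm_ge_zero growth[of 1]] by simp
  have K: "K * exp (- \<delta> * y) \<ge> 0" if "y \<ge> 1" for y using order.trans[OF norm_ge_zero decay(1)[OF that]] .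
  obtain w where w: "\<And>y. y > 0 \<Longrightarrow> W y * B' y - W' y * B y = w"
    using radial_wronskian_constant[OF W B] by blast
  define E where "E = (C + D) * K * (real (m + 2) / \<delta>) ^ (m + 2)"
  have bound: "norm w * y \<le> E" if y: "y \<ge> 1" for y
  proof -
    have "norm w \<le> norm (W y) * norm (B' y) + norm (W' y) * norm (B y)"
      using w[of y] y norm_triangle_ineq4[of "W y * B' y" "W' y * B y"] by (simp add: norm_mult)
    also have "\<dots> \<le> (C * y ^ Suc m) * (K * exp (- \<delta> * y)) + (D * y ^ Suc m) * (K * exp (- \<delta> * y))"
    proof (intro add_mono mult_mono decay D)
      have "C * y ^ m \<le> C * y ^ Suc m" using C y by (intro mult_left_mono power_increasing) auto
      thus "norm (W y) \<le> C * y ^ Suc m" using growth[OF y] by linarith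
    qed (use y C D in auto)
    finally have "norm w * y \<le> ((C * y ^ Suc m) * (K * exp (- \<delta> * y)) + (D * y ^ Suc m) * (K * exp (- \<delta> * y))) * y"
      using y by (intro mult_right_mono) auto
    also have "\<dots> = (C + D) * K * (y ^ (m + 2) * exp (- \<delta> * y))" by (simp add: algebra_simps)
    also have "\<dots> \<le> E"
      unfolding E_def using C D K[of 1] y \<open>\<delta> > 0\<close>
      by (intro mult_left_mono power_mult_exp_minus_le) (auto simp: zero_le_mult_iff)
    finally show ?thesis .
  qed
  have "w = 0"
  proof (rule ccontr)
    assume "w \<noteq> 0"
    define y where "y = max 1 ((E + 1) / norm w)"
    have "norm w * ((E + 1) / norm w) \<le> norm w * y" by (intro mult_left_mono) (auto simp: y_def)
    also have "\<dots> \<le> E" by (rule bound) (simp add: y_def)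
    finally show False using \<open>w \<noteq> 0\<close> by simp
  qed
  thus ?thesis using w[OF \<open>y > 0\<close>] by simp
qed

lemma recessive_solutions_proportional:
  assumes W: "radial_solution \<omega> \<mu> W W'" and B: "radial_solution \<omega> \<mu> B B'"
    and "\<And>y. y \<ge> 1 \<Longrightarrow> norm (W y) \<le> C * y ^ m" "\<delta> > 0"
    and "\<And>y. y \<ge> 1 \<Longrightarrow> norm (B y) \<le> K * exp (- \<delta> * y)" "\<And>y. y \<ge> 1 \<Longrightarrow> norm (B' y) \<le> K * exp (- \<delta> * y)"
    and x: "x > 0" "B x \<noteq> 0"
  shows "\<exists>c. \<forall>y>0. W y = c * B y"
proof (intro exI allI impI)
  define c where "c = W x / B x"
  have "W x * B' x = W' x * B x"
    using assms by (intro radial_wronskian_eq_0[where \<delta> = \<delta>])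
  hence "W' x - c * B' x = 0" using x by (simp add: c_def field_simps)
  moreover have "W x - c * B x = 0" using x by (simp add: c_def)
  ultimately have "W y - c * B y = 0" if "y > 0" for y
    using radial_solution_unique[OF radial_solution_diff_cmult[OF W B]] x that by blast
  thus "W y = c * B y" if "y > 0" for y using that by simp
qed

section \<open>Mellin transforms in logarithmic coordinates\<close>

lemma has_field_derivative_integral_dominated:
  fixes F F' :: "complex \<Rightarrow> 'a \<Rightarrow> complex"
  assumes S: "open S" "convex S" "z \<in> S"
    and integrable: "\<And>w. w \<in> S \<Longrightarrow> integrable M (F w)"
    and deriv: "\<And>w t. w \<in> S \<Longrightarrow> ((\<lambda>w. F w t) has_field_derivative F' w t) (at w)"
    and bound: "\<And>w t. w \<in> S \<Longrightarrow> norm (F' w t) \<le> g t" and g: "integrable M g"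
  shows "((\<lambda>w. \<integral>t. F w t \<partial>M) has_field_derivative (\<integral>t. F' z t \<partial>M)) (at z)"
proof -
  have "(\<lambda>i. ((\<integral>t. F (X i) t \<partial>M) - (\<integral>t. F z t \<partial>M)) / (X i - z)) \<longlonglongrightarrow> (\<integral>t. F' z t \<partial>M)"
    if X: "\<And>i. X i \<in> S - {z}" "X \<longlonglongrightarrow> z" for X
  proof -
    define Q where "Q = (\<lambda>i t. (F (X i) t - F z t) / (X i - z))"
    have Q_integrable: "integrable M (Q i)" for i
      using X(1) S unfolding Q_def by (intro integrable_divide Bochner_Integration.integrable_diff integrable) auto
    have Q_tendsto: "(\<lambda>i. Q i t) \<longlonglongrightarrow> F' z t" for t
      using deriv[OF S(3), of t] X S
      unfolding has_field_derivative_iff at_within_open[OF S(3) S(1), symmetric] tendsto_at_iff_sequentially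
      by (auto simp: Q_def o_def)
    have Q_bound: "norm (Q i t) \<le> g t" for i t
    proof -
      have "norm (F (X i) t - F z t) \<le> g t * norm (X i - z)"
        using X(1) S deriv bound
        by (intro field_differentiable_bound[OF S(2), of "\<lambda>w. F w t" "\<lambda>w. F' w t"])
           (auto intro: has_field_derivative_at_within)
      thus ?thesis using X(1)[of i] by (simp add: Q_def norm_divide field_simps)
    qed
    have "(\<lambda>i. \<integral>t. Q i t \<partial>M) \<longlonglongrightarrow> (\<integral>t. F' z t \<partial>M)"
    proof (rule integral_dominated_convergence[OF _ _ g])
      show "F' z \<in> borel_measurable M"
        by (rule borel_measurable_LIMSEQ_metric[OF _ Q_tendsto]) (use Q_integrable in auto)
    qed (use Q_integrable Q_tendsto Q_bound in auto)
    moreover have "(\<integral>t. Q i t \<partial>M) = ((\<integral>t. F (X i) t \<partial>M) - (\<integral>t. F z t \<partial>M)) / (X i - z)" for i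
      using X(1) S by (simp add: Q_def Bochner_Integration.integral_diff integrable)
    ultimately show ?thesis by simp
  qed
  thus ?thesis
    unfolding has_field_derivative_iff at_within_open[OF S(3) S(1), symmetric] tendsto_at_iff_sequentially
    by (auto simp: o_def)
qed

definition mellin :: "(real \<Rightarrow> complex) \<Rightarrow> complex \<Rightarrow> complex" where
  "mellin h s = (\<integral>t. h t * exp (s * of_real t) \<partial>lborel)"

lemma mellin_integrable:
  assumes h: "continuous_on UNIV h" and i: "integrable lborel (\<lambda>t. norm (h t) * exp (Re s * t))"
  shows "integrable lborel (\<lambda>t. h t * exp (s * of_real t))"
proof (rule Bochner_Integration.integrable_bound[OF i])
  have "continuous_on UNIV (\<lambda>t. h t * exp (s * of_real t))"
    by (intro continuous_intros h)
  thus "(\<lambda>t. h t * exp (s * of_real t)) \<in> borel_measurable lborel"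
    by (simp add: borel_measurable_continuous_onI)
qed (auto simp: norm_mult)

lemma mellin_has_field_derivative:
  assumes h: "continuous_on UNIV h"
    and i: "\<And>\<sigma>. \<sigma> > a \<Longrightarrow> integrable lborel (\<lambda>t. norm (h t) * exp (\<sigma> * t))" and s: "Re s > a"
  shows "(mellin h has_field_derivative mellin (\<lambda>t. of_real t * h t) s) (at s)"
proof -
  define d where "d = (Re s - a) / 3"
  have d: "d > 0" using s by (simp add: d_def)
  define g where "g = (\<lambda>t. 1 / d * (norm (h t) * exp ((Re s - 2 * d) * t) + norm (h t) * exp ((Re s + 2 * d) * t)))"
  have re: "\<bar>Re w - Re s\<bar> \<le> d" if "w \<in> ball s d" for w
    using abs_Re_le_cmod[of "w - s"] that by (simp add: dist_norm norm_minus_commute)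
  have "((\<lambda>w. \<integral>t. h t * exp (w * of_real t) \<partial>lborel) has_field_derivative
          (\<integral>t. of_real t * h t * exp (s * of_real t) \<partial>lborel)) (at s)"
  proof (rule has_field_derivative_integral_dominated[where g = g])
    have "a < Re s - d" using s by (simp add: d_def field_simps)
    hence "Re w > a" if "w \<in> ball s d" for w using re[OF that] by linarith
    thus "integrable lborel (\<lambda>t. h t * exp (w * of_real t))" if "w \<in> ball s d" for w
      using that by (intro mellin_integrable h i)
    show "((\<lambda>w. h t * exp (w * of_real t)) has_field_derivative of_real t * h t * exp (w * of_real t)) (at w)" for w t
      by (auto intro!: derivative_eq_intros)
    show "norm (of_real t * h t * exp (w * of_real t)) \<le> g t" if w: "w \<in> ball s d" for w t
    proof -
      have "(Re w - Re s) * t \<le> d * \<bar>t\<bar>" using re[OF w] by (metis abs_le_D1 abs_mult mult_right_mono abs_ge_zero)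
      moreover have "d * \<bar>t\<bar> \<le> exp (d * \<bar>t\<bar>)"
        using exp_ge_add_one_self[of "d * \<bar>t\<bar>"] by linarith
      hence "\<bar>t\<bar> \<le> 1 / d * exp (d * \<bar>t\<bar>)"
        using d by (simp add: field_simps)
      ultimately have "\<bar>t\<bar> * exp (Re w * t) \<le> (1 / d * exp (d * \<bar>t\<bar>)) * exp (Re s * t + d * \<bar>t\<bar>)"
        using d by (intro mult_mono) (auto simp: algebra_simps)
      also have "\<dots> \<le> 1 / d * (exp ((Re s - 2 * d) * t) + exp ((Re s + 2 * d) * t))"
        using d by (cases "t \<ge> 0") (auto simp: algebra_simps divide_right_mono simp flip: exp_add)
      finally have "norm (h t) * (\<bar>t\<bar> * exp (Re w * t)) \<le>
          norm (h t) * (1 / d * (exp ((Re s - 2 * d) * t) + exp ((Re s + 2 * d) * t)))"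
        by (rule mult_left_mono) simp
      thus ?thesis by (simp add: g_def norm_mult algebra_simps)
    qed
    show "integrable lborel g"
      unfolding g_def using d by (intro integrable_mult_right Bochner_Integration.integrable_add i)
        (auto simp: d_def field_simps)
  qed (use d in auto)
  thus ?thesis unfolding mellin_def[abs_def] by (simp add: mult_ac)
qed

lemma mellin_holomorphic:
  assumes "continuous_on UNIV h" "\<And>\<sigma>. \<sigma> > a \<Longrightarrow> integrable lborel (\<lambda>t. norm (h t) * exp (\<sigma> * t))"
  shows "mellin h holomorphic_on {s. Re s > a}"
  using mellin_has_field_derivative[OF assms]
  by (auto simp: holomorphic_on_open open_halfspace_Re_gt)

lemma mellin_shift: "mellin (\<lambda>t. h (t + c)) s = exp (- s * of_real c) * mellin h s"
proof -
  have "mellin h s = (\<integral>t. h (c + 1 * t) * exp (s * of_real (c + 1 * t)) \<partial>lborel)"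
    unfolding mellin_def by (subst lborel_integral_real_affine[of 1 _ c]) auto
  also have "\<dots> = (\<integral>t. exp (s * of_real c) * (h (t + c) * exp (s * of_real t)) \<partial>lborel)"
    by (intro Bochner_Integration.integral_cong refl) (simp add: algebra_simps exp_add)
  finally have "mellin h s = exp (s * of_real c) * mellin (\<lambda>t. h (t + c)) s"
    by (simp add: mellin_def)
  thus ?thesis by (simp add: exp_minus)
qed

lemma mellin_mult_exp: "mellin (\<lambda>t. h t * exp (a * of_real t)) p = mellin h (p + a)"
  unfolding mellin_def
  by (intro Bochner_Integration.integral_cong refl) (simp add: ring_distribs exp_add mult_ac)

lemma integrable_exp_minus_abs: "integrable lborel (\<lambda>t::real. exp (- \<bar>t\<bar>))"
proof -
  have "(\<lambda>t::real. exp (- 1 * t)) absolutely_integrable_on {0..}"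
    by (intro nonnegative_absolutely_integrable_1 integrable_on_exp_minus_to_infinity) auto
  hence "integrable lebesgue (\<lambda>t::real. indicator {0..} t * exp (- t))"
    by (simp add: set_integrable_def)
  hence half: "integrable lborel (\<lambda>t::real. indicator {0..} t * exp (- t))"
    by (subst (asm) integrable_completion) auto
  have "integrable lborel (\<lambda>t::real. indicator {0..} (0 + (-1) * t) * exp (- (0 + (-1) * t)))"
    using half by (intro lborel_integrable_real_affine) auto
  from Bochner_Integration.integrable_add[OF half this] show ?thesis
    by (rule Bochner_Integration.integrable_bound) (auto simp: indicator_def)
qed

definition rapid :: "(real \<Rightarrow> complex) \<Rightarrow> bool" where
  "rapid h \<longleftrightarrow> continuous_on UNIV h \<and> (\<forall>m::nat. \<exists>C. \<forall>t. norm (h t) \<le> C * exp (- real m * \<bar>t\<bar>))"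

lemma rapid_continuous: "rapid h \<Longrightarrow> continuous_on UNIV h"
  by (simp add: rapid_def)

lemma rapid_bound:
  assumes "rapid h"
  shows "\<exists>C\<ge>0. \<forall>t. norm (h t) \<le> C * exp (- real m * \<bar>t\<bar>)"
proof -
  obtain C where C: "\<And>t. norm (h t) \<le> C * exp (- real m * \<bar>t\<bar>)" using assms unfolding rapid_def by metis
  have "C \<ge> 0" using order.trans[OF norm_ge_zero C[of 0]] by simp
  with C show ?thesis by blast
qed

lemma rapid_add:
  assumes "rapid g" "rapid h"
  shows "rapid (\<lambda>t. g t + h t)"
  unfolding rapid_def
proof (intro conjI allI)
  show "continuous_on UNIV (\<lambda>t. g t + h t)" by (intro continuous_intros rapid_continuous assms)
  fix m
  obtain C D where C: "\<And>t. norm (g t) \<le> C * exp (- real m * \<bar>t\<bar>)" and D: "\<And>t. norm (h t) \<le> D * exp (- real m * \<bar>t\<bar>)"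
    using rapid_bound[OF assms(1)] rapid_bound[OF assms(2)] by metis
  have "norm (g t + h t) \<le> (C + D) * exp (- real m * \<bar>t\<bar>)" for t
    using norm_triangle_ineq[of "g t" "h t"] C[of t] D[of t] by (simp add: algebra_simps)
  thus "\<exists>C. \<forall>t. norm (g t + h t) \<le> C * exp (- real m * \<bar>t\<bar>)" by blast
qed

lemma rapid_mult_exp:
  assumes "rapid h"
  shows "rapid (\<lambda>t. h t * exp (s * of_real t))"
  unfolding rapid_def
proof (intro conjI allI)
  show "continuous_on UNIV (\<lambda>t. h t * exp (s * of_real t))" by (intro continuous_intros rapid_continuous assms)
  fix m
  obtain n :: nat where n: "real n \<ge> real m + \<bar>Re s\<bar>" using real_arch_simple by blast
  obtain C where C: "C \<ge> 0" "\<And>t. norm (h t) \<le> C * exp (- real n * \<bar>t\<bar>)" using rapid_bound[OF assms] by blast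
  have "norm (h t * exp (s * of_real t)) \<le> C * exp (- real m * \<bar>t\<bar>)" for t
  proof -
    have "(real m + \<bar>Re s\<bar>) * \<bar>t\<bar> \<le> real n * \<bar>t\<bar>" using n by (rule mult_right_mono) simp
    moreover have "Re s * t \<le> \<bar>Re s\<bar> * \<bar>t\<bar>" by (metis abs_ge_self abs_mult)
    ultimately have "exp (- real n * \<bar>t\<bar>) * exp (Re s * t) \<le> exp (- real m * \<bar>t\<bar>)"
      by (simp add: algebra_simps flip: exp_add)
    hence "C * (exp (- real n * \<bar>t\<bar>) * exp (Re s * t)) \<le> C * exp (- real m * \<bar>t\<bar>)"
      using C(1) by (rule mult_left_mono)
    moreover have "norm (h t * exp (s * of_real t)) \<le> C * exp (- real n * \<bar>t\<bar>) * exp (Re s * t)"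
      using C(2) by (simp add: norm_mult mult_right_mono)
    ultimately show ?thesis by (simp only: mult.assoc)
  qed
  thus "\<exists>C. \<forall>t. norm (h t * exp (s * of_real t)) \<le> C * exp (- real m * \<bar>t\<bar>)" by blast
qed

lemma rapid_cmult:
  assumes "rapid g"
  shows "rapid (\<lambda>t. c * g t)"
  unfolding rapid_def
proof (intro conjI allI)
  show "continuous_on UNIV (\<lambda>t. c * g t)" by (intro continuous_intros rapid_continuous assms)
  fix m
  obtain C where C: "\<And>t. norm (g t) \<le> C * exp (- real m * \<bar>t\<bar>)" using rapid_bound[OF assms] by blast
  have "norm (c * g t) \<le> (norm c * C) * exp (- real m * \<bar>t\<bar>)" for t
    unfolding norm_mult mult.assoc by (intro mult_left_mono C) auto
  thus "\<exists>C. \<forall>t. norm (c * g t) \<le> C * exp (- real m * \<bar>t\<bar>)" by blast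
qed

lemma rapid_integrable:
  assumes "rapid h"
  shows "integrable lborel h"
proof -
  obtain C where C: "C \<ge> 0" "\<And>t. norm (h t) \<le> C * exp (- real 1 * \<bar>t\<bar>)" using rapid_bound[OF assms] by blast
  show ?thesis
  proof (rule Bochner_Integration.integrable_bound)
    show "integrable lborel (\<lambda>t::real. C * exp (- \<bar>t\<bar>))"
      by (intro integrable_mult_right integrable_exp_minus_abs)
    show "h \<in> borel_measurable lborel"
      using rapid_continuous[OF assms] by (simp add: borel_measurable_continuous_onI)
    show "AE t in lborel. norm (h t) \<le> norm (C * exp (- \<bar>t\<bar>))" using C by simp
  qed
qed

lemma rapid_mellin_integrable: "rapid h \<Longrightarrow> integrable lborel (\<lambda>t. h t * exp (s * of_real t))"
  by (intro rapid_integrable rapid_mult_exp)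

lemma rapid_mellin_holomorphic:
  assumes "rapid h"
  shows "mellin h holomorphic_on UNIV"
proof -
  have "integrable lborel (\<lambda>t. norm (h t) * exp (\<sigma> * t))" for \<sigma>
    using integrable_norm[OF rapid_mellin_integrable[OF assms, of "of_real \<sigma>"]] by (simp add: norm_mult)
  hence "(mellin h has_field_derivative mellin (\<lambda>t. of_real t * h t) s) (at s)" for s
    using assms by (intro mellin_has_field_derivative[where a = "Re s - 1"] rapid_continuous) auto
  thus ?thesis by (auto simp: holomorphic_on_open)
qed

lemma rapid_tendsto_0:
  assumes "rapid h"
  shows "(h \<longlongrightarrow> 0) at_top" "(h \<longlongrightarrow> 0) at_bot"
proof -
  obtain C where C: "C \<ge> 0" "\<And>t. norm (h t) \<le> C * exp (- real 1 * \<bar>t\<bar>)" using rapid_bound[OF assms] by blast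
  have lim: "((\<lambda>t::real. C * exp (- \<bar>t\<bar>)) \<longlongrightarrow> 0) F" if "filterlim abs at_top F" for F
    using that by (intro tendsto_mult_right_zero filterlim_compose[OF exp_at_bot])
      (simp add: filterlim_uminus_at_bot)
  have "filterlim abs at_top (at_bot :: real filter)"
    by (simp add: filterlim_at_bot_mirror filterlim_abs_real)
  thus "(h \<longlongrightarrow> 0) at_top" "(h \<longlongrightarrow> 0) at_bot"
    using C by (auto intro!: Lim_null_comparison[OF _ lim] filterlim_abs_real always_eventually)
qed

lemma integral_derivative_rapid:
  assumes F: "rapid F" and "\<And>t. (F has_vector_derivative f t) (at t)"
    and "continuous_on UNIV f" "integrable lborel f"
  shows "(\<integral>t. f t \<partial>lborel) = 0"
proof -
  have "(LBINT x=-\<infinity>..\<infinity>. f x) = 0 - 0"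
    using assms rapid_tendsto_0[OF F]
    by (intro interval_integral_FTC_integrable[where F = F])
       (auto simp: continuous_on_eq_continuous_at set_integrable_def ereal_tendsto_simps)
  thus ?thesis by (simp add: interval_lebesgue_integral_def set_lebesgue_integral_def)
qed

lemma rapidI:
  assumes h: "continuous_on UNIV h"
    and pos: "\<And>m::nat. \<exists>C. \<forall>t\<ge>0. norm (h t) \<le> C * exp (- real m * t)"
    and neg: "\<And>m::nat. \<exists>C. \<forall>t\<le>-T. norm (h t) \<le> C * exp (real m * t)" and T: "T \<ge> 0"
  shows "rapid h"
  unfolding rapid_def
proof (intro conjI allI h)
  fix m :: nat
  obtain C1 where C1: "\<And>t. t \<ge> 0 \<Longrightarrow> norm (h t) \<le> C1 * exp (- real m * t)" using pos by blast
  obtain C2 where C2: "\<And>t. t \<le> - T \<Longrightarrow> norm (h t) \<le> C2 * exp (real m * t)" using neg by blast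
  have "bounded (h ` {-T..0})"
    by (intro compact_imp_bounded compact_continuous_image continuous_on_subset[OF h]) auto
  then obtain B where B: "\<And>t. t \<in> {-T..0} \<Longrightarrow> norm (h t) \<le> B" unfolding bounded_iff by (metis imageI)
  define C where "C = max (max C1 C2) (\<bar>B\<bar> * exp (real m * T))"
  have mono: "x \<le> C * exp (- real m * \<bar>t\<bar>)" if "x \<le> D * exp (- real m * \<bar>t\<bar>)" "D \<le> C" for x D t
    by (rule order.trans[OF that(1) mult_right_mono[OF that(2)]]) simp
  have "norm (h t) \<le> C * exp (- real m * \<bar>t\<bar>)" for t
  proof -
    consider "t \<ge> 0" | "t \<le> - T" "t < 0" | "t \<in> {-T..0}" by force
    thus ?thesis
    proof cases
      case 1
      show ?thesis by (rule mono[of _ C1]) (use C1[OF 1] 1 in \<open>auto simp: C_def\<close>)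
    next
      case 2
      show ?thesis by (rule mono[of _ C2]) (use C2[OF 2(1)] 2 in \<open>auto simp: C_def\<close>)
    next
      case 3
      have "real m * \<bar>t\<bar> \<le> real m * T" using 3 by (intro mult_left_mono) auto
      hence "1 \<le> exp (real m * T) * exp (- real m * \<bar>t\<bar>)" by (simp flip: exp_add)
      hence "\<bar>B\<bar> * 1 \<le> \<bar>B\<bar> * (exp (real m * T) * exp (- real m * \<bar>t\<bar>))" by (rule mult_left_mono) simp
      hence "norm (h t) \<le> \<bar>B\<bar> * exp (real m * T) * exp (- real m * \<bar>t\<bar>)" using B[OF 3] by simp
      thus ?thesis by (rule mono) (simp add: C_def)
    qed
  qed
  thus "\<exists>C. \<forall>t. norm (h t) \<le> C * exp (- real m * \<bar>t\<bar>)" by blast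
qed

lemma integral_exp_substitution:
  fixes \<phi> :: "real \<Rightarrow> complex"
  assumes cont: "continuous_on {0<..} \<phi>" and integrable: "\<phi> absolutely_integrable_on {0<..}"
  shows "integrable lborel (\<lambda>t. of_real (exp t) * \<phi> (exp t))"
    and "(\<integral>t. of_real (exp t) * \<phi> (exp t) \<partial>lborel) = integral {0<..} \<phi>"
proof -
  have range: "range exp = {0::real<..}"
    by (auto simp: image_iff) (metis exp_ln)
  have deriv: "(exp has_field_derivative exp x) (at x within UNIV)" for x :: real
    by (auto intro!: derivative_eq_intros)
  have transformed: "(\<lambda>t. of_real (exp t) * \<phi> (exp t)) absolutely_integrable_on UNIV"
    "integral UNIV (\<lambda>t. of_real (exp t) * \<phi> (exp t)) = integral {0<..} \<phi>"
    using has_absolute_integral_change_of_variables_real[OF _ deriv, of \<phi> "integral {0<..} \<phi>"] integrable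
    by (simp_all add: range scaleR_conv_of_real inj_on_def)
  have "continuous_on UNIV (\<lambda>t. of_real (exp t) * \<phi> (exp t))"
    by (intro continuous_intros continuous_on_compose2[OF cont]) auto
  hence "(\<lambda>t. of_real (exp t) * \<phi> (exp t)) \<in> borel_measurable lborel"
    by (simp add: borel_measurable_continuous_onI)
  with transformed(1) show "integrable lborel (\<lambda>t. of_real (exp t) * \<phi> (exp t))"
    by (simp add: set_integrable_def integrable_completion)
  from integral_lborel[OF this] transformed(2)
  show "(\<integral>t. of_real (exp t) * \<phi> (exp t) \<partial>lborel) = integral {0<..} \<phi>" by simp
qed

lemma Gamma_eq_mellin:
  assumes p: "Re p > 0"
  shows "integrable lborel (\<lambda>t. of_real (exp (- exp t)) * exp (p * of_real t))"
    and "mellin (\<lambda>t. of_real (exp (- exp t))) p = Gamma p"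
proof -
  define \<phi> where "\<phi> = (\<lambda>t. complex_of_real t powr (p - 1) / of_real (exp t))"
  have integrable: "\<phi> absolutely_integrable_on {0<..}"
    unfolding \<phi>_def by (rule absolutely_integrable_Gamma_integral'[OF p])
  have value_Gamma: "integral {0<..} \<phi> = Gamma p"
    unfolding \<phi>_def by (intro integral_unique Gamma_integral_complex'[OF p])
  have cont: "continuous_on {0<..} \<phi>"
    unfolding \<phi>_def by (intro continuous_intros) (auto simp: complex_nonpos_Reals_iff)
  have "of_real (exp t) * \<phi> (exp t) = of_real (exp (- exp t)) * exp (p * of_real t)" for t
  proof -
    have "\<phi> (exp t) = exp ((p - 1) * of_real t) * of_real (exp (- exp t))"
      by (simp add: \<phi>_def powr_def Ln_of_real exp_minus field_simps flip: exp_of_real)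
    moreover have "of_real (exp t) * exp ((p - 1) * of_real t) = exp (p * complex_of_real t)"
      by (simp add: algebra_simps exp_of_real[symmetric] flip: exp_add)
    ultimately show ?thesis by (simp add: mult_ac)
  qed
  with integral_exp_substitution[OF cont integrable] value_Gamma
  show "integrable lborel (\<lambda>t. of_real (exp (- exp t)) * exp (p * of_real t))"
    "mellin (\<lambda>t. of_real (exp (- exp t))) p = Gamma p"
    by (simp_all add: mellin_def)
qed

section \<open>The Bessel function \<open>K\<close>\<close>

definition bessel_K :: "complex \<Rightarrow> complex \<Rightarrow> complex" where
  "bessel_K s z = mellin (\<lambda>t. exp (- z * of_real (cosh t))) s / 2"

lemma rapid_cosh_mult:
  assumes "rapid h"
  shows "rapid (\<lambda>t. of_real (cosh t) * h t)"
proof -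
  have "rapid (\<lambda>t. 1 / 2 * (h t * exp (1 * of_real t) + h t * exp (- 1 * of_real t)))"
    by (intro rapid_cmult rapid_add rapid_mult_exp assms)
  thus ?thesis by (rule back_subst) (simp add: cosh_field_def exp_of_real[symmetric] fun_eq_iff field_simps)
qed

lemma mellin_cosh_mult:
  assumes "rapid h"
  shows "mellin (\<lambda>t. of_real (cosh t) * h t) s = (mellin h (s + 1) + mellin h (s - 1)) / 2"
proof -
  have "of_real (cosh t) * h t * exp (s * of_real t) =
      1 / 2 * (h t * exp ((s + 1) * of_real t) + h t * exp ((s - 1) * of_real t))" for t
    by (simp add: cosh_field_def exp_of_real[symmetric] ring_distribs exp_add exp_diff exp_minus field_simps)
  thus ?thesis
    using rapid_mellin_integrable[OF assms] by (simp only: mellin_def integral_mult_right_zero) simp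
qed

lemma rapid_exp_minus_cosh:
  assumes z: "Re z > 0"
  shows "rapid (\<lambda>t. exp (- z * of_real (cosh t)))"
  unfolding rapid_def
proof (intro conjI allI)
  show "continuous_on UNIV (\<lambda>t. exp (- z * of_real (cosh t)))" by (intro continuous_intros)
  fix m :: nat
  define C where "C = (real m / (Re z / 2)) ^ m"
  have "norm (exp (- z * of_real (cosh t))) \<le> C * exp (- real m * \<bar>t\<bar>)" for t
  proof -
    have "exp \<bar>t\<bar> / 2 \<le> cosh t" by (simp add: cosh_field_def abs_if)
    hence "Re z * (exp \<bar>t\<bar> / 2) \<le> Re z * cosh t" using z by (intro mult_left_mono) auto
    hence "norm (exp (- z * of_real (cosh t))) \<le> exp (- (Re z / 2) * exp \<bar>t\<bar>)" by simp
    also have "\<dots> = (exp \<bar>t\<bar> ^ m * exp (- (Re z / 2) * exp \<bar>t\<bar>)) * exp (- real m * \<bar>t\<bar>)"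
      by (simp add: exp_minus exp_of_nat_mult)
    also have "\<dots> \<le> C * exp (- real m * \<bar>t\<bar>)"
      unfolding C_def using z by (intro mult_right_mono power_mult_exp_minus_le) auto
    finally show ?thesis .
  qed
  thus "\<exists>C. \<forall>t. norm (exp (- z * of_real (cosh t))) \<le> C * exp (- real m * \<bar>t\<bar>)" by blast
qed

lemma norm_exp_minus_cosh_le:
  assumes "a \<le> Re z"
  shows "norm (exp (- z * of_real (cosh t))) \<le>
      exp (- (Re z - a)) * norm (exp (- complex_of_real a * of_real (cosh t)))"
proof -
  have "(Re z - a) * 1 \<le> (Re z - a) * cosh t"
    using assms cosh_real_ge_1[of t] by (intro mult_left_mono) auto
  thus ?thesis by (simp add: algebra_simps flip: exp_add)
qed

lemma norm_bessel_K_le: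
  assumes a: "a > 0"
  shows "\<exists>C\<ge>0. \<forall>z. Re z \<ge> a \<longrightarrow> norm (bessel_K s z) \<le> C * exp (- Re z)"
proof -
  define k where "k = (\<lambda>z t. exp (- z * of_real (cosh t)) * exp (s * of_real t))"
  have k: "integrable lborel (k z)" if "Re z > 0" for z
    unfolding k_def using that by (intro rapid_mellin_integrable rapid_exp_minus_cosh)
  define C where "C = exp a * (\<integral>t. norm (k (of_real a) t) \<partial>lborel)"
  have "norm (bessel_K s z) \<le> C * exp (- Re z)" if z: "Re z \<ge> a" for z
  proof -
    have "norm (\<integral>t. k z t \<partial>lborel) \<le> (\<integral>t. exp (- (Re z - a)) * norm (k (of_real a) t) \<partial>lborel)"
    proof (rule Bochner_Integration.integral_norm_bound_integral)
      show "norm (k z t) \<le> exp (- (Re z - a)) * norm (k (of_real a) t)" for t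
        using norm_exp_minus_cosh_le[OF z, of t] mult_right_mono[of _ _ "norm (exp (s * of_real t))"]
        unfolding k_def norm_mult mult.assoc[symmetric] by simp
    qed (use k a z in auto)
    moreover have "norm (bessel_K s z) \<le> norm (\<integral>t. k z t \<partial>lborel)"
      by (simp add: bessel_K_def mellin_def k_def norm_divide)
    ultimately show ?thesis by (simp add: C_def mult_ac exp_diff exp_minus divide_inverse)
  qed
  moreover have "C \<ge> 0" by (simp add: C_def)
  ultimately show ?thesis by blast
qed

definition bessel_K' :: "complex \<Rightarrow> complex \<Rightarrow> complex" where
  "bessel_K' s z = - (bessel_K (s + 1) z + bessel_K (s - 1) z) / 2"

lemma norm_bessel_K'_le:
  assumes a: "a > 0"
  shows "\<exists>C\<ge>0. \<forall>z. Re z \<ge> a \<longrightarrow> norm (bessel_K' s z) \<le> C * exp (- Re z)"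
proof -
  obtain C where C: "C \<ge> 0" "\<And>z. Re z \<ge> a \<Longrightarrow> norm (bessel_K (s + 1) z) \<le> C * exp (- Re z)"
    using norm_bessel_K_le[OF a] by blast
  obtain D where D: "D \<ge> 0" "\<And>z. Re z \<ge> a \<Longrightarrow> norm (bessel_K (s - 1) z) \<le> D * exp (- Re z)"
    using norm_bessel_K_le[OF a] by blast
  have "norm (bessel_K' s z) \<le> (C + D) * exp (- Re z)" if z: "Re z \<ge> a" for z
  proof -
    have "norm (bessel_K' s z) \<le> norm (bessel_K (s + 1) z + bessel_K (s - 1) z)"
      unfolding bessel_K'_def norm_divide norm_minus_cancel by simp
    also have "\<dots> \<le> C * exp (- Re z) + D * exp (- Re z)" by (intro norm_triangle_mono C D z)
    finally show ?thesis by (simp add: algebra_simps)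
  qed
  with C(1) D(1) show ?thesis by (intro exI[of _ "C + D"]) auto
qed

lemma bessel_K_has_field_derivative:
  assumes z: "Re z > 0"
  shows "(bessel_K s has_field_derivative bessel_K' s z) (at z)"
proof -
  define k where "k = (\<lambda>z t. exp (- z * of_real (cosh t)) * exp (s * of_real t))"
  define a where "a = Re z / 2"
  have k: "rapid (k w)" if "Re w > 0" for w
    unfolding k_def using that by (intro rapid_mult_exp rapid_exp_minus_cosh)
  have "((\<lambda>w. \<integral>t. k w t \<partial>lborel) has_field_derivative (\<integral>t. - of_real (cosh t) * k z t \<partial>lborel)) (at z)"
  proof (rule has_field_derivative_integral_dominated[where S = "{w. Re w > a}"
    and g = "\<lambda>t. norm (of_real (cosh t) * k (of_real a) t)"])
    show "open {w. Re w > a}" "convex {w. Re w > a}"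
      by (simp_all add: open_halfspace_Re_gt convex_halfspace_Re_gt)
    show "z \<in> {w. Re w > a}" using z by (simp add: a_def)
    show "integrable lborel (k w)" if "w \<in> {w. Re w > a}" for w
      using that z by (intro rapid_integrable k) (simp add: a_def)
    show "((\<lambda>w. k w t) has_field_derivative - of_real (cosh t) * k w t) (at w)" for w t
      unfolding k_def by (auto intro!: derivative_eq_intros)
    show "norm (- of_real (cosh t) * k w t) \<le> norm (of_real (cosh t) * k (of_real a) t)" if "w \<in> {w. Re w > a}"
      for w t
    proof -
      have "norm (exp (- w * of_real (cosh t))) \<le>
          exp (- (Re w - a)) * norm (exp (- complex_of_real a * of_real (cosh t)))"
        using that by (intro norm_exp_minus_cosh_le) simp
      also have "\<dots> \<le> 1 * norm (exp (- complex_of_real a * of_real (cosh t)))"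
        using that by (intro mult_right_mono) auto
      finally show ?thesis unfolding k_def norm_mult norm_minus_cancel by (intro mult_left_mono mult_right_mono) auto
    qed
    show "integrable lborel (\<lambda>t. norm (of_real (cosh t) * k (of_real a) t))"
      using z by (intro integrable_norm rapid_integrable rapid_cosh_mult k) (simp add: a_def)
  qed
  moreover have "(\<integral>t. - of_real (cosh t) * k z t \<partial>lborel) = 2 * bessel_K' s z"
  proof -
    have "(\<integral>t. - of_real (cosh t) * k z t \<partial>lborel) = - mellin (\<lambda>t. of_real (cosh t) * exp (- z * of_real (cosh t))) s"
      by (simp add: k_def mellin_def mult.assoc)
    also have "\<dots> = 2 * bessel_K' s z"
      unfolding mellin_cosh_mult[OF rapid_exp_minus_cosh[OF z]] by (simp add: bessel_K'_def bessel_K_def field_simps)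
    finally show ?thesis .
  qed
  ultimately show ?thesis
    unfolding bessel_K_def[abs_def] mellin_def by (auto simp: k_def intro!: derivative_eq_intros)
qed

text \<open>Integrate the derivative of \<open>exp (- z cosh t + s t)\<close> over the line.\<close>

lemma bessel_K_recurrence:
  assumes z: "Re z > 0"
  shows "z * (bessel_K (s + 1) z - bessel_K (s - 1) z) = 2 * s * bessel_K s z"
proof -
  define h where "h = (\<lambda>t. exp (- z * of_real (cosh t)))"
  define k where "k = (\<lambda>s t. h t * exp (s * of_real t))"
  define k' where "k' = (\<lambda>t. s * k s t - z / 2 * (k (s + 1) t - k (s - 1) t))"
  have k: "rapid (k s)" for s unfolding k_def h_def by (intro rapid_mult_exp rapid_exp_minus_cosh z)
  have K: "(\<integral>t. k s t \<partial>lborel) = 2 * bessel_K s z" for s by (simp add: bessel_K_def mellin_def k_def h_def)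
  have "(\<integral>t. k' t \<partial>lborel) = 0"
  proof (rule integral_derivative_rapid[OF k])
    show "(k s has_vector_derivative k' t) (at t)" for t
    proof -
      have cosh: "cosh (complex_of_real t) = of_real (cosh t)" for t
        by (simp add: cosh_field_def flip: exp_of_real)
      have "((\<lambda>w. exp (- z * cosh w) * exp (s * w)) has_field_derivative
              (s - z * sinh (of_real t)) * k s t) (at (of_real t))"
        by (auto intro!: derivative_eq_intros simp: k_def h_def cosh algebra_simps)
      from has_vector_derivative_real_field[OF this]
      have "(k s has_vector_derivative (s - z * sinh (of_real t)) * k s t) (at t)"
        by (simp add: k_def[abs_def] h_def cosh)
      moreover have "(s - z * sinh (of_real t)) * k s t = k' t"
        by (simp add: k'_def k_def sinh_field_def ring_distribs exp_add exp_diff exp_minus field_simps)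
      ultimately show ?thesis by simp
    qed
    show "continuous_on UNIV k'"
      unfolding k'_def by (intro continuous_intros rapid_continuous k)
    show "integrable lborel k'"
      unfolding k'_def by (intro Bochner_Integration.integrable_diff integrable_mult_right rapid_integrable k)
  qed
  moreover have "(\<integral>t. k' t \<partial>lborel) = s * (2 * bessel_K s z) - z / 2 *
      (2 * bessel_K (s + 1) z - 2 * bessel_K (s - 1) z)"
    unfolding k'_def K[symmetric] using rapid_integrable[OF k]
    by (subst Bochner_Integration.integral_diff) (auto simp: Bochner_Integration.integral_diff)
  ultimately show ?thesis by (simp add: algebra_simps)
qed

lemma bessel_K'_has_field_derivative:
  assumes z: "Re z > 0"
  shows "(bessel_K' s has_field_derivative (1 + s\<^sup>2 / z\<^sup>2) * bessel_K s z - bessel_K' s z / z) (at z)"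
proof -
  have z0: "z \<noteq> 0" using z by auto
  define K where "K = (\<lambda>j::int. bessel_K (s + of_int j) z)"
  have rec: "K (j + 1) = K (j - 1) + 2 * (s + of_int j) * K j / z" for j
    using bessel_K_recurrence[OF z, of "s + of_int j"] z0 by (simp add: K_def field_simps)
  have "(bessel_K' s has_field_derivative - (bessel_K' (s + 1) z + bessel_K' (s - 1) z) / 2) (at z)"
    unfolding bessel_K'_def[of s, abs_def]
    by (rule derivative_eq_intros bessel_K_has_field_derivative[OF z] refl)+ (simp_all add: field_simps)
  also have "- (bessel_K' (s + 1) z + bessel_K' (s - 1) z) / 2 = (K 2 + 2 * K 0 + K (-2)) / 4"
    by (simp add: bessel_K'_def K_def add.assoc diff_diff_eq field_simps)
  also have "\<dots> = K 0 + (s * (K 1 - K (-1)) + (K 1 + K (-1))) / (2 * z)"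
  proof -
    have K2: "K 2 = K 0 + 2 * (s + 1) * K 1 / z" and Km2: "K (-2) = K 0 - 2 * (s - 1) * K (-1) / z"
      using rec[of 1] rec[of "-1"] by (simp_all add: algebra_simps)
    show ?thesis unfolding K2 Km2 using z0 by (simp add: field_simps)
  qed
  also have "K 1 - K (-1) = 2 * s * K 0 / z"
    using rec[of 0] by simp
  also have "K 0 + (s * (2 * s * K 0 / z) + (K 1 + K (-1))) / (2 * z) =
      (1 + s\<^sup>2 / z\<^sup>2) * bessel_K s z - bessel_K' s z / z"
    using z0 by (simp add: K_def bessel_K'_def field_simps power2_eq_square)
  finally show ?thesis .
qed

lemma integral_integral_mult_sum_diff:
  fixes G H :: "real \<Rightarrow> complex"
  assumes G: "integrable lborel G" and H: "integrable lborel H"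
  shows "(\<integral>a. (\<integral>t. G (a + t) * H (a - t) \<partial>lborel) \<partial>lborel) = (\<integral>t. G t \<partial>lborel) * (\<integral>t. H t \<partial>lborel) / 2"
proof -
  note [measurable] = borel_measurable_integrable[OF G] borel_measurable_integrable[OF H]
  have affine: "integrable lborel (\<lambda>a. H (2 * a - u))" "(\<integral>a. H (2 * a - u) \<partial>lborel) = (\<integral>t. H t \<partial>lborel) / 2"
    "(\<integral>a. norm (H (2 * a - u)) \<partial>lborel) = (\<integral>t. norm (H t) \<partial>lborel) / 2" for u
    using lborel_integrable_real_affine[OF H, of 2 "-u"] lborel_integral_real_affine[of 2 H "-u"]
      lborel_integral_real_affine[of 2 "\<lambda>t. norm (H t)" "-u"]
    by (simp_all add: scaleR_conv_of_real)
  have "integrable (lborel \<Otimes>\<^sub>M lborel) (\<lambda>(u, a). G u * H (2 * a - u))"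
    by (intro lborel_pair.Fubini_integrable) (auto simp: norm_mult affine intro!: integrable_divide
      integrable_mult_left integrable_norm G)
  from lborel_pair.Fubini_integral[OF this]
  have "(\<integral>a. (\<integral>u. G u * H (2 * a - u) \<partial>lborel) \<partial>lborel) = (\<integral>u. (\<integral>a. G u * H (2 * a - u) \<partial>lborel) \<partial>lborel)" .
  also have "\<dots> = (\<integral>t. G t \<partial>lborel) * (\<integral>t. H t \<partial>lborel) / 2"
    using G by (simp add: affine)
  finally have swapped: "(\<integral>a. (\<integral>u. G u * H (2 * a - u) \<partial>lborel) \<partial>lborel) =
      (\<integral>t. G t \<partial>lborel) * (\<integral>t. H t \<partial>lborel) / 2" .
  have "(\<integral>u. G u * H (2 * a - u) \<partial>lborel) = (\<integral>t. G (a + t) * H (a - t) \<partial>lborel)" for a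
    by (subst lborel_integral_real_affine[of 1 _ a]) (auto simp: algebra_simps)
  thus ?thesis using swapped by simp
qed

lemma mellin_exp_minus_exp:
  assumes p: "Re p > 0" and c: "c > 0"
  shows "integrable lborel (\<lambda>t. of_real (exp (- c * exp t)) * exp (p * of_real t))"
    and "mellin (\<lambda>t. of_real (exp (- c * exp t))) p = of_real c powr (- p) * Gamma p"
proof -
  have shift: "of_real (exp (- c * exp t)) = complex_of_real (exp (- exp (t + ln c)))" for t
    using c by (simp add: exp_add mult.commute)
  have powr: "of_real c powr (- p) = exp (- p * of_real (ln c))"
    using c by (simp add: powr_def Ln_of_real)
  show "mellin (\<lambda>t. of_real (exp (- c * exp t))) p = of_real c powr (- p) * Gamma p"
    unfolding shift by (subst mellin_shift[of "\<lambda>t. of_real (exp (- exp t))"])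
      (simp add: Gamma_eq_mellin(2)[OF p] powr)
  have "integrable lborel (\<lambda>t. of_real c powr (- p) *
          (of_real (exp (- exp (ln c + 1 * t))) * exp (p * of_real (ln c + 1 * t))))"
    by (intro integrable_mult_right lborel_integrable_real_affine Gamma_eq_mellin(1) p) auto
  moreover have "of_real c powr (- p) * (of_real (exp (- exp (ln c + 1 * t))) * exp (p * of_real (ln c + 1 * t))) =
      of_real (exp (- c * exp t)) * exp (p * of_real t)" for t
    unfolding shift powr by (simp add: ring_distribs exp_add exp_minus add.commute)
  ultimately show "integrable lborel (\<lambda>t. of_real (exp (- c * exp t)) * exp (p * of_real t))" by simp
qed

theorem mellin_bessel_K:
  assumes p: "Re p > \<bar>Re s\<bar>" and c: "c > 0"
  shows "mellin (\<lambda>t. bessel_K s (of_real (2 * c * exp t))) p =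
           of_real c powr (- p) * Gamma ((p + s) / 2) * Gamma ((p - s) / 2) / 4"
proof -
  define G where "G = (\<lambda>q t. complex_of_real (exp (- c * exp t)) * exp (q * of_real t))"
  have re: "Re ((p + s) / 2) > 0" "Re ((p - s) / 2) > 0" using p by auto
  have G: "integrable lborel (G q)" "(\<integral>t. G q t \<partial>lborel) = of_real c powr (- q) * Gamma q" if "Re q > 0" for q
    using mellin_exp_minus_exp[OF that c] by (simp_all add: G_def mellin_def)
  have split: "exp (- of_real (2 * c * exp a) * of_real (cosh t)) * exp (s * of_real t) * exp (p * of_real a) =
      G ((p + s) / 2) (a + t) * G ((p - s) / 2) (a - t)" for a t
  proof -
    have "- of_real (2 * c * exp a) * of_real (cosh t) =
        complex_of_real (- c * exp (a + t)) + of_real (- c * exp (a - t))"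
      by (simp add: cosh_field_def exp_add exp_diff exp_minus field_simps)
    moreover have "s * of_real t + p * of_real a = (p + s) / 2 * of_real (a + t) + (p - s) / 2 * of_real (a - t)"
      by (simp add: field_simps)
    ultimately show ?thesis
      by (simp only: G_def exp_of_real[symmetric] mult.assoc exp_add[symmetric]) (simp add: algebra_simps)
  qed
  have "mellin (\<lambda>t. bessel_K s (of_real (2 * c * exp t))) p =
      (\<integral>a. (\<integral>t. G ((p + s) / 2) (a + t) * G ((p - s) / 2) (a - t) \<partial>lborel) / 2 \<partial>lborel)"
    by (simp add: mellin_def bessel_K_def flip: split)
  also have "\<dots> = (\<integral>a. (\<integral>t. G ((p + s) / 2) (a + t) * G ((p - s) / 2) (a - t) \<partial>lborel) \<partial>lborel) / 2"
    by simp
  also have "\<dots> = (of_real c powr (- ((p + s) / 2)) * Gamma ((p + s) / 2)) *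
      (of_real c powr (- ((p - s) / 2)) * Gamma ((p - s) / 2)) / 4"
    unfolding integral_integral_mult_sum_diff[OF G(1)[OF re(1)] G(1)[OF re(2)]] G(2)[OF re(1)] G(2)[OF re(2)] by simp
  also have "of_real c powr (- ((p + s) / 2)) * of_real c powr (- ((p - s) / 2)) = complex_of_real c powr (- p)"
    by (simp add: field_simps flip: powr_add)
  hence "(of_real c powr (- ((p + s) / 2)) * Gamma ((p + s) / 2)) *
      (of_real c powr (- ((p - s) / 2)) * Gamma ((p - s) / 2)) / 4 =
      complex_of_real c powr (- p) * Gamma ((p + s) / 2) * Gamma ((p - s) / 2) / 4"
    by (simp add: mult_ac)
  finally show ?thesis .
qed

text \<open>
  The radial factor of the Fourier coefficients of a Maass form with Laplace eigenvalue \<open>1/4 - s\<^sup>2\<close>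
  and its derivative.
\<close>

definition whittaker :: "complex \<Rightarrow> real \<Rightarrow> complex" where
  "whittaker s y = of_real (sqrt y) * bessel_K s (of_real (2 * pi * y))"

definition whittaker' :: "complex \<Rightarrow> real \<Rightarrow> complex" where
  "whittaker' s y = of_real (2 * pi * sqrt y) * bessel_K' s (of_real (2 * pi * y)) +
     of_real (1 / (2 * sqrt y)) * bessel_K s (of_real (2 * pi * y))"

lemma has_vector_derivative_of_real_dilate:
  assumes "(g has_field_derivative g') (at (of_real (c * y)))"
  shows "((\<lambda>y. g (complex_of_real (c * y))) has_vector_derivative of_real c * g') (at y)"
proof -
  have "((\<lambda>w. g (of_real c * w)) has_field_derivative g' * of_real c) (at (of_real y))"
    using assms by (intro DERIV_chain2[of g]) (auto intro!: derivative_eq_intros)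
  from has_vector_derivative_real_field[OF this] show ?thesis by (simp add: mult.commute)
qed

lemma radial_solution_whittaker: "radial_solution (2 * pi) (1 / 4 - s\<^sup>2) (whittaker s) (whittaker' s)"
  unfolding radial_solution_def
proof (intro allI impI conjI)
  fix y :: real assume y: "y > 0"
  define z where "z = complex_of_real (2 * pi * y)"
  define r where "r = complex_of_real (sqrt y)"
  have z: "Re z > 0" "z \<noteq> 0" using y by (auto simp: z_def)
  have r: "r \<noteq> 0" "of_real y = r\<^sup>2" using y by (auto simp: r_def simp flip: of_real_power)
  have K: "((\<lambda>y. bessel_K s (of_real (2 * pi * y))) has_vector_derivative of_real (2 * pi) * bessel_K' s z) (at y)"
    using z unfolding z_def by (intro has_vector_derivative_of_real_dilate bessel_K_has_field_derivative)
  have K': "((\<lambda>y. bessel_K' s (of_real (2 * pi * y))) has_vector_derivative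
      of_real (2 * pi) * ((1 + s\<^sup>2 / z\<^sup>2) * bessel_K s z - bessel_K' s z / z)) (at y)"
    using z unfolding z_def by (intro has_vector_derivative_of_real_dilate bessel_K'_has_field_derivative)
  have sqrt: "((\<lambda>y. complex_of_real (sqrt y)) has_vector_derivative of_real (1 / (2 * sqrt y))) (at y)"
    using DERIV_real_sqrt[OF y] by (intro has_vector_derivative_of_real) (simp add: field_simps)
  have inv_sqrt: "((\<lambda>y. complex_of_real (1 / (2 * sqrt y))) has_vector_derivative
      of_real (- 1 / (4 * sqrt y * y))) (at y)"
    using y by (intro has_vector_derivative_of_real) (auto intro!: derivative_eq_intros simp: field_simps)
  show "(whittaker s has_vector_derivative whittaker' s y) (at y)"
    using has_vector_derivative_mult[OF sqrt K]
    by (simp add: whittaker_def[abs_def] whittaker'_def z_def mult_ac)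
  have "(whittaker' s has_vector_derivative
      (of_real (2 * pi) * r * (of_real (2 * pi) * ((1 + s\<^sup>2 / z\<^sup>2) * bessel_K s z - bessel_K' s z / z)) +
        of_real (2 * pi) * of_real (1 / (2 * sqrt y)) * bessel_K' s z) +
      (of_real (1 / (2 * sqrt y)) * (of_real (2 * pi) * bessel_K' s z) + of_real (- 1 / (4 * sqrt y * y)) *
        bessel_K s z)) (at y)"
    unfolding whittaker'_def[abs_def] of_real_mult[of "2 * pi" "sqrt _"] r_def z_def
    by (intro has_vector_derivative_add has_vector_derivative_mult has_vector_derivative_mult_right
          K[unfolded z_def] K'[unfolded z_def] sqrt inv_sqrt)
  moreover have "(of_real (2 * pi) * r * (of_real (2 * pi) * ((1 + s\<^sup>2 / z\<^sup>2) * bessel_K s z - bessel_K' s z / z)) +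
        of_real (2 * pi) * of_real (1 / (2 * sqrt y)) * bessel_K' s z) +
      (of_real (1 / (2 * sqrt y)) * (of_real (2 * pi) * bessel_K' s z) + of_real (- 1 / (4 * sqrt y * y)) *
        bessel_K s z) =
      (of_real ((2 * pi)\<^sup>2) - (1 / 4 - s\<^sup>2) / of_real (y\<^sup>2)) * whittaker s y"
  proof -
    have "z = 2 * of_real pi * r\<^sup>2" by (simp add: z_def r)
    thus ?thesis
      using r(1) unfolding whittaker_def z_def[symmetric]
      by (simp add: r r_def[symmetric] field_simps power2_eq_square)
  qed
  ultimately show "(whittaker' s has_vector_derivative
      (of_real ((2 * pi)\<^sup>2) - (1 / 4 - s\<^sup>2) / of_real (y\<^sup>2)) * whittaker s y) (at y)"
    by (simp only:)
qed

lemma sqrt_mult_exp_minus_le: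
  assumes "y \<ge> 0"
  shows "sqrt y * exp (- (2 * pi) * y) \<le> exp (- pi * y)"
proof -
  have "sqrt y \<le> 1 + y"
    using assms by (intro real_le_lsqrt) (auto simp: power2_eq_square algebra_simps)
  also have "\<dots> \<le> 1 + pi * y"
    using assms pi_ge_two mult_right_mono[of 1 pi y] by simp
  also have "\<dots> \<le> exp (pi * y)" by (rule exp_ge_add_one_self)
  finally have "sqrt y * exp (- (2 * pi) * y) \<le> exp (pi * y) * exp (- (2 * pi) * y)" by (rule mult_right_mono) simp
  thus ?thesis by (simp flip: exp_add)
qed

lemma whittaker_exp_decay:
  assumes c: "c > 0"
  shows "\<exists>K\<ge>0. \<forall>y\<ge>c. norm (whittaker s y) \<le> K * exp (- pi * y) \<and> norm (whittaker' s y) \<le> K * exp (- pi * y)"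
proof -
  obtain C where C: "C \<ge> 0" "\<And>z. Re z \<ge> 2 * pi * c \<Longrightarrow> norm (bessel_K s z) \<le> C * exp (- Re z)"
    using norm_bessel_K_le[of "2 * pi * c" s] c by auto
  obtain D where D: "D \<ge> 0" "\<And>z. Re z \<ge> 2 * pi * c \<Longrightarrow> norm (bessel_K' s z) \<le> D * exp (- Re z)"
    using norm_bessel_K'_le[of "2 * pi * c" s] c by auto
  define K where "K = C + 2 * pi * D + C / (2 * c)"
  have "norm (whittaker s y) \<le> K * exp (- pi * y) \<and> norm (whittaker' s y) \<le> K * exp (- pi * y)" if y: "y \<ge> c" for y
  proof
    define z where "z = complex_of_real (2 * pi * y)"
    define E where "E = sqrt y * exp (- (2 * pi) * y)"
    have y0: "y > 0" using y c by simp
    have K: "norm (bessel_K s z) \<le> C * exp (- (2 * pi) * y)" and K': "norm (bessel_K' s z) \<le> D * exp (- (2 * pi) * y)"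
      using C(2)[of z] D(2)[of z] y by (simp_all add: z_def)
    have E: "b * E \<le> K * exp (- pi * y)" if "0 \<le> b" "b \<le> K" for b
      unfolding E_def using that y0 sqrt_mult_exp_minus_le[of y] by (intro mult_mono) auto
    have "norm (whittaker s y) \<le> sqrt y * (C * exp (- (2 * pi) * y))"
      unfolding whittaker_def norm_mult z_def[symmetric] using K y0 by (intro mult_mono) auto
    also have "\<dots> = C * E" by (simp add: E_def)
    also have "\<dots> \<le> K * exp (- pi * y)" using C D c by (intro E) (auto simp: K_def)
    finally show "norm (whittaker s y) \<le> K * exp (- pi * y)" .
    have "1 / sqrt y = sqrt y / y" using y0 by (simp add: real_div_sqrt field_simps)
    also have "\<dots> \<le> sqrt y / c" using y c y0 by (intro divide_left_mono) auto
    finally have inv_sqrt: "1 / (2 * sqrt y) \<le> sqrt y / (2 * c)" by simp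
    have "norm (whittaker' s y) \<le> norm (of_real (2 * pi * sqrt y) * bessel_K' s z) +
        norm (of_real (1 / (2 * sqrt y)) * bessel_K s z)"
      unfolding whittaker'_def z_def by (rule norm_triangle_ineq)
    also have "\<dots> \<le> (2 * pi * sqrt y) * (D * exp (- (2 * pi) * y)) + sqrt y / (2 * c) * (C * exp (- (2 * pi) * y))"
      unfolding norm_mult norm_of_real using K K' inv_sqrt c y0 by (intro add_mono mult_mono) auto
    also have "\<dots> = (2 * pi * D + C / (2 * c)) * E" by (simp add: E_def algebra_simps)
    also have "\<dots> \<le> K * exp (- pi * y)" using C D c by (intro E) (auto simp: K_def)
    finally show "norm (whittaker' s y) \<le> K * exp (- pi * y)" .
  qed
  moreover have "K \<ge> 0" using C D c by (simp add: K_def)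
  ultimately show ?thesis by blast
qed

lemma mellin_whittaker:
  assumes "Re p + 1 / 2 > \<bar>Re s\<bar>"
  shows "mellin (\<lambda>t. whittaker s (exp t)) p =
    of_real pi powr (- (p + 1 / 2)) * Gamma ((p + 1 / 2 + s) / 2) * Gamma ((p + 1 / 2 - s) / 2) / 4"
proof -
  have "whittaker s (exp t) = bessel_K s (of_real (2 * pi * exp t)) * exp (1 / 2 * of_real t)" for t
  proof -
    have "sqrt (exp t) = exp (1 / 2 * t)" by (simp add: real_sqrt_unique power2_eq_square flip: exp_add)
    hence "complex_of_real (sqrt (exp t)) = exp (1 / 2 * of_real t)"
      by (simp flip: exp_of_real)
    thus ?thesis by (simp add: whittaker_def)
  qed
  thus ?thesis using assms by (simp only: mellin_mult_exp) (subst mellin_bessel_K, auto)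
qed

lemma Gamma_nonzero_of_Re_pos: "Re z > 0 \<Longrightarrow> Gamma z \<noteq> 0"
  by (auto simp: Gamma_eq_zero_iff elim!: nonpos_Ints_cases)

lemma whittaker_nonzero: "\<exists>y>0. whittaker s y \<noteq> 0"
proof (rule ccontr)
  assume "\<not> (\<exists>y>0. whittaker s y \<noteq> 0)"
  define p where "p = complex_of_real (\<bar>Re s\<bar> + 1)"
  have "Re ((p + 1 / 2 + s) / 2) > 0" "Re ((p + 1 / 2 - s) / 2) > 0" by (auto simp: p_def)
  hence "Gamma ((p + 1 / 2 + s) / 2) \<noteq> 0" "Gamma ((p + 1 / 2 - s) / 2) \<noteq> 0"
    by (simp_all only: Gamma_nonzero_of_Re_pos not_False_eq_True)
  moreover have "mellin (\<lambda>t. whittaker s (exp t)) p = 0"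
    using \<open>\<not> (\<exists>y>0. whittaker s y \<noteq> 0)\<close> by (simp add: mellin_def)
  ultimately show False using mellin_whittaker[of s p] by (auto simp: p_def)
qed

section \<open>Smooth functions on the upper half plane\<close>

lemma open_upper_half_plane: "open upper_half_plane"
  unfolding upper_half_plane_def by (rule open_halfspace_Im_gt)

lemma Complex_in_upper_half_plane [simp]: "Complex x y \<in> upper_half_plane \<longleftrightarrow> y > 0"
  by (simp add: upper_half_plane_def)

lemma smooth_on_differentiable: "smooth_on S f \<Longrightarrow> f differentiable_on S"
  unfolding smooth_on_def using C_k_on.simps(2) by blast

lemma smooth_on_continuous: "smooth_on S f \<Longrightarrow> continuous_on S f"
  by (rule differentiable_imp_continuous_on[OF smooth_on_differentiable])

lemma smooth_on_partial_x: "smooth_on S f \<Longrightarrow> smooth_on S (partial_x f)"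
  unfolding smooth_on_def using C_k_on.simps(2) by blast

lemma smooth_on_partial_y: "smooth_on S f \<Longrightarrow> smooth_on S (partial_y f)"
  unfolding smooth_on_def using C_k_on.simps(2) by blast

lemma has_derivative_partials:
  assumes "smooth_on upper_half_plane f" "z \<in> upper_half_plane"
  shows "(f has_derivative (\<lambda>h. of_real (Re h) * partial_x f z + of_real (Im h) * partial_y f z)) (at z)"
proof -
  have "f differentiable (at z)"
    using smooth_on_differentiable[OF assms(1)] assms(2) open_upper_half_plane
    by (metis at_within_open differentiable_on_def)
  then obtain D where D: "(f has_derivative D) (at z)" by (auto simp: differentiable_def)
  interpret D: bounded_linear D using D by (rule has_derivative_bounded_linear)
  have dir: "((\<lambda>t. f (z + w * of_real t)) has_vector_derivative D w) (at 0)" for w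
  proof -
    have "((\<lambda>t. z + w * of_real t) has_derivative (\<lambda>t. w * of_real t)) (at 0)"
      by (auto intro!: derivative_eq_intros)
    from has_derivative_compose[OF this, of f D] D
    have "((\<lambda>t. f (z + w * of_real t)) has_derivative (\<lambda>t. D (w * of_real t))) (at 0)" by simp
    moreover have "D (w * of_real t) = t *\<^sub>R D w" for t
      using D.scaleR[of t w] by (simp add: scaleR_conv_of_real mult.commute)
    ultimately show ?thesis by (simp add: has_vector_derivative_def)
  qed
  have x: "partial_x f z = D 1"
    unfolding partial_x_def using dir[of 1] by (intro vector_derivative_at) simp
  have y: "partial_y f z = D \<i>"
    unfolding partial_y_def using dir[of \<i>] by (intro vector_derivative_at) simp
  have "D h = of_real (Re h) * partial_x f z + of_real (Im h) * partial_y f z" for h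
  proof -
    have "D h = D (Re h *\<^sub>R 1 + Im h *\<^sub>R \<i>)"
      by (rule arg_cong[of _ _ D]) (simp add: complex_eq_iff)
    thus ?thesis unfolding D.add D.scaleR x y by (simp add: scaleR_conv_of_real)
  qed
  thus ?thesis using D by presburger
qed

lemma has_vector_derivative_along:
  assumes "smooth_on upper_half_plane f" "\<gamma> t \<in> upper_half_plane" "(\<gamma> has_vector_derivative w) (at t)"
  shows "((\<lambda>t. f (\<gamma> t)) has_vector_derivative
           (of_real (Re w) * partial_x f (\<gamma> t) + of_real (Im w) * partial_y f (\<gamma> t))) (at t)"
proof -
  have "(\<gamma> has_derivative (\<lambda>h. h *\<^sub>R w)) (at t)" using assms(3) by (simp add: has_vector_derivative_def)
  from has_derivative_compose[OF this has_derivative_partials[OF assms(1,2)]]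
  show ?thesis by (simp add: has_vector_derivative_def scaleR_conv_of_real algebra_simps)
qed

lemma Complex_has_vector_derivative_x: "((\<lambda>x. Complex x y) has_vector_derivative 1) (at x)"
proof -
  have "((\<lambda>x. of_real x + \<i> * of_real y) has_vector_derivative 1) (at x)"
    by (auto intro!: derivative_eq_intros)
  thus ?thesis by (simp add: Complex_eq)
qed

lemma Complex_has_vector_derivative_y: "((\<lambda>y. Complex x y) has_vector_derivative \<i>) (at y)"
proof -
  have "((\<lambda>y. of_real x + \<i> * of_real y) has_vector_derivative \<i>) (at y)"
    by (auto intro!: derivative_eq_intros)
  thus ?thesis by (simp add: Complex_eq)
qed

lemma has_vector_derivative_x:
  assumes "smooth_on upper_half_plane f" "y > 0"
  shows "((\<lambda>x. f (Complex x y)) has_vector_derivative partial_x f (Complex x y)) (at x)"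
  using has_vector_derivative_along[OF assms(1) _ Complex_has_vector_derivative_x[of y x]] assms(2) by simp

lemma has_vector_derivative_y:
  assumes "smooth_on upper_half_plane f" "y > 0"
  shows "((\<lambda>y. f (Complex x y)) has_vector_derivative partial_y f (Complex x y)) (at y)"
  using has_vector_derivative_along[OF assms(1) _ Complex_has_vector_derivative_y[of x y]] assms(2) by simp

lemma continuous_on_horizontal:
  assumes "continuous_on upper_half_plane g" "y > 0"
  shows "continuous_on A (\<lambda>x. g (Complex x y))"
  by (intro continuous_on_compose2[OF assms(1)] continuous_intros) (use assms in auto)

definition horocycle_coeff :: "(complex \<Rightarrow> complex) \<Rightarrow> int \<Rightarrow> real \<Rightarrow> complex" where
  "horocycle_coeff g n y = fourier_coeff (\<lambda>x. g (Complex x y)) n"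

lemma horocycle_coeff_has_vector_derivative:
  assumes g: "smooth_on upper_half_plane g" and y: "y > 0"
  shows "(horocycle_coeff g n has_vector_derivative horocycle_coeff (partial_y g) n y) (at y)"
proof -
  let ?c = "\<lambda>t. cis (- 2 * pi * of_int n * t)"
  have "((\<lambda>y. integral (cbox 0 1) (\<lambda>t. g (Complex t y) * ?c t)) has_vector_derivative
          integral (cbox 0 1) (\<lambda>t. partial_y g (Complex t y) * ?c t)) (at y within {0<..})"
  proof (rule leibniz_rule_vector_derivative[where fx = "\<lambda>y t. partial_y g (Complex t y) * ?c t"])
    show "((\<lambda>y. g (Complex t y) * ?c t) has_vector_derivative partial_y g (Complex t y) * ?c t) (at y within {0<..})"
      if "y \<in> {0<..}" for y t
      using has_vector_derivative_mult_left[OF has_vector_derivative_y[OF g, of y t], of "?c t"] that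
      by (auto intro: has_vector_derivative_at_within)
    show "(\<lambda>t. g (Complex t y) * ?c t) integrable_on cbox 0 1" if "y \<in> {0<..}" for y
      using that unfolding cbox_interval
      by (intro integrable_mult_cis continuous_on_horizontal smooth_on_continuous[OF g]) auto
    have "continuous_on ({0<..} \<times> cbox 0 1) (\<lambda>p. partial_y g (Complex (snd p) (fst p)) * ?c (snd p))"
      by (intro continuous_intros continuous_on_compose2[OF smooth_on_continuous[OF smooth_on_partial_y[OF g]]]) auto
    thus "continuous_on ({0<..} \<times> cbox 0 1) (\<lambda>(y, t). partial_y g (Complex t y) * ?c t)"
      by (simp add: case_prod_unfold)
  qed (use y in auto)
  thus ?thesis
    using y unfolding horocycle_coeff_def[abs_def] fourier_coeff_def cbox_interval
    by (simp add: at_within_open[of y "{0<..}"])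
qed

definition one_periodic :: "(complex \<Rightarrow> complex) \<Rightarrow> bool" where
  "one_periodic g \<longleftrightarrow> (\<forall>z\<in>upper_half_plane. g (z + 1) = g z)"

lemma one_periodic_Complex: "one_periodic g \<Longrightarrow> y > 0 \<Longrightarrow> g (Complex (x + 1) y) = g (Complex x y)"
proof -
  assume "one_periodic g" "y > 0"
  hence "g (Complex x y + 1) = g (Complex x y)" unfolding one_periodic_def by simp
  moreover have "Complex x y + 1 = Complex (x + 1) y" by (simp add: complex_eq_iff)
  ultimately show ?thesis by simp
qed

lemma one_periodic_partial_x: "one_periodic g \<Longrightarrow> one_periodic (partial_x g)"
proof -
  assume g: "one_periodic g"
  show ?thesis unfolding one_periodic_def
  proof
    fix z assume z: "z \<in> upper_half_plane"
    have "g (z + 1 + of_real t) = g (z + of_real t)" for t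
    proof -
      have "z + of_real t \<in> upper_half_plane" using z by (simp add: upper_half_plane_def)
      hence "g (z + of_real t + 1) = g (z + of_real t)" using g by (simp add: one_periodic_def)
      thus ?thesis by (simp add: add_ac)
    qed
    thus "partial_x g (z + 1) = partial_x g z" by (simp add: partial_x_def)
  qed
qed

lemma one_periodic_partial_y: "one_periodic g \<Longrightarrow> one_periodic (partial_y g)"
proof -
  assume g: "one_periodic g"
  show ?thesis unfolding one_periodic_def
  proof
    fix z assume z: "z \<in> upper_half_plane"
    have "eventually (\<lambda>t. t \<in> {- Im z<..}) (nhds (0::real))"
      using z by (intro eventually_nhds_in_open) (auto simp: upper_half_plane_def)
    hence "eventually (\<lambda>t. g (z + 1 + \<i> * of_real t) = g (z + \<i> * of_real t)) (nhds 0)"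
    proof eventually_elim
      case (elim t)
      hence "z + \<i> * of_real t \<in> upper_half_plane" by (simp add: upper_half_plane_def)
      hence "g (z + \<i> * of_real t + 1) = g (z + \<i> * of_real t)" using g by (simp add: one_periodic_def)
      thus ?case by (simp add: add_ac)
    qed
    thus "partial_y g (z + 1) = partial_y g z"
      unfolding partial_y_def by (intro vector_derivative_cong_eq) auto
  qed
qed

lemma horocycle_coeff_partial_x:
  assumes g: "smooth_on upper_half_plane g" "one_periodic g" and y: "y > 0"
  shows "horocycle_coeff (partial_x g) n y = 2 * of_real pi * \<i> * of_int n * horocycle_coeff g n y"
proof -
  let ?c = "\<lambda>t. cis (- 2 * pi * of_int n * t)"
  define k where "k = - 2 * pi * of_int n"
  have "((\<lambda>x. g (Complex x y) * (\<i> * of_real k * cis (k * x)) + partial_x g (Complex x y) * cis (k * x)) has_integral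
          (g (Complex 1 y) * cis (k * 1) - g (Complex 0 y) * cis (k * 0))) {0..1}"
    by (rule fundamental_theorem_of_calculus)
       (auto intro!: has_vector_derivative_mult has_vector_derivative_cis_mult
          has_vector_derivative_at_within[OF has_vector_derivative_x[OF g(1) y]])
  moreover have "cis k = 1"
    using cis_2pi_eq_1_iff[of "- of_int n"] by (simp add: k_def)
  ultimately have total: "((\<lambda>x. g (Complex x y) * (\<i> * of_real k * cis (k * x)) + partial_x g (Complex x y) *
      cis (k * x)) has_integral 0) {0..1}"
    using one_periodic_Complex[OF g(2) y, of 0] by simp
  have first: "((\<lambda>x. \<i> * of_real k * (g (Complex x y) * cis (k * x))) has_integral (\<i> * of_real k *
      horocycle_coeff g n y)) {0..1}"
    unfolding horocycle_coeff_def fourier_coeff_def k_def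
    by (intro has_integral_mult_right integrable_integral integrable_mult_cis continuous_on_horizontal
      smooth_on_continuous g y)
  from has_integral_diff[OF total first]
  have "((\<lambda>x. partial_x g (Complex x y) * cis (k * x)) has_integral - (\<i> * of_real k * horocycle_coeff g n y)) {0..1}"
    by (simp add: algebra_simps)
  thus ?thesis by (simp add: horocycle_coeff_def fourier_coeff_def k_def integral_unique algebra_simps)
qed

inductive iterated_partial :: "(complex \<Rightarrow> complex) \<Rightarrow> (complex \<Rightarrow> complex) \<Rightarrow> bool" for f where
  iterated_partial_refl: "iterated_partial f f"
| iterated_partial_x: "iterated_partial f g \<Longrightarrow> iterated_partial f (partial_x g)"
| iterated_partial_y: "iterated_partial f g \<Longrightarrow> iterated_partial f (partial_y g)"

lemma iterated_partial_smooth: "iterated_partial f g \<Longrightarrow> smooth_on upper_half_plane f \<Longrightarrow> smooth_on upper_half_plane g"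
  by (induction rule: iterated_partial.induct) (auto intro: smooth_on_partial_x smooth_on_partial_y)

lemma iterated_partial_one_periodic: "iterated_partial f g \<Longrightarrow> one_periodic f \<Longrightarrow> one_periodic g"
  by (induction rule: iterated_partial.induct) (auto intro: one_periodic_partial_x one_periodic_partial_y)

lemma horocycle_fourier_series:
  assumes g: "smooth_on upper_half_plane g" "one_periodic g" and y: "y > 0"
    and constant_term: "horocycle_coeff g 0 y = 0"
  shows "(\<lambda>k. horocycle_coeff g (int (Suc k)) y * cis (2 * pi * real (Suc k) * x) +
              horocycle_coeff g (- int (Suc k)) y * cis (- 2 * pi * real (Suc k) * x)) sums g (Complex x y)"
proof -
  have "(\<lambda>N. \<Sum>n=-int N..int N. horocycle_coeff g n y * cis (2 * pi * of_int n * x)) \<longlonglongrightarrow> g (Complex x y)"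
    unfolding horocycle_coeff_def
    by (rule fourier_series) (use g y in \<open>auto intro!: continuous_on_horizontal smooth_on_continuous
        has_vector_derivative_x one_periodic_Complex\<close>)
  moreover have "(\<Sum>n=-int N..int N. horocycle_coeff g n y * cis (2 * pi * of_int n * x)) =
      (\<Sum>k<N. horocycle_coeff g (int (Suc k)) y * cis (2 * pi * real (Suc k) * x) +
              horocycle_coeff g (- int (Suc k)) y * cis (- 2 * pi * real (Suc k) * x))" for N
  proof (induction N)
    case (Suc N)
    thus ?case unfolding sum_symmetric_int_Suc by (simp add: algebra_simps)
  qed (simp add: constant_term)
  ultimately show ?thesis by (simp add: sums_def)
qed

lemma summable_power_mult_exp:
  fixes c :: real
  assumes c: "c > 0"
  shows "summable (\<lambda>k. real (Suc k) ^ B * exp (- c * real (Suc k)))"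
proof (rule summable_comparison_test)
  define K where "K = (real B / (c / 2)) ^ B"
  show "\<exists>N. \<forall>n\<ge>N. norm (real (Suc n) ^ B * exp (- c * real (Suc n))) \<le> K * exp (- c / 2) ^ (Suc n)"
  proof (intro exI[of _ 0] allI impI)
    fix n
    have "real (Suc n) ^ B * exp (- c * real (Suc n)) =
          (real (Suc n) ^ B * exp (- (c / 2) * real (Suc n))) * exp (- (c / 2) * real (Suc n))"
      by (simp add: mult.assoc field_simps flip: exp_add)
    also have "\<dots> \<le> K * exp (- (c / 2) * real (Suc n))"
      unfolding K_def using c by (intro mult_right_mono power_mult_exp_minus_le) auto
    also have "exp (- (c / 2) * real (Suc n)) = exp (- c / 2) ^ (Suc n)"
      by (subst exp_of_nat_mult[symmetric]) (simp add: field_simps)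
    finally show "norm (real (Suc n) ^ B * exp (- c * real (Suc n))) \<le> K * exp (- c / 2) ^ (Suc n)" by simp
  qed
  show "summable (\<lambda>n. K * exp (- c / 2) ^ (Suc n))"
    using c by (intro summable_mult, subst summable_Suc_iff) (auto intro: summable_geometric)
qed

text \<open>
  By the radial equation, the Fourier coefficients of all iterated derivatives of a Maass form are
  combinations of those of the form and of its \<open>y\<close>-derivative with coefficients of this kind.
\<close>

inductive freq_poly :: "(int \<Rightarrow> real \<Rightarrow> complex) \<Rightarrow> bool" where
  freq_poly_const: "freq_poly (\<lambda>n y. c)"
| freq_poly_freq: "freq_poly (\<lambda>n y. of_int n)"
| freq_poly_inv: "freq_poly (\<lambda>n y. of_real (1 / y))"
| freq_poly_add: "freq_poly A \<Longrightarrow> freq_poly B \<Longrightarrow> freq_poly (\<lambda>n y. A n y + B n y)"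
| freq_poly_mult: "freq_poly A \<Longrightarrow> freq_poly B \<Longrightarrow> freq_poly (\<lambda>n y. A n y * B n y)"

lemma freq_poly_deriv:
  "freq_poly A \<Longrightarrow> \<exists>A'. freq_poly A' \<and> (\<forall>n. \<forall>y>0. (A n has_vector_derivative A' n y) (at y))"
proof (induction rule: freq_poly.induct)
  case (freq_poly_const c)
  show ?case by (intro exI[of _ "\<lambda>n y. 0"]) (auto intro: freq_poly.intros)
next
  case freq_poly_freq
  show ?case by (intro exI[of _ "\<lambda>n y. 0"]) (auto intro: freq_poly.intros)
next
  case freq_poly_inv
  have "freq_poly (\<lambda>n y. (-1) * (of_real (1 / y) * of_real (1 / y)))"
    by (intro freq_poly.intros)
  moreover have "((\<lambda>y. of_real (1 / y)) has_vector_derivative (-1) * (of_real (1 / y) * complex_of_real (1 / y)))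
      (at y)"
    if "y > 0" for y :: real
  proof -
    have "((\<lambda>y. 1 / y) has_real_derivative - 1 * (1 / y * (1 / y))) (at y)"
      using that by (auto intro!: derivative_eq_intros)
    hence "((\<lambda>y. complex_of_real (1 / y)) has_vector_derivative of_real (- 1 * (1 / y * (1 / y)))) (at y)"
      by (rule has_vector_derivative_of_real)
    thus ?thesis by simp
  qed
  ultimately show ?case by blast
next
  case (freq_poly_add A B)
  then obtain A' B' where "freq_poly A'" "freq_poly B'"
    "\<forall>n. \<forall>y>0. (A n has_vector_derivative A' n y) (at y)" "\<forall>n. \<forall>y>0. (B n has_vector_derivative B' n y) (at y)"
      by blast
  thus ?case
    by (intro exI[of _ "\<lambda>n y. A' n y + B' n y"]) (auto intro: freq_poly.intros has_vector_derivative_add)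
next
  case (freq_poly_mult A B)
  then obtain A' B' where "freq_poly A'" "freq_poly B'"
    "\<forall>n. \<forall>y>0. (A n has_vector_derivative A' n y) (at y)" "\<forall>n. \<forall>y>0. (B n has_vector_derivative B' n y) (at y)"
      by blast
  thus ?case using freq_poly_mult.hyps
    by (intro exI[of _ "\<lambda>n y. A n y * B' n y + A' n y * B n y"])
       (auto intro!: freq_poly.intros has_vector_derivative_mult)
qed

lemma freq_poly_bound:
  assumes c: "c > 0"
  shows "freq_poly A \<Longrightarrow> \<exists>C\<ge>0. \<exists>B::nat. \<forall>n y. y \<ge> c \<longrightarrow> norm (A n y) \<le> C * (1 + \<bar>real_of_int n\<bar>) ^ B"
proof (induction rule: freq_poly.induct)
  case (freq_poly_const k)
  show ?case by (intro exI[of _ "norm k"] conjI exI[of _ 0]) auto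
next
  case freq_poly_freq
  show ?case by (intro exI[of _ 1] conjI exI[of _ 1]) auto
next
  case freq_poly_inv
  show ?case using c by (intro exI[of _ "1 / c"] conjI exI[of _ 0]) (auto simp: norm_divide field_simps)
next
  case (freq_poly_add A B)
  then obtain C1 B1 C2 B2 where bounds: "C1 \<ge> 0" "C2 \<ge> 0"
    "\<And>n y. y \<ge> c \<Longrightarrow> norm (A n y) \<le> C1 * (1 + \<bar>real_of_int n\<bar>) ^ B1"
    "\<And>n y. y \<ge> c \<Longrightarrow> norm (B n y) \<le> C2 * (1 + \<bar>real_of_int n\<bar>) ^ B2" by metis
  have "norm (A n y + B n y) \<le> (C1 + C2) * (1 + \<bar>real_of_int n\<bar>) ^ (B1 + B2)" if "y \<ge> c" for n y
  proof -
    have "norm (A n y + B n y) \<le> C1 * (1 + \<bar>real_of_int n\<bar>) ^ B1 + C2 * (1 + \<bar>real_of_int n\<bar>) ^ B2"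
      using bounds(3,4)[OF that] by (intro norm_triangle_le add_mono) auto
    also have "\<dots> \<le> C1 * (1 + \<bar>real_of_int n\<bar>) ^ (B1 + B2) + C2 * (1 + \<bar>real_of_int n\<bar>) ^ (B1 + B2)"
      using bounds by (intro add_mono mult_left_mono power_increasing) auto
    finally show ?thesis by (simp add: algebra_simps)
  qed
  thus ?case using bounds by (intro exI[of _ "C1 + C2"] conjI exI[of _ "B1 + B2"]) auto
next
  case (freq_poly_mult A B)
  then obtain C1 B1 C2 B2 where bounds: "C1 \<ge> 0" "C2 \<ge> 0"
    "\<And>n y. y \<ge> c \<Longrightarrow> norm (A n y) \<le> C1 * (1 + \<bar>real_of_int n\<bar>) ^ B1"
    "\<And>n y. y \<ge> c \<Longrightarrow> norm (B n y) \<le> C2 * (1 + \<bar>real_of_int n\<bar>) ^ B2" by metis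
  have "norm (A n y * B n y) \<le> (C1 * C2) * (1 + \<bar>real_of_int n\<bar>) ^ (B1 + B2)" if "y \<ge> c" for n y
  proof -
    have "norm (A n y * B n y) \<le> (C1 * (1 + \<bar>real_of_int n\<bar>) ^ B1) * (C2 * (1 + \<bar>real_of_int n\<bar>) ^ B2)"
      unfolding norm_mult using bounds(1,2) bounds(3,4)[OF that] by (intro mult_mono) auto
    thus ?thesis by (simp add: power_add mult_ac)
  qed
  thus ?case using bounds by (intro exI[of _ "C1 * C2"] conjI exI[of _ "B1 + B2"]) auto
qed

section \<open>Fourier coefficients and Hecke eigenvalues\<close>

lemma Im_moebius:
  fixes a b c d :: real
  shows "Im ((of_real a * z + of_real b) / (of_real c * z + of_real d)) =
           (a * d - b * c) * Im z / (norm (of_real c * z + of_real d))\<^sup>2"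
  unfolding Im_divide cmod_power2 by (simp add: algebra_simps)

lemma ex_coprime_small_denominator:
  fixes x y :: real
  assumes y: "0 < y" "y < 1"
  shows "\<exists>h k :: int. coprime h k \<and> k > 0 \<and> (of_int k * x - of_int h)\<^sup>2 + (of_int k * y)\<^sup>2 \<le> 5 * y"
proof -
  define r where "r = 1 / sqrt y"
  have r: "r \<ge> 1" "r\<^sup>2 * y = 1" using y by (auto simp: r_def real_sqrt_le_1_iff power_divide)
  define N where "N = nat \<lfloor>r\<rfloor>"
  have "\<lfloor>r\<rfloor> \<ge> 1" using r by linarith
  hence "real N = of_int \<lfloor>r\<rfloor>" "real_of_int \<lfloor>r\<rfloor> \<ge> 1" by (simp_all add: N_def)
  hence "real N \<ge> 1" "real N \<le> r" "real N \<ge> r / 2" by linarith+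
  hence N: "N > 0" "real N \<le> r" "real N \<ge> r / 2" by simp_all
  obtain h k :: int where hk: "coprime h k" "0 < k" "k \<le> int N" "\<bar>of_int k * x - of_int h\<bar> < 1 / real N"
    using Dirichlet_approx_coprime[of N x] N(1) by metis
  have "(of_int k * x - of_int h)\<^sup>2 \<le> (1 / real N)\<^sup>2"
    using hk(4) by (intro power2_le_iff_abs_le[THEN iffD2]) auto
  also have "\<dots> \<le> (2 / r)\<^sup>2"
    using N r by (intro power_mono) (auto simp: field_simps)
  also have "\<dots> = 4 * y" using r by (simp add: power_divide field_simps)
  finally have "(of_int k * x - of_int h)\<^sup>2 \<le> 4 * y" .
  moreover have "(of_int k * y)\<^sup>2 \<le> (r * y)\<^sup>2"
    using hk N y by (intro power_mono mult_right_mono) (auto intro: order.trans[of _ "real N"])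
  moreover have "(r * y)\<^sup>2 = y" using r by (simp add: power_mult_distrib power2_eq_square[of y] mult.assoc[symmetric])
  ultimately show ?thesis using hk by (intro exI[of _ h] exI[of _ k]) auto
qed

locale hecke_form =
  fixes f :: "complex \<Rightarrow> complex"
  assumes hecke_maass_cusp_form: "hecke_maass_cusp_form f"
begin

abbreviation "eigenvalue \<equiv> hecke_eigenvalue f"

lemma maass_cusp_form: "maass_cusp_form f"
  using hecke_maass_cusp_form by (simp add: hecke_maass_cusp_form_def)

lemma smooth: "smooth_on upper_half_plane f"
  using maass_cusp_form by (simp add: maass_cusp_form_def)

lemma continuous: "continuous_on upper_half_plane f"
  by (rule smooth_on_continuous[OF smooth])

lemma invariant:
  fixes a b c d :: int
  assumes "a * d - b * c = 1" "z \<in> upper_half_plane"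
  shows "f ((of_int a * z + of_int b) / (of_int c * z + of_int d)) = f z"
  using maass_cusp_form assms unfolding maass_cusp_form_def SL2Z_invariant_def by blast

lemma translate: "z \<in> upper_half_plane \<Longrightarrow> f (z + of_int k) = f z"
  using invariant[of 1 1 k 0 z] by simp

lemma one_periodic: "one_periodic f"
  unfolding one_periodic_def using translate[of _ 1] by simp

definition "laplace_eigenvalue = (SOME \<mu>. \<forall>z\<in>upper_half_plane. hyperbolic_laplacian f z = \<mu> * f z)"

lemma laplacian:
  assumes "z \<in> upper_half_plane"
  shows "hyperbolic_laplacian f z = laplace_eigenvalue * f z"
proof -
  have "\<exists>\<mu>. \<forall>z\<in>upper_half_plane. hyperbolic_laplacian f z = \<mu> * f z"
    using maass_cusp_form by (auto simp: maass_cusp_form_def)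
  from someI_ex[OF this] assms show ?thesis
    unfolding laplace_eigenvalue_def by blast
qed

definition "fcoeff = horocycle_coeff f"
definition "fcoeff_deriv = horocycle_coeff (partial_y f)"

lemma fcoeff_0: "y > 0 \<Longrightarrow> fcoeff 0 y = 0"
  using maass_cusp_form by (simp add: fcoeff_def horocycle_coeff_def fourier_coeff_def maass_cusp_form_def)

lemma fcoeff_has_vector_derivative: "y > 0 \<Longrightarrow> (fcoeff n has_vector_derivative fcoeff_deriv n y) (at y)"
  unfolding fcoeff_def fcoeff_deriv_def by (rule horocycle_coeff_has_vector_derivative[OF smooth])

lemma fcoeff_deriv_0:
  assumes y: "y > 0"
  shows "fcoeff_deriv 0 y = 0"
proof -
  have "(fcoeff 0 has_vector_derivative 0) (at y)"
    by (rule has_vector_derivative_transform_within_open[of "\<lambda>_. 0" _ _ "{0<..}"]) (use y fcoeff_0 in auto)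
  from vector_derivative_unique_at[OF fcoeff_has_vector_derivative[OF y] this] show ?thesis .
qed

lemma fcoeff_deriv_has_vector_derivative:
  assumes y: "y > 0"
  shows "(fcoeff_deriv n has_vector_derivative
           (of_real ((2 * pi * of_int n)\<^sup>2) - laplace_eigenvalue / of_real (y\<^sup>2)) * fcoeff n y) (at y)"
proof -
  have smooth_x: "smooth_on upper_half_plane (partial_x f)" and smooth_y: "smooth_on upper_half_plane (partial_y f)"
    and smooth_xx: "smooth_on upper_half_plane (partial_x (partial_x f))"
    by (intro smooth_on_partial_x smooth_on_partial_y smooth)+
  define k where "k = - laplace_eigenvalue / of_real (y\<^sup>2)"
  have "partial_y (partial_y f) (Complex x y) = k * f (Complex x y) - partial_x (partial_x f) (Complex x y)" for x
  proof -
    define A B where "A = partial_x (partial_x f) (Complex x y)" and "B = partial_y (partial_y f) (Complex x y)"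
    have "- of_real (y\<^sup>2) * (A + B) = laplace_eigenvalue * f (Complex x y)"
      using laplacian[of "Complex x y"] y by (simp add: hyperbolic_laplacian_def A_def B_def)
    hence "k * f (Complex x y) = - (- of_real (y\<^sup>2) * (A + B)) / of_real (y\<^sup>2)" by (simp add: k_def)
    also have "\<dots> = A + B" using y by simp
    finally show ?thesis by (simp add: A_def B_def)
  qed
  hence "horocycle_coeff (partial_y (partial_y f)) n y =
     integral {0..1} (\<lambda>x. k * (f (Complex x y) * cis (- 2 * pi * of_int n * x)) -
        partial_x (partial_x f) (Complex x y) * cis (- 2 * pi * of_int n * x))"
    unfolding horocycle_coeff_def fourier_coeff_def by (simp only: left_diff_distrib mult.assoc)
  also have "\<dots> = k * fcoeff n y - horocycle_coeff (partial_x (partial_x f)) n y"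
    unfolding horocycle_coeff_def fcoeff_def fourier_coeff_def
    by (intro integral_unique has_integral_diff has_integral_mult_right integrable_integral integrable_mult_cis
          continuous_on_horizontal continuous smooth_on_continuous smooth_xx y)
  also have "horocycle_coeff (partial_x (partial_x f)) n y =
      2 * of_real pi * \<i> * of_int n * (2 * of_real pi * \<i> * of_int n * fcoeff n y)"
    unfolding fcoeff_def
    by (simp only: horocycle_coeff_partial_x[OF smooth_x one_periodic_partial_x[OF one_periodic] y]
          horocycle_coeff_partial_x[OF smooth one_periodic y])
  finally have "horocycle_coeff (partial_y (partial_y f)) n y =
      (of_real ((2 * pi * of_int n)\<^sup>2) - laplace_eigenvalue / of_real (y\<^sup>2)) * fcoeff n y"
    by (simp add: k_def algebra_simps power2_eq_square)
  thus ?thesis using horocycle_coeff_has_vector_derivative[OF smooth_y y, of n] by (simp add: fcoeff_deriv_def)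
qed

lemma radial_solution_fcoeff: "radial_solution (2 * pi * of_int n) laplace_eigenvalue (fcoeff n) (fcoeff_deriv n)"
  unfolding radial_solution_def using fcoeff_has_vector_derivative fcoeff_deriv_has_vector_derivative by blast

lemma fcoeff_nonzero: "\<exists>n y. y > 0 \<and> fcoeff n y \<noteq> 0"
proof (rule ccontr)
  assume "\<not> (\<exists>n y. y > 0 \<and> fcoeff n y \<noteq> 0)"
  hence zero: "horocycle_coeff f n y = 0" if "y > 0" for n y using that by (auto simp: fcoeff_def)
  obtain w where w: "w \<in> upper_half_plane" "f w \<noteq> 0" using maass_cusp_form by (auto simp: maass_cusp_form_def)
  hence "Im w > 0" by (simp add: upper_half_plane_def)
  from horocycle_fourier_series[OF smooth one_periodic this zero[OF this], of "Re w"] zero[OF this]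
  have "f w = 0" by (simp add: sums_iff)
  with w show False by simp
qed

lemma fcoeff_hecke:
  assumes n: "n \<ge> 1" and y: "y > 0"
  shows "of_real (sqrt (real n)) * eigenvalue n * fcoeff m y =
     (\<Sum>d | d dvd n. if int (n div d) dvd m
        then of_nat d * fcoeff (m div int (n div d) * int d) (real (n div d) * y / real d) else 0)"
proof -
  define g where "g = (\<lambda>d u. f (Complex u (real (n div d) * y / real d)))"
  define \<phi> where "\<phi> = (\<lambda>d x. \<Sum>b<d. g d ((real (n div d) * x + real b) / real d))"
  have pos: "d > 0" "n div d > 0" if "d dvd n" for d
    using that n by (auto simp: dvd_div_eq_0_iff intro: Nat.gr0I)
  have g: "continuous_on A (g d)" "g d (u + 1) = g d u" if "d dvd n" for d u A
    unfolding g_def using pos[OF that] y by (auto intro!: continuous_on_horizontal continuous one_periodic_Complex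
      one_periodic)
  have \<phi>: "continuous_on A (\<phi> d)" if "d dvd n" for d A
    unfolding \<phi>_def by (intro continuous_intros continuous_on_compose2[OF g(1)[OF that, of UNIV]])
      (use pos[OF that] in auto)
  have hecke: "of_real (sqrt (real n)) * (eigenvalue n * f (Complex x y)) = (\<Sum>d | d dvd n. \<phi> d x)" for x
  proof -
    have "(of_nat (n div d) * Complex x y + of_nat b) / of_nat d =
       Complex ((real (n div d) * x + real b) / real d) (real (n div d) * y / real d)" for d b
      by (simp add: complex_eq_iff Re_divide_of_nat Im_divide_of_nat)
    hence "eigenvalue n * f (Complex x y) = (\<Sum>d | d dvd n. \<phi> d x) / of_real (sqrt (real n))"
      using hecke_operator_eigenvalue[OF hecke_maass_cusp_form n, of "Complex x y"] y
      unfolding hecke_operator_def \<phi>_def g_def by simp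
    thus ?thesis using n by simp
  qed
  have "of_real (sqrt (real n)) * eigenvalue n * fcoeff m y =
        integral {0..1} (\<lambda>x. \<Sum>d | d dvd n. \<phi> d x * cis (- 2 * pi * of_int m * x))"
    unfolding fcoeff_def horocycle_coeff_def fourier_coeff_def integral_mult_right[symmetric]
      sum_distrib_right[symmetric]
    by (intro integral_cong) (simp only: hecke[symmetric] mult.assoc)
  also have "\<dots> = (\<Sum>d | d dvd n. fourier_coeff (\<phi> d) m)"
    unfolding fourier_coeff_def using n by (intro integral_sum integrable_mult_cis \<phi>) auto
  also have "\<dots> = (\<Sum>d | d dvd n. if int (n div d) dvd m
        then of_nat d * fcoeff (m div int (n div d) * int d) (real (n div d) * y / real d) else 0)"
  proof (intro sum.cong refl)
    fix d assume "d \<in> {d. d dvd n}"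
    hence d: "d dvd n" by simp
    show "fourier_coeff (\<phi> d) m = (if int (n div d) dvd m
        then of_nat d * fcoeff (m div int (n div d) * int d) (real (n div d) * y / real d) else 0)"
      using fourier_coeff_hecke_average[OF g(1)[OF d] g(2)[OF d] pos(2)[OF d] pos(1)[OF d], of m]
      by (simp add: \<phi>_def g_def fcoeff_def horocycle_coeff_def)
  qed
  finally show ?thesis .
qed

lemma fcoeff_scale:
  assumes n: "n \<ge> 1" and y: "y > 0" and s: "\<bar>s\<bar> = 1"
  shows "fcoeff (s * int n) y = eigenvalue n / of_real (sqrt (real n)) * fcoeff s (real n * y)"
proof -
  have "of_real (sqrt (real n)) * eigenvalue n * fcoeff s (real n * y) =
     (\<Sum>d | d dvd n. if int (n div d) dvd s
        then of_nat d * fcoeff (s div int (n div d) * int d) (real (n div d) * (real n * y) / real d) else 0)"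
    using n y by (intro fcoeff_hecke) auto
  also have "\<dots> = (\<Sum>d | d dvd n. if d = n then of_nat n * fcoeff (s * int n) y else 0)"
  proof (intro sum.cong refl)
    fix d assume "d \<in> {d. d dvd n}"
    hence d: "d dvd n" by simp
    have "int (n div d) dvd s \<longleftrightarrow> d = n"
    proof
      assume "int (n div d) dvd s"
      hence "n div d = 1" using s by (metis dvd_abs_iff int_dvd_int_iff nat_dvd_1_iff_1 of_nat_1)
      thus "d = n" using d by (metis dvd_mult_div_cancel mult.right_neutral)
    qed (use n in auto)
    thus "(if int (n div d) dvd s
        then of_nat d * fcoeff (s div int (n div d) * int d) (real (n div d) * (real n * y) / real d) else 0) =
       (if d = n then of_nat n * fcoeff (s * int n) y else 0)" using n by auto
  qed
  also have "\<dots> = of_nat n * fcoeff (s * int n) y" using n by (simp add: sum.delta)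
  also have "of_nat n = complex_of_real (sqrt (real n)) * of_real (sqrt (real n))"
    by (simp flip: of_real_mult)
  finally show ?thesis using n by (simp add: field_simps)
qed

lemma fcoeff_hecke_prime:
  assumes q: "prime q" and y: "y > 0"
  shows "of_real (sqrt (real q)) * eigenvalue q * fcoeff m y =
    (if int q dvd m then fcoeff (m div int q) (real q * y) else 0) + of_nat q * fcoeff (m * int q) (y / real q)"
proof -
  have "q > 1" using q prime_gt_1_nat by blast
  moreover have "{d. d dvd q} = {1, q}" using q by (auto simp: prime_nat_iff)
  ultimately show ?thesis using fcoeff_hecke[of q y m] y by simp
qed

lemma ex_equivalent_large_Im:
  assumes z: "z \<in> upper_half_plane" "Im z < 1"
  shows "\<exists>w. f w = f z \<and> Im w \<ge> 1 / 5 \<and> Im w \<le> 1 / Im z"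
proof -
  have y: "0 < Im z" using z by (simp add: upper_half_plane_def)
  obtain h k :: int where hk: "coprime h k" "k > 0" "(of_int k * Re z - of_int h)\<^sup>2 + (of_int k * Im z)\<^sup>2 \<le> 5 * Im z"
    using ex_coprime_small_denominator[OF y z(2), of "Re z"] by blast
  obtain u v where uv: "u * h + v * k = 1"
    using bezout_int[of h k] hk(1) by (auto simp: coprime_iff_gcd_eq_1)
  define den where "den = of_int k * z + of_int (- h)"
  define w where "w = (of_int (- u) * z + of_int (- v)) / den"
  have det: "(- u) * (- h) - (- v) * k = 1" using uv by (simp add: algebra_simps)
  have "(norm den)\<^sup>2 = (of_int k * Re z - of_int h)\<^sup>2 + (of_int k * Im z)\<^sup>2"
    by (simp add: den_def cmod_power2)
  moreover have "(1 * Im z)\<^sup>2 \<le> (of_int k * Im z)\<^sup>2" using hk y by (intro power_mono mult_right_mono) auto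
  ultimately have den: "(norm den)\<^sup>2 \<le> 5 * Im z" "(norm den)\<^sup>2 \<ge> (Im z)\<^sup>2"
    using hk(3) zero_le_power2[of "of_int k * Re z - of_int h"] by (simp_all only: mult_1)
  hence "den \<noteq> 0" using y by auto
  have "Im w = real_of_int ((- u) * (- h) - (- v) * k) * Im z / (norm den)\<^sup>2"
    using Im_moebius[of "of_int (- u)" z "of_int (- v)" "of_int k" "of_int (- h)"] by (simp add: w_def den_def)
  hence Im_w: "Im w = Im z / (norm den)\<^sup>2" unfolding det by simp
  have "f w = f z" unfolding w_def den_def by (rule invariant[OF det z(1)])
  moreover have "Im w \<ge> 1 / 5" "Im w \<le> 1 / Im z"
    unfolding Im_w using den y \<open>den \<noteq> 0\<close> by (simp_all add: field_simps power2_eq_square)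
  ultimately show ?thesis by blast
qed

lemma poly_bound_large_Im: "\<exists>C\<ge>0. \<exists>m::nat. \<forall>z. Im z \<ge> 1 / 5 \<longrightarrow> norm (f z) \<le> C * (1 + Im z) ^ m"
proof -
  obtain C A where CA: "\<And>z. Im z \<ge> 1 \<Longrightarrow> norm (f z) \<le> C * Im z powr A"
    using maass_cusp_form unfolding maass_cusp_form_def by blast
  obtain m :: nat where m: "real m \<ge> A" using real_arch_simple by blast
  define K where "K = {0..1::real} \<times> {1/5..1::real}"
  have "compact ((\<lambda>p. f (Complex (fst p) (snd p))) ` K)"
    unfolding K_def
    by (intro compact_continuous_image compact_Times continuous_on_compose2[OF continuous] continuous_intros) auto
  hence "bounded ((\<lambda>p. f (Complex (fst p) (snd p))) ` K)" by (rule compact_imp_bounded)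
  then obtain B where B: "\<And>p. p \<in> K \<Longrightarrow> norm (f (Complex (fst p) (snd p))) \<le> B"
    unfolding bounded_iff by blast
  define D where "D = max \<bar>C\<bar> \<bar>B\<bar>"
  have "norm (f z) \<le> D * (1 + Im z) ^ m" if z: "Im z \<ge> 1 / 5" for z
  proof (cases "Im z \<ge> 1")
    case True
    have "Im z powr A \<le> Im z powr real m" using True m by (intro powr_mono) auto
    also have "\<dots> = Im z ^ m" using True by (simp add: powr_realpow)
    also have "\<dots> \<le> (1 + Im z) ^ m" using True by (intro power_mono) auto
    finally have "C * Im z powr A \<le> D * (1 + Im z) ^ m" by (intro mult_mono) (auto simp: D_def)
    with CA[OF True] show ?thesis by simp
  next
    case False
    define w where "w = z + of_int (- \<lfloor>Re z\<rfloor>)"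
    have "f w = f z" unfolding w_def using z by (intro translate) (auto simp: upper_half_plane_def)
    moreover have "Re z - of_int \<lfloor>Re z\<rfloor> \<ge> 0" "Re z - of_int \<lfloor>Re z\<rfloor> \<le> 1" by linarith+
    hence "(Re w, Im w) \<in> K" using z False by (auto simp: K_def w_def)
    ultimately have "norm (f z) \<le> D * 1" using B[of "(Re w, Im w)"] by (auto simp: D_def)
    also have "\<dots> \<le> D * (1 + Im z) ^ m" using z by (intro mult_left_mono one_le_power) (auto simp: D_def)
    finally show ?thesis .
  qed
  moreover have "D \<ge> 0" by (simp add: D_def)
  ultimately show ?thesis by blast
qed

lemma poly_bound: "\<exists>C\<ge>0. \<exists>m::nat. \<forall>z\<in>upper_half_plane. norm (f z) \<le> C * (1 + Im z + 1 / Im z) ^ m"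
proof -
  obtain C m where C: "C \<ge> 0" "\<And>z. Im z \<ge> 1 / 5 \<Longrightarrow> norm (f z) \<le> C * (1 + Im z) ^ m"
    using poly_bound_large_Im by blast
  have "norm (f z) \<le> C * (1 + Im z + 1 / Im z) ^ m" if z: "z \<in> upper_half_plane" for z
  proof -
    have y: "Im z > 0" using z by (simp add: upper_half_plane_def)
    obtain w where w: "f w = f z" "Im w \<ge> 1 / 5" "Im w \<le> Im z + 1 / Im z"
    proof (cases "Im z < 1")
      case True
      with ex_equivalent_large_Im[OF z] y that show ?thesis by force
    qed (use that[of z] y in auto)
    have "norm (f z) \<le> C * (1 + Im w) ^ m" using C(2)[OF w(2)] w(1) by simp
    also have "\<dots> \<le> C * (1 + Im z + 1 / Im z) ^ m"
      using w C(1) by (intro mult_left_mono power_mono) auto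
    finally show ?thesis .
  qed
  thus ?thesis using C(1) by blast
qed

lemma fcoeff_poly_bound: "\<exists>C\<ge>0. \<exists>m::nat. \<forall>n y. y > 0 \<longrightarrow> norm (fcoeff n y) \<le> C * (1 + y + 1 / y) ^ m"
proof -
  obtain C m where C: "C \<ge> 0" "\<And>z. z \<in> upper_half_plane \<Longrightarrow> norm (f z) \<le> C * (1 + Im z + 1 / Im z) ^ m"
    using poly_bound by blast
  have "norm (fcoeff n y) \<le> C * (1 + y + 1 / y) ^ m" if "y > 0" for n y
    unfolding fcoeff_def horocycle_coeff_def
    using C(2)[of "Complex _ y"] that by (intro norm_fourier_coeff_le continuous_on_horizontal continuous) auto
  thus ?thesis using C(1) by blast
qed

definition "spectral_parameter = csqrt (1 / 4 - laplace_eigenvalue)"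

abbreviation "W \<equiv> whittaker spectral_parameter"
abbreviation "W' \<equiv> whittaker' spectral_parameter"

lemma radial_solution_W: "radial_solution (2 * pi) laplace_eigenvalue W W'"
  using radial_solution_whittaker[of spectral_parameter] by (simp add: spectral_parameter_def)

definition "first_coeff s = (SOME c. \<forall>y>0. fcoeff s y = c * W y)"

lemma fcoeff_eq_W:
  assumes s: "\<bar>s\<bar> = 1" and "y > 0"
  shows "fcoeff s y = first_coeff s * W y"
proof -
  obtain C m where C: "C \<ge> 0" "\<And>n y. y > 0 \<Longrightarrow> norm (fcoeff n y) \<le> C * (1 + y + 1 / y) ^ m"
    using fcoeff_poly_bound by blast
  have growth: "norm (fcoeff s y) \<le> C * 3 ^ m * y ^ m" if y: "y \<ge> 1" for y
  proof -
    have "1 / y \<le> 1" using y by simp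
    hence "1 + y + 1 / y \<le> 3 * y" using y by linarith
    hence "C * (1 + y + 1 / y) ^ m \<le> C * (3 * y) ^ m"
      using y C by (intro mult_left_mono power_mono) auto
    with C(2)[of y s] y show ?thesis by (simp add: power_mult_distrib)
  qed
  obtain K where K: "\<And>y. y \<ge> 1 \<Longrightarrow> norm (W y) \<le> K * exp (- pi * y)" "\<And>y. y \<ge> 1 \<Longrightarrow> norm (W' y) \<le> K * exp (- pi * y)"
    using whittaker_exp_decay[of 1] by fastforce
  obtain y0 where y0: "y0 > 0" "W y0 \<noteq> 0" using whittaker_nonzero by blast
  have "s = 1 \<or> s = - 1" using s by linarith
  hence "radial_solution (2 * pi) laplace_eigenvalue (fcoeff s) (fcoeff_deriv s)"
    using radial_solution_fcoeff[of 1] radial_solution_fcoeff[of "-1"] by (auto simp: radial_solution_def)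
  from recessive_solutions_proportional[OF this radial_solution_W growth pi_gt_zero K y0]
  have "\<exists>c. \<forall>y>0. fcoeff s y = c * W y" by blast
  from someI_ex[OF this] \<open>y > 0\<close> show ?thesis unfolding first_coeff_def by blast
qed

lemma fcoeff_whittaker:
  assumes "n \<ge> 1" "y > 0" "\<bar>s\<bar> = 1"
  shows "fcoeff (s * int n) y = eigenvalue n / of_real (sqrt (real n)) * first_coeff s * W (real n * y)"
  using assms by (simp add: fcoeff_scale fcoeff_eq_W)

lemma fcoeff_deriv_whittaker:
  assumes n: "n \<ge> 1" and y: "y > 0" and s: "\<bar>s\<bar> = 1"
  shows "fcoeff_deriv (s * int n) y = eigenvalue n / of_real (sqrt (real n)) * first_coeff s * of_nat n *
      W' (real n * y)"
proof -
  define c where "c = eigenvalue n / of_real (sqrt (real n)) * first_coeff s"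
  have "(W \<circ> (\<lambda>y. real n * y) has_vector_derivative real n *\<^sub>R W' (real n * y)) (at y)"
    by (rule vector_diff_chain_at) (use n y in
      \<open>auto intro!: derivative_eq_intros radial_solutionD[OF radial_solution_W]\<close>)
  from has_vector_derivative_mult_right[OF this, of c]
  have "((\<lambda>y. c * W (real n * y)) has_vector_derivative c * (real n *\<^sub>R W' (real n * y))) (at y)"
    by (simp only: o_def)
  hence "(fcoeff (s * int n) has_vector_derivative c * (real n *\<^sub>R W' (real n * y))) (at y)"
    by (rule has_vector_derivative_transform_within_open[of _ _ _ "{0<..}"])
       (use n y s in \<open>auto simp: fcoeff_whittaker c_def\<close>)
  from vector_derivative_unique_at[OF fcoeff_has_vector_derivative[OF y] this]
  show ?thesis by (simp add: c_def scaleR_conv_of_real)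
qed

lemma int_eq_sign_mult_nat:
  fixes n :: int
  assumes "n \<noteq> 0"
  obtains s :: int and N :: nat where "n = s * int N" "\<bar>s\<bar> = 1" "N \<ge> 1" "real N = \<bar>of_int n\<bar>"
  using assms by (intro that[of "sgn n" "nat \<bar>n\<bar>"]) (auto simp: sgn_mult_abs abs_sgn_eq)

lemma first_coeff_nonzero: "\<exists>s. \<bar>s\<bar> = 1 \<and> first_coeff s \<noteq> 0"
proof -
  obtain n y where ny: "y > 0" "fcoeff n y \<noteq> 0" using fcoeff_nonzero by blast
  have "n \<noteq> 0" using ny fcoeff_0 by auto
  then obtain s N where "n = s * int N" "\<bar>s\<bar> = 1" "N \<ge> 1" using int_eq_sign_mult_nat by metis
  with fcoeff_whittaker[of N y s] ny show ?thesis by auto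
qed

lemma eigenvalue_poly_bound: "\<exists>C\<ge>0. \<exists>B::nat. \<forall>n\<ge>1. norm (eigenvalue n) \<le> C * real n ^ B"
proof -
  obtain s where s: "\<bar>s\<bar> = 1" "first_coeff s \<noteq> 0" using first_coeff_nonzero by blast
  obtain y0 where y0: "y0 > 0" "W y0 \<noteq> 0" using whittaker_nonzero by blast
  obtain C m where C: "C \<ge> 0" "\<And>n y. y > 0 \<Longrightarrow> norm (fcoeff n y) \<le> C * (1 + y + 1 / y) ^ m"
    using fcoeff_poly_bound by blast
  define w where "w = norm (first_coeff s * W y0)"
  have w: "w > 0" using s y0 by (simp add: w_def)
  define D where "D = C * (1 + y0 + 1 / y0) ^ m / w"
  have "norm (eigenvalue n) \<le> D * real n ^ Suc m" if n: "n \<ge> 1" for n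
  proof -
    have n1: "real n \<ge> 1" using n by simp
    have "norm (eigenvalue n) * w = sqrt (real n) * norm (fcoeff (s * int n) (y0 / real n))"
      using n y0 s by (simp add: fcoeff_whittaker w_def norm_mult norm_divide)
    also have "\<dots> \<le> real n * (C * ((1 + y0 + 1 / y0) * real n) ^ m)"
    proof (intro mult_mono)
      show "sqrt (real n) \<le> real n" using mult_left_mono[OF n1, of "real n"]
        by (intro real_le_lsqrt) (auto simp: power2_eq_square)
      have "y0 / real n \<le> y0 / 1" using n1 y0 by (intro divide_left_mono) auto
      also have "\<dots> \<le> y0 * real n" using n1 y0 by simp
      finally have "y0 / real n \<le> y0 * real n" .
      moreover have "1 / (y0 / real n) = 1 / y0 * real n" by simp
      moreover note n1
      ultimately have "1 + y0 / real n + 1 / (y0 / real n) \<le> (1 + y0 + 1 / y0) * real n"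
        by (simp only: distrib_right mult_1)
      hence "C * (1 + y0 / real n + 1 / (y0 / real n)) ^ m \<le> C * ((1 + y0 + 1 / y0) * real n) ^ m"
        using C y0 n by (intro mult_left_mono power_mono) auto
      thus "norm (fcoeff (s * int n) (y0 / real n)) \<le> C * ((1 + y0 + 1 / y0) * real n) ^ m"
        using C(2)[of "y0 / real n" "s * int n"] y0 n by simp
    qed auto
    also have "\<dots> = D * real n ^ Suc m * w"
      using w by (simp add: D_def power_mult_distrib)
    finally show ?thesis using w by simp
  qed
  moreover have "D \<ge> 0" using C y0 w by (simp add: D_def)
  ultimately show ?thesis by blast
qed

lemma eigenvalue_div_sqrt_poly_bound: "\<exists>C\<ge>0. \<exists>B::nat. \<forall>n\<ge>1. norm (eigenvalue n) / sqrt (real n) \<le> C * real n ^ B"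
proof -
  obtain C B where C: "C \<ge> 0" "\<And>n. n \<ge> 1 \<Longrightarrow> norm (eigenvalue n) \<le> C * real n ^ B"
    using eigenvalue_poly_bound by blast
  have "norm (eigenvalue n) / sqrt (real n) \<le> C * real n ^ B" if n: "n \<ge> 1" for n
  proof -
    have "norm (eigenvalue n) / sqrt (real n) \<le> norm (eigenvalue n) / 1" using n by (intro divide_left_mono) auto
    with C(2)[OF n] show ?thesis by simp
  qed
  with C(1) show ?thesis by blast
qed

lemma eigenvalue_mult:
  assumes q: "prime q" and m: "m \<ge> 1"
  shows "eigenvalue q * eigenvalue m = eigenvalue (q * m) + (if q dvd m then eigenvalue (m div q) else 0)"
proof -
  obtain s where s: "\<bar>s\<bar> = 1" "first_coeff s \<noteq> 0" using first_coeff_nonzero by blast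
  obtain y0 where y0: "y0 > 0" "W y0 \<noteq> 0" using whittaker_nonzero by blast
  define y where "y = y0 / real m"
  have y: "y > 0" "real m * y = y0" using y0 m by (auto simp: y_def)
  have q0: "q > 0" using q prime_gt_0_nat by blast
  define A where "A = first_coeff s * W y0"
  define Q M where "Q = complex_of_real (sqrt (real q))" and "M = complex_of_real (sqrt (real m))"
  have nz: "A \<noteq> 0" "Q \<noteq> 0" "M \<noteq> 0" and QQ: "of_nat q = Q * Q"
    using s y0 q0 m by (auto simp: A_def Q_def M_def simp flip: of_real_mult)
  have "fcoeff (s * int m) y = eigenvalue m / M * A"
    using m y s by (simp add: fcoeff_whittaker A_def M_def)
  moreover have "fcoeff (s * int m * int q) (y / real q) = eigenvalue (q * m) / (Q * M) * A"
    using fcoeff_whittaker[of "q * m" "y / real q" s] m y s q0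
    by (simp add: A_def Q_def M_def real_sqrt_mult mult_ac)
  moreover have "(if int q dvd s * int m then fcoeff (s * int m div int q) (real q * y) else 0) =
      (if q dvd m then eigenvalue (m div q) else 0) * Q / M * A"
  proof (cases "q dvd m")
    case True
    then obtain r where r: "m = q * r" by (elim dvdE)
    have "r \<ge> 1" using m r by (cases r) auto
    moreover have "real r * (real q * y) = y0" using y(2) by (simp add: r mult_ac)
    ultimately have "fcoeff (s * int r) (real q * y) = eigenvalue r / of_real (sqrt (real r)) * A"
      using fcoeff_whittaker[of r "real q * y" s] y s q0 by (simp add: A_def)
    moreover have "M = Q * of_real (sqrt (real r))" by (simp add: M_def Q_def r real_sqrt_mult)
    ultimately show ?thesis using nz r q0 by (simp add: field_simps)
  next
    case False
    hence "\<not> int q dvd s * int m"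
      using s(1) dvd_abs_iff[of "int q" "s * int m"] by (simp add: abs_mult)
    thus ?thesis using False by simp
  qed
  ultimately have "Q * eigenvalue q * (eigenvalue m / M * A) =
      (if q dvd m then eigenvalue (m div q) else 0) * Q / M * A + of_nat q * (eigenvalue (q * m) / (Q * M) * A)"
    using fcoeff_hecke_prime[OF q y(1), of "s * int m"] by (simp only: Q_def)
  hence "(Q / M * A) * (eigenvalue q * eigenvalue m) =
      (Q / M * A) * (eigenvalue (q * m) + (if q dvd m then eigenvalue (m div q) else 0))"
    using nz by (simp add: QQ field_simps)
  thus ?thesis using nz by simp
qed

end

section \<open>Exponential decay of the form and mean squares of its eigenvalues\<close>

context hecke_form
begin

lemma fcoeff_exp_bound:
  assumes c: "c > 0"
  shows "\<exists>K\<ge>0. \<exists>B::nat. \<forall>n y. n \<noteq> 0 \<longrightarrow> y \<ge> c \<longrightarrow>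
     norm (fcoeff n y) \<le> K * (1 + \<bar>real_of_int n\<bar>) ^ B * exp (- pi * \<bar>real_of_int n\<bar> * y) \<and>
     norm (fcoeff_deriv n y) \<le> K * (1 + \<bar>real_of_int n\<bar>) ^ B * exp (- pi * \<bar>real_of_int n\<bar> * y)"
proof -
  obtain K where K: "K \<ge> 0" "\<And>y. y \<ge> c \<Longrightarrow> norm (W y) \<le> K * exp (- pi * y)"
    "\<And>y. y \<ge> c \<Longrightarrow> norm (W' y) \<le> K * exp (- pi * y)" using whittaker_exp_decay[OF c] by blast
  obtain C B where C: "C \<ge> 0" "\<And>n. n \<ge> 1 \<Longrightarrow> norm (eigenvalue n) / sqrt (real n) \<le> C * real n ^ B"
    using eigenvalue_div_sqrt_poly_bound by blast
  define F where "F = max (norm (first_coeff 1)) (norm (first_coeff (- 1)))"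
  have F: "norm (first_coeff s) \<le> F" if "\<bar>s\<bar> = 1" for s
  proof -
    have "s = 1 \<or> s = - 1" using that by linarith
    thus ?thesis by (auto simp: F_def)
  qed
  have "F \<ge> 0" by (simp add: F_def max_def)
  define D where "D = C * F * K"
  have "norm (fcoeff n y) \<le> D * (1 + \<bar>real_of_int n\<bar>) ^ Suc B * exp (- pi * \<bar>real_of_int n\<bar> * y) \<and>
     norm (fcoeff_deriv n y) \<le> D * (1 + \<bar>real_of_int n\<bar>) ^ Suc B * exp (- pi * \<bar>real_of_int n\<bar> * y)"
    if n: "n \<noteq> 0" and y: "y \<ge> c" for n y
  proof -
    obtain s N where N: "n = s * int N" "\<bar>s\<bar> = 1" "N \<ge> 1" "real N = \<bar>of_int n\<bar>"
      using int_eq_sign_mult_nat[OF n] by metis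
    have y0: "y > 0" using y c by simp
    have "1 * c \<le> real N * y" using N(3) y c by (intro mult_mono) auto
    hence Ny: "real N * y \<ge> c" by simp
    note C(2)[OF N(3)]
    also have "C * real N ^ B \<le> C * (1 + real N) ^ B" using C(1) by (intro mult_left_mono power_mono) auto
    finally have eigenvalue_le: "norm (eigenvalue N) / sqrt (real N) \<le> C * (1 + real N) ^ B" .
    have "norm (fcoeff n y) = norm (eigenvalue N) / sqrt (real N) * norm (first_coeff s) * 1 * norm (W (real N * y))"
      unfolding N(1) fcoeff_whittaker[OF N(3) y0 N(2)] by (simp add: norm_mult norm_divide)
    also have "\<dots> \<le> (C * (1 + real N) ^ B) * F * (1 + real N) * (K * exp (- pi * (real N * y)))"
      by (intro mult_mono eigenvalue_le F K Ny N mult_nonneg_nonneg C \<open>F \<ge> 0\<close>) auto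
    finally have bound: "norm (fcoeff n y) \<le> D * (1 + real N) ^ Suc B * exp (- pi * real N * y)"
      by (simp add: D_def mult_ac)
    have "norm (fcoeff_deriv n y) =
        norm (eigenvalue N) / sqrt (real N) * norm (first_coeff s) * real N * norm (W' (real N * y))"
      unfolding N(1) fcoeff_deriv_whittaker[OF N(3) y0 N(2)] by (simp add: norm_mult norm_divide)
    also have "\<dots> \<le> (C * (1 + real N) ^ B) * F * (1 + real N) * (K * exp (- pi * (real N * y)))"
      by (intro mult_mono eigenvalue_le F K Ny N mult_nonneg_nonneg C \<open>F \<ge> 0\<close>) auto
    finally have "norm (fcoeff_deriv n y) \<le> D * (1 + real N) ^ Suc B * exp (- pi * real N * y)"
      by (simp add: D_def mult_ac)
    with bound show ?thesis by (simp add: N(4))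
  qed
  moreover have "D \<ge> 0" using C K \<open>F \<ge> 0\<close> by (simp add: D_def)
  ultimately show ?thesis by blast
qed

definition fcoeff_combination :: "(complex \<Rightarrow> complex) \<Rightarrow> bool" where
  "fcoeff_combination g \<longleftrightarrow> (\<exists>A B. freq_poly A \<and> freq_poly B \<and>
     (\<forall>n. \<forall>y>0. horocycle_coeff g n y = A n y * fcoeff n y + B n y * fcoeff_deriv n y))"

lemma fcoeff_combination_partial_x:
  assumes g: "smooth_on upper_half_plane g" "one_periodic g" and "fcoeff_combination g"
  shows "fcoeff_combination (partial_x g)"
proof -
  obtain A B where AB: "freq_poly A" "freq_poly B"
    "\<And>n y. y > 0 \<Longrightarrow> horocycle_coeff g n y = A n y * fcoeff n y + B n y * fcoeff_deriv n y"
    using assms(3) unfolding fcoeff_combination_def by blast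
  show ?thesis unfolding fcoeff_combination_def
  proof (intro exI conjI allI impI)
    show "freq_poly (\<lambda>n y. (2 * of_real pi * \<i>) * of_int n * A n y)"
      "freq_poly (\<lambda>n y. (2 * of_real pi * \<i>) * of_int n * B n y)"
      by (intro freq_poly.intros AB)+
    show "horocycle_coeff (partial_x g) n y =
        (2 * of_real pi * \<i>) * of_int n * A n y * fcoeff n y + (2 * of_real pi * \<i>) * of_int n * B n y *
          fcoeff_deriv n y"
      if "y > 0" for n y
      using horocycle_coeff_partial_x[OF g that, of n] AB(3)[OF that, of n] by (simp add: algebra_simps)
  qed
qed

lemma fcoeff_combination_partial_y:
  assumes g: "smooth_on upper_half_plane g" and "fcoeff_combination g"
  shows "fcoeff_combination (partial_y g)"
proof -
  obtain A B where AB: "freq_poly A" "freq_poly B"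
    "\<And>n y. y > 0 \<Longrightarrow> horocycle_coeff g n y = A n y * fcoeff n y + B n y * fcoeff_deriv n y"
    using assms(2) unfolding fcoeff_combination_def by blast
  obtain A' where A': "freq_poly A'" "\<And>n y. y > 0 \<Longrightarrow> (A n has_vector_derivative A' n y) (at y)"
    using freq_poly_deriv[OF AB(1)] by blast
  obtain B' where B': "freq_poly B'" "\<And>n y. y > 0 \<Longrightarrow> (B n has_vector_derivative B' n y) (at y)"
    using freq_poly_deriv[OF AB(2)] by blast
  let ?potential = "\<lambda>n y. (2 * of_real pi * of_int n) * (2 * of_real pi * of_int n) +
      (- laplace_eigenvalue) * (of_real (1 / y) * of_real (1 / y))"
  show ?thesis unfolding fcoeff_combination_def
  proof (intro exI conjI allI impI)
    show "freq_poly (\<lambda>n y. A' n y + B n y * ?potential n y)" "freq_poly (\<lambda>n y. A n y + B' n y)"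
      by (intro freq_poly.intros AB A' B')+
    fix n and y :: real assume y: "y > 0"
    let ?d = "(A n y * fcoeff_deriv n y + A' n y * fcoeff n y) +
       (B n y * ((of_real ((2 * pi * of_int n)\<^sup>2) - laplace_eigenvalue / of_real (y\<^sup>2)) * fcoeff n y) +
        B' n y * fcoeff_deriv n y)"
    have "((\<lambda>y. A n y * fcoeff n y + B n y * fcoeff_deriv n y) has_vector_derivative ?d) (at y)"
      by (intro has_vector_derivative_add has_vector_derivative_mult A' B' fcoeff_has_vector_derivative
            fcoeff_deriv_has_vector_derivative y)
    hence "(horocycle_coeff g n has_vector_derivative ?d) (at y)"
      by (rule has_vector_derivative_transform_within_open[of _ _ _ "{0<..}"]) (use y AB(3) in auto)
    from vector_derivative_unique_at[OF horocycle_coeff_has_vector_derivative[OF g y] this]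
    show "horocycle_coeff (partial_y g) n y =
        (A' n y + B n y * ?potential n y) * fcoeff n y + (A n y + B' n y) * fcoeff_deriv n y"
      by (simp add: algebra_simps power2_eq_square)
  qed
qed

lemma iterated_partial_fcoeff_combination: "iterated_partial f g \<Longrightarrow> fcoeff_combination g"
proof (induction rule: iterated_partial.induct)
  case iterated_partial_refl
  show ?case unfolding fcoeff_combination_def
    by (intro exI[of _ "\<lambda>n y. 1"] exI[of _ "\<lambda>n y. 0"]) (auto simp: fcoeff_def intro: freq_poly_const)
next
  case (iterated_partial_x g)
  thus ?case
    by (intro fcoeff_combination_partial_x iterated_partial_smooth[OF _ smooth]
      iterated_partial_one_periodic[OF _ one_periodic])
next
  case (iterated_partial_y g)
  thus ?case by (intro fcoeff_combination_partial_y iterated_partial_smooth[OF _ smooth])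
qed

lemma iterated_partial_coeff_bound:
  assumes g: "iterated_partial f g" and c: "c > 0"
  shows "\<exists>K\<ge>0. \<exists>B::nat. \<forall>n y. n \<noteq> 0 \<longrightarrow> y \<ge> c \<longrightarrow>
     norm (horocycle_coeff g n y) \<le> K * (1 + \<bar>real_of_int n\<bar>) ^ B * exp (- pi * \<bar>real_of_int n\<bar> * y)"
proof -
  obtain A B where AB: "freq_poly A" "freq_poly B"
    "\<And>n y. y > 0 \<Longrightarrow> horocycle_coeff g n y = A n y * fcoeff n y + B n y * fcoeff_deriv n y"
    using iterated_partial_fcoeff_combination[OF g] unfolding fcoeff_combination_def by blast
  obtain CA mA where A: "CA \<ge> 0" "\<And>n y. y \<ge> c \<Longrightarrow> norm (A n y) \<le> CA * (1 + \<bar>real_of_int n\<bar>) ^ mA"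
    using freq_poly_bound[OF c AB(1)] by blast
  obtain CB mB where B: "CB \<ge> 0" "\<And>n y. y \<ge> c \<Longrightarrow> norm (B n y) \<le> CB * (1 + \<bar>real_of_int n\<bar>) ^ mB"
    using freq_poly_bound[OF c AB(2)] by blast
  obtain K m where K: "K \<ge> 0" "\<And>n y. n \<noteq> 0 \<Longrightarrow> y \<ge> c \<Longrightarrow>
     norm (fcoeff n y) \<le> K * (1 + \<bar>real_of_int n\<bar>) ^ m * exp (- pi * \<bar>real_of_int n\<bar> * y) \<and>
     norm (fcoeff_deriv n y) \<le> K * (1 + \<bar>real_of_int n\<bar>) ^ m * exp (- pi * \<bar>real_of_int n\<bar> * y)"
    using fcoeff_exp_bound[OF c] by blast
  have "norm (horocycle_coeff g n y) \<le>
      (CA + CB) * K * (1 + \<bar>real_of_int n\<bar>) ^ (mA + mB + m) * exp (- pi * \<bar>real_of_int n\<bar> * y)"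
    if n: "n \<noteq> 0" and y: "y \<ge> c" for n y
  proof -
    define t where "t = 1 + \<bar>real_of_int n\<bar>"
    define E where "E = K * t ^ m * exp (- pi * \<bar>real_of_int n\<bar> * y)"
    have "t \<ge> 1" by (simp add: t_def)
    have "norm (A n y) \<le> CA * t ^ (mA + mB)"
      using A(2)[OF y, of n] mult_left_mono[OF power_increasing[of mA "mA + mB" t] A(1)] \<open>t \<ge> 1\<close> by (simp add: t_def)
    moreover have "norm (B n y) \<le> CB * t ^ (mA + mB)"
      using B(2)[OF y, of n] mult_left_mono[OF power_increasing[of mB "mA + mB" t] B(1)] \<open>t \<ge> 1\<close> by (simp add: t_def)
    moreover have "norm (fcoeff n y) \<le> E" "norm (fcoeff_deriv n y) \<le> E" using K(2)[OF n y] by (auto simp: E_def t_def)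
    ultimately have "norm (A n y) * norm (fcoeff n y) + norm (B n y) * norm (fcoeff_deriv n y) \<le>
        (CA * t ^ (mA + mB)) * E + (CB * t ^ (mA + mB)) * E"
      using A(1) B(1) \<open>t \<ge> 1\<close> by (intro add_mono mult_mono) auto
    moreover have "norm (horocycle_coeff g n y) \<le>
        norm (A n y) * norm (fcoeff n y) + norm (B n y) * norm (fcoeff_deriv n y)"
      using AB(3)[of y n] y c by (metis norm_mult norm_triangle_ineq less_le_trans)
    ultimately show ?thesis by (simp add: t_def E_def power_add algebra_simps)
  qed
  moreover have "(CA + CB) * K \<ge> 0" using A B K by simp
  ultimately show ?thesis by blast
qed

lemma iterated_partial_coeff_0: "iterated_partial f g \<Longrightarrow> y > 0 \<Longrightarrow> horocycle_coeff g 0 y = 0"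
  using iterated_partial_fcoeff_combination[of g] fcoeff_0 fcoeff_deriv_0 unfolding fcoeff_combination_def
  by fastforce

lemma exp_minus_pi_mult_le:
  fixes c n y :: real
  assumes "0 < c" "c \<le> y" "n \<ge> 1"
  shows "exp (- pi * n * y) \<le> exp (- y) * exp (- c * n)"
proof -
  have "y + c * n \<le> n * y + y * n" using assms by (intro add_mono mult_right_mono) (auto simp: mult_le_cancel_right1)
  also have "\<dots> = 2 * (n * y)" by simp
  also have "\<dots> \<le> pi * (n * y)" using assms pi_ge_two by (intro mult_right_mono) auto
  finally show ?thesis by (simp flip: exp_add)
qed

lemma iterated_partial_exp_decay:
  assumes g: "iterated_partial f g" and c: "c > 0"
  shows "\<exists>C\<ge>0. \<forall>z. Im z \<ge> c \<longrightarrow> norm (g z) \<le> C * exp (- Im z)"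
proof -
  obtain K B where K: "K \<ge> 0" "\<And>n y. n \<noteq> 0 \<Longrightarrow> y \<ge> c \<Longrightarrow>
     norm (horocycle_coeff g n y) \<le> K * (1 + \<bar>real_of_int n\<bar>) ^ B * exp (- pi * \<bar>real_of_int n\<bar> * y)"
    using iterated_partial_coeff_bound[OF g c] by blast
  define v where "v = (\<lambda>k. real (Suc k) ^ B * exp (- c * real (Suc k)))"
  have v: "summable v" unfolding v_def by (rule summable_power_mult_exp[OF c])
  have "norm (g z) \<le> 2 * K * 2 ^ B * suminf v * exp (- Im z)" if z: "Im z \<ge> c" for z
  proof -
    define x y where "x = Re z" and "y = Im z"
    have y: "y \<ge> c" "y > 0" using z c by (auto simp: y_def)
    define u where "u = (\<lambda>k. horocycle_coeff g (int (Suc k)) y * cis (2 * pi * real (Suc k) * x) +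
              horocycle_coeff g (- int (Suc k)) y * cis (- 2 * pi * real (Suc k) * x))"
    have u: "u sums g z"
      using horocycle_fourier_series[OF iterated_partial_smooth[OF g smooth]
          iterated_partial_one_periodic[OF g one_periodic] y(2) iterated_partial_coeff_0[OF g y(2)], of x]
      by (simp add: u_def x_def y_def)
    have u_le: "norm (u k) \<le> 2 * K * 2 ^ B * exp (- y) * v k" for k
    proof -
      define n where "n = real (Suc k)"
      have n: "n \<ge> 1" by (simp add: n_def)
      have "exp (- pi * n * y) \<le> exp (- y) * exp (- c * n)" by (rule exp_minus_pi_mult_le[OF c y(1) n])
      moreover have "(1 + n) ^ B \<le> (2 * n) ^ B" using n by (intro power_mono) auto
      ultimately have "K * (1 + n) ^ B * exp (- pi * n * y) \<le> K * (2 * n) ^ B * (exp (- y) * exp (- c * n))"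
        using K n by (intro mult_mono mult_left_mono) auto
      moreover have "norm (horocycle_coeff g (int (Suc k)) y) \<le> K * (1 + n) ^ B * exp (- pi * n * y)"
        "norm (horocycle_coeff g (- int (Suc k)) y) \<le> K * (1 + n) ^ B * exp (- pi * n * y)"
        using K(2)[of "int (Suc k)" y] K(2)[of "- int (Suc k)" y] y by (simp_all add: n_def add_ac)
      moreover have "norm (u k) \<le> norm (horocycle_coeff g (int (Suc k)) y) +
          norm (horocycle_coeff g (- int (Suc k)) y)"
        unfolding u_def by (rule order.trans[OF norm_triangle_ineq]) (simp add: norm_mult)
      ultimately have "norm (u k) \<le> 2 * (K * (2 * n) ^ B * (exp (- y) * exp (- c * n)))" by linarith
      thus ?thesis unfolding power_mult_distrib v_def n_def by (simp only: mult_ac)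
    qed
    have "norm (suminf u) \<le> (\<Sum>k. 2 * K * 2 ^ B * exp (- y) * v k)"
      by (rule norm_suminf_le[OF u_le summable_mult[OF v]])
    also have "\<dots> = 2 * K * 2 ^ B * exp (- y) * suminf v" by (rule suminf_mult[OF v])
    finally show ?thesis using u by (simp add: sums_iff y_def mult_ac)
  qed
  moreover have "2 * K * 2 ^ B * suminf v \<ge> 0"
    using K by (intro mult_nonneg_nonneg suminf_nonneg v) (auto simp: v_def)
  ultimately show ?thesis by blast
qed

lemma bounded: "\<exists>B>0. \<forall>z\<in>upper_half_plane. norm (f z) \<le> B"
proof -
  obtain C where C: "C \<ge> 0" "\<And>z. Im z \<ge> 1 / 5 \<Longrightarrow> norm (f z) \<le> C * exp (- Im z)"
    using iterated_partial_exp_decay[OF iterated_partial_refl, of "1 / 5"] by auto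
  have "norm (f z) \<le> C + 1" if "Im z \<ge> 1 / 5" for z
  proof -
    have "C * exp (- Im z) \<le> C * 1" using C that by (intro mult_left_mono) auto
    thus ?thesis using C(2)[OF that] by simp
  qed
  hence "norm (f z) \<le> C + 1" if "z \<in> upper_half_plane" for z
    using ex_equivalent_large_Im[OF that] by (cases "Im z < 1") (metis, force)
  thus ?thesis using C(1) by (intro exI[of _ "C + 1"]) auto
qed

lemma isCont_W: "y > 0 \<Longrightarrow> isCont W y"
  using radial_solutionD[OF radial_solution_W] has_vector_derivative_continuous by blast

lemma continuous_on_W_exp: "continuous_on A (\<lambda>t. W (exp t))"
  by (intro continuous_at_imp_continuous_on ballI isCont_o2[of _ exp W] isCont_W continuous_intros) auto

lemma W_exp_bound: "\<exists>K>0. \<forall>y>0. norm (W y) \<le> K * exp (- pi * y)"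
proof -
  obtain s where s: "\<bar>s\<bar> = 1" "first_coeff s \<noteq> 0" using first_coeff_nonzero by blast
  obtain B where B: "B > 0" "\<And>z. z \<in> upper_half_plane \<Longrightarrow> norm (f z) \<le> B" using bounded by blast
  obtain K where K: "K \<ge> 0" "\<And>y. y \<ge> 1 \<Longrightarrow> norm (W y) \<le> K * exp (- pi * y)"
    using whittaker_exp_decay[of 1 spectral_parameter] by auto
  define D where "D = K + B / norm (first_coeff s) * exp pi"
  have "norm (W y) \<le> D * exp (- pi * y)" if y: "y > 0" for y
  proof (cases "y \<ge> 1")
    case True
    note K(2)[OF True]
    also have "K * exp (- pi * y) \<le> D * exp (- pi * y)" using B by (intro mult_right_mono) (auto simp: D_def)
    finally show ?thesis .
  next
    case False
    have "norm (fcoeff s y) \<le> B"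
      unfolding fcoeff_def horocycle_coeff_def
      using B(2)[of "Complex _ y"] y by (intro norm_fourier_coeff_le continuous_on_horizontal continuous) auto
    hence "norm (W y) \<le> B / norm (first_coeff s) * exp (pi - pi)"
      using fcoeff_eq_W[OF s(1) y] s by (simp add: norm_mult field_simps)
    also have "\<dots> \<le> B / norm (first_coeff s) * exp (pi - pi * y)"
      using B False by (intro mult_left_mono) auto
    also have "\<dots> = B / norm (first_coeff s) * exp pi * exp (- pi * y)" by (simp add: exp_diff exp_minus field_simps)
    also have "\<dots> \<le> D * exp (- pi * y)" using K by (intro mult_right_mono) (auto simp: D_def)
    finally show ?thesis .
  qed
  moreover have "D > 0" using B K s by (simp add: D_def add_nonneg_pos)
  ultimately show ?thesis by blast
qed

lemma eigenvalue_bessel_inequality: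
  "\<exists>C>0. \<forall>N. \<forall>y>0. (\<Sum>n=1..N. (norm (eigenvalue n))\<^sup>2 / real n * (norm (W (real n * y)))\<^sup>2) \<le> C"
proof -
  obtain s where s: "\<bar>s\<bar> = 1" "first_coeff s \<noteq> 0" using first_coeff_nonzero by blast
  obtain B where B: "B > 0" "\<And>z. z \<in> upper_half_plane \<Longrightarrow> norm (f z) \<le> B" using bounded by blast
  define c where "c = (norm (first_coeff s))\<^sup>2"
  have c: "c > 0" using s by (simp add: c_def)
  have "(\<Sum>n=1..N. (norm (eigenvalue n))\<^sup>2 / real n * (norm (W (real n * y)))\<^sup>2) \<le> B\<^sup>2 / c" if y: "y > 0" for N y
  proof -
    have inj: "inj_on (\<lambda>n. s * int n) {1..N}" using s by (auto simp: inj_on_def)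
    have "c * (\<Sum>n=1..N. (norm (eigenvalue n))\<^sup>2 / real n * (norm (W (real n * y)))\<^sup>2) =
        (\<Sum>n=1..N. (norm (fcoeff (s * int n) y))\<^sup>2)"
      unfolding sum_distrib_left using y s
      by (intro sum.cong refl) (simp add: fcoeff_whittaker c_def norm_mult norm_divide power_mult_distrib
        power_divide)
    also have "\<dots> = (\<Sum>k\<in>(\<lambda>n. s * int n) ` {1..N}. (norm (fourier_coeff (\<lambda>x. f (Complex x y)) k))\<^sup>2)"
      unfolding fcoeff_def horocycle_coeff_def by (subst sum.reindex[OF inj]) simp
    also have "\<dots> \<le> integral {0..1} (\<lambda>x. (norm (f (Complex x y)))\<^sup>2)"
      by (intro bessel_inequality continuous_on_horizontal continuous y) auto
    also have "\<dots> \<le> integral {0..1} (\<lambda>x::real. B\<^sup>2)"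
      using B(2) y
      by (intro integral_le integrable_continuous_interval continuous_intros continuous_on_horizontal continuous
        power_mono) auto
    finally show ?thesis using c by (simp add: field_simps)
  qed
  moreover have "B\<^sup>2 / c > 0" using B c by simp
  ultimately show ?thesis by blast
qed

definition log_energy :: "real \<Rightarrow> real \<Rightarrow> real" where
  "log_energy \<epsilon> t = (norm (W (exp t)))\<^sup>2 * exp (\<epsilon> * t)"

lemma continuous_on_log_energy: "continuous_on A (log_energy \<epsilon>)"
  unfolding log_energy_def[abs_def] by (intro continuous_intros continuous_on_W_exp)

lemma log_energy_nonneg: "log_energy \<epsilon> t \<ge> 0"
  by (simp add: log_energy_def)

lemma log_energy_shift:
  "n \<ge> 1 \<Longrightarrow> log_energy \<epsilon> (t + ln (real n)) = real n powr \<epsilon> * ((norm (W (real n * exp t)))\<^sup>2 * exp (\<epsilon> * t))"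
  by (simp add: log_energy_def powr_def exp_add distrib_left mult_ac)

lemma ex_log_energy_integral_pos: "\<exists>a. integral {a..a + 1} (log_energy \<epsilon>) > 0"
proof -
  obtain y0 where y0: "y0 > 0" "W y0 \<noteq> 0" using whittaker_nonzero by blast
  define a where "a = ln y0"
  have "integral {a..a + 1} (log_energy \<epsilon>) \<noteq> 0"
    using integral_eq_0_iff[of a "a + 1" "log_energy \<epsilon>"] continuous_on_log_energy log_energy_nonneg y0
    by (force simp: log_energy_def a_def)
  moreover have "integral {a..a + 1} (log_energy \<epsilon>) \<ge> 0"
    by (intro integral_nonneg integrable_continuous_interval continuous_on_log_energy log_energy_nonneg)
  ultimately show ?thesis by (intro exI[of _ a]) simp
qed

lemma log_energy_integral_le_shifted:
  assumes n: "n \<in> {1..N}"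
  shows "integral {a..a + 1} (log_energy \<epsilon>) \<le> integral {a - ln (real N)..a + 1} (\<lambda>t. log_energy \<epsilon> (t + ln (real n)))"
proof -
  define l where "l = a - ln (real N)"
  have "integral {l..a + 1} (\<lambda>t. log_energy \<epsilon> (t + ln (real n))) = integral {l + ln (real n)..a + 1 + ln (real n)}
      (log_energy \<epsilon>)"
    using integral_shift[OF continuous_on_log_energy, where a = l and b = "a + 1" and c = "ln (real n)"]
    by (simp add: o_def)
  moreover have "0 \<le> ln (real n)" "ln (real n) \<le> ln (real N)" using n by auto
  ultimately show ?thesis
    by (auto simp: l_def log_energy_nonneg intro!: integral_subset_le integrable_continuous_interval
      continuous_on_log_energy)
qed

text \<open>
  Integrated against \<open>y\<^sup>\<epsilon> dy / y\<close>, the \<open>n\<close>-th term of the Bessel inequality scales to a fixed positive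
  multiple of \<open>\<bar>\<lambda>(n)\<bar>\<^sup>2 / n\<^sup>1\<^sup>+\<^sup>\<epsilon>\<close>.
\<close>

lemma eigenvalue_square_partial_sums:
  assumes \<epsilon>: "\<epsilon> > 0"
  shows "\<exists>D. \<forall>N\<ge>1. (\<Sum>n=1..N. (norm (eigenvalue n))\<^sup>2 / real n powr (1 + \<epsilon>)) \<le> D"
proof -
  obtain C where C: "C > 0" "\<And>N y. y > 0 \<Longrightarrow>
      (\<Sum>n=1..N. (norm (eigenvalue n))\<^sup>2 / real n * (norm (W (real n * y)))\<^sup>2) \<le> C"
    using eigenvalue_bessel_inequality by blast
  obtain a where energy_pos: "integral {a..a + 1} (log_energy \<epsilon>) > 0" using ex_log_energy_integral_pos by blast
  define \<kappa> where "\<kappa> = integral {a..a + 1} (log_energy \<epsilon>)"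
  define D where "D = C * (exp (\<epsilon> * (a + 1)) / \<epsilon>)"
  let ?x = "\<lambda>n. (norm (eigenvalue n))\<^sup>2 / real n powr (1 + \<epsilon>)"
  have "(\<Sum>n=1..N. ?x n) \<le> D / \<kappa>" if N: "N \<ge> 1" for N
  proof -
    define l where "l = a - ln (real N)"
    have "ln (real N) \<ge> 0" using N by simp
    hence "l \<le> a + 1" by (simp add: l_def)
    have continuous: "continuous_on {l..a + 1} (\<lambda>t. log_energy \<epsilon> (t + ln (real n)))" for n
      by (intro continuous_on_compose2[OF continuous_on_log_energy[of UNIV]] continuous_intros) auto
    have "\<kappa> * (\<Sum>n=1..N. ?x n) \<le> (\<Sum>n=1..N. ?x n * integral {l..a + 1} (\<lambda>t. log_energy \<epsilon> (t + ln (real n))))"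
      unfolding sum_distrib_left \<kappa>_def l_def using log_energy_integral_le_shifted
      by (intro sum_mono) (subst mult.commute, intro mult_left_mono, auto)
    also have "\<dots> = integral {l..a + 1} (\<lambda>t. \<Sum>n=1..N. ?x n * log_energy \<epsilon> (t + ln (real n)))"
      by (subst integral_sum) (auto intro!: integrable_continuous_interval continuous_intros continuous)
    also have "\<dots> \<le> integral {l..a + 1} (\<lambda>t. C * exp (\<epsilon> * t))"
    proof (intro integral_le integrable_continuous_interval continuous_intros continuous)
      fix t
      have "(\<Sum>n=1..N. ?x n * log_energy \<epsilon> (t + ln (real n))) =
          (\<Sum>n=1..N. (norm (eigenvalue n))\<^sup>2 / real n * (norm (W (real n * exp t)))\<^sup>2) * exp (\<epsilon> * t)"
        unfolding sum_distrib_right by (intro sum.cong refl) (simp add: log_energy_shift powr_add)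
      also have "\<dots> \<le> C * exp (\<epsilon> * t)" by (intro mult_right_mono C) auto
      finally show "(\<Sum>n=1..N. ?x n * log_energy \<epsilon> (t + ln (real n))) \<le> C * exp (\<epsilon> * t)" .
    qed
    also have "((\<lambda>t. C * exp (\<epsilon> * t)) has_integral C * (exp (\<epsilon> * (a + 1)) / \<epsilon>) - C * (exp (\<epsilon> * l) / \<epsilon>)) {l..a + 1}"
      using \<epsilon> \<open>l \<le> a + 1\<close>
      by (intro fundamental_theorem_of_calculus)
         (auto intro!: derivative_eq_intros simp flip: has_real_derivative_iff_has_vector_derivative)
    hence "integral {l..a + 1} (\<lambda>t. C * exp (\<epsilon> * t)) = D - C * (exp (\<epsilon> * l) / \<epsilon>)"
      unfolding D_def by (rule integral_unique)
    also have "D - C * (exp (\<epsilon> * l) / \<epsilon>) \<le> D" using C(1) \<epsilon> by simp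
    finally show ?thesis using energy_pos by (simp add: \<kappa>_def field_simps)
  qed
  thus ?thesis by blast
qed

lemma eigenvalue_square_summable:
  assumes \<epsilon>: "\<epsilon> > 0"
  shows "summable (\<lambda>n. (norm (eigenvalue (Suc n)))\<^sup>2 / real (Suc n) powr (1 + \<epsilon>))"
proof -
  obtain D where D: "\<And>N. N \<ge> 1 \<Longrightarrow> (\<Sum>n=1..N. (norm (eigenvalue n))\<^sup>2 / real n powr (1 + \<epsilon>)) \<le> D"
    using eigenvalue_square_partial_sums[OF \<epsilon>] by blast
  show ?thesis
  proof (rule bounded_imp_summable)
    fix n
    have "(\<Sum>k\<le>n. (norm (eigenvalue (Suc k)))\<^sup>2 / real (Suc k) powr (1 + \<epsilon>)) =
        (\<Sum>k=1..Suc n. (norm (eigenvalue k))\<^sup>2 / real k powr (1 + \<epsilon>))"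
      by (simp only: atMost_atLeast0 One_nat_def sum.shift_bounds_cl_Suc_ivl)
    also have "\<dots> \<le> D" by (rule D) simp
    finally show "(\<Sum>k\<le>n. (norm (eigenvalue (Suc k)))\<^sup>2 / real (Suc k) powr (1 + \<epsilon>)) \<le> D" .
  qed auto
qed

lemma eigenvalue_abs_summable:
  assumes \<sigma>: "\<sigma> > 1"
  shows "summable (\<lambda>n. norm (eigenvalue (Suc n)) / real (Suc n) powr \<sigma>)"
proof (rule summable_comparison_test)
  have "summable (\<lambda>n. real (Suc n) powr (- \<sigma>))"
    using \<sigma> by (subst summable_Suc_iff) (simp add: summable_real_powr_iff)
  thus "summable (\<lambda>n. (norm (eigenvalue (Suc n)))\<^sup>2 / real (Suc n) powr \<sigma> + real (Suc n) powr (- \<sigma>))"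
    using eigenvalue_square_summable[of "\<sigma> - 1"] \<sigma> by (intro summable_add) auto
  have "norm (norm (eigenvalue (Suc n)) / real (Suc n) powr \<sigma>) \<le>
      (norm (eigenvalue (Suc n)))\<^sup>2 / real (Suc n) powr \<sigma> + real (Suc n) powr (- \<sigma>)" for n
  proof -
    have "norm (eigenvalue (Suc n)) \<le> (norm (eigenvalue (Suc n)))\<^sup>2 + 1"
      using sum_squares_bound[of "norm (eigenvalue (Suc n))" 1] by (smt (verit) norm_ge_zero one_power2)
    hence "norm (eigenvalue (Suc n)) / real (Suc n) powr \<sigma> \<le>
        ((norm (eigenvalue (Suc n)))\<^sup>2 + 1) / real (Suc n) powr \<sigma>"
      by (intro divide_right_mono) auto
    thus ?thesis by (simp add: powr_minus divide_inverse algebra_simps)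
  qed
  thus "\<exists>N. \<forall>n\<ge>N. norm (norm (eigenvalue (Suc n)) / real (Suc n) powr \<sigma>) \<le>
      (norm (eigenvalue (Suc n)))\<^sup>2 / real (Suc n) powr \<sigma> + real (Suc n) powr (- \<sigma>)" by blast
qed

end

section \<open>Approach to the cusps\<close>

lemma minus_inverse_in_upper_half_plane:
  assumes "z \<in> upper_half_plane"
  shows "- 1 / z \<in> upper_half_plane" "Im (- 1 / z) = Im z / (norm z)\<^sup>2"
proof -
  have "Im z > 0" using assms by (simp add: upper_half_plane_def)
  hence "norm z > 0" by auto
  show "Im (- 1 / z) = Im z / (norm z)\<^sup>2" by (simp add: Im_divide cmod_power2)
  thus "- 1 / z \<in> upper_half_plane"
    unfolding upper_half_plane_def using \<open>Im z > 0\<close> \<open>norm z > 0\<close> by simp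
qed

lemma inverse_Complex_has_vector_derivative:
  assumes "y > 0"
  shows "((\<lambda>x. 1 / Complex x y) has_vector_derivative - ((1 / Complex x y)\<^sup>2)) (at x)"
proof -
  have "Complex x y \<noteq> 0" using assms by (simp add: complex_eq_iff)
  hence "((\<lambda>w. 1 / w) has_field_derivative - ((1 / Complex x y)\<^sup>2)) (at (Complex x y))"
    by (auto intro!: derivative_eq_intros simp: power2_eq_square)
  from field_vector_diff_chain_at[OF Complex_has_vector_derivative_x this] show ?thesis by (simp add: o_def)
qed

text \<open>
  The functions \<open>P(1/z, cnj (1/z)) g(-1/z)\<close> with a polynomial \<open>P\<close> and an iterated partial derivative \<open>g\<close>
  of \<open>f\<close>. The class contains an inversion invariant \<open>f\<close> itself, is stable under differentiation, and
  inherits the decay of the \<open>g\<close> towards \<open>\<i>\<infinity>\<close> as decay at \<open>0\<close> inside a cone.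
\<close>

inductive inverted_partial :: "(complex \<Rightarrow> complex) \<Rightarrow> (complex \<Rightarrow> complex) \<Rightarrow> bool" for f where
  inverted_partial_base: "iterated_partial f g \<Longrightarrow> inverted_partial f (\<lambda>z. g (- 1 / z))"
| inverted_partial_inverse: "inverted_partial f h \<Longrightarrow> \<sigma> \<in> {\<lambda>z. z, cnj} \<Longrightarrow> inverted_partial f (\<lambda>z. \<sigma> (1 / z) * h z)"
| inverted_partial_add: "inverted_partial f h \<Longrightarrow> inverted_partial f k \<Longrightarrow> inverted_partial f (\<lambda>z. h z + k z)"
| inverted_partial_cmult: "inverted_partial f h \<Longrightarrow> inverted_partial f (\<lambda>z. c * h z)"

lemma inverted_partial_base_deriv:
  assumes f: "smooth_on upper_half_plane f" and g: "iterated_partial f g"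
  shows "\<exists>h'. inverted_partial f h' \<and>
    (\<forall>x y. y > 0 \<longrightarrow> ((\<lambda>x. g (- 1 / Complex x y)) has_vector_derivative h' (Complex x y)) (at x))"
proof -
  define h' where "h' = (\<lambda>z.
      (1 / 2) * (1 / z * (1 / z * partial_x g (- 1 / z)) + cnj (1 / z) * (cnj (1 / z) * partial_x g (- 1 / z))) +
      (1 / (2 * \<i>)) * (1 / z * (1 / z * partial_y g (- 1 / z)) + (-1) *
        (cnj (1 / z) * (cnj (1 / z) * partial_y g (- 1 / z)))))"
  have inverse: "inverted_partial f (\<lambda>z. 1 / z * h z)" "inverted_partial f (\<lambda>z. cnj (1 / z) * h z)"
    if "inverted_partial f h" for h
    using inverted_partial_inverse[OF that, of "\<lambda>z. z"] inverted_partial_inverse[OF that, of cnj] by simp_all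
  have "inverted_partial f h'"
    unfolding h'_def
    by (intro inverted_partial_add inverted_partial_cmult inverse inverted_partial_base iterated_partial.intros g)
  moreover have "((\<lambda>x. g (- 1 / Complex x y)) has_vector_derivative h' (Complex x y)) (at x)" if y: "y > 0" for x y
  proof -
    define w where "w = 1 / Complex x y"
    have "((\<lambda>x. - (1 / Complex x y)) has_vector_derivative - (- (w\<^sup>2))) (at x)"
      unfolding w_def by (intro has_vector_derivative_minus inverse_Complex_has_vector_derivative y)
    hence "((\<lambda>x. - 1 / Complex x y) has_vector_derivative w\<^sup>2) (at x)" by simp
    moreover have "- 1 / Complex x y \<in> upper_half_plane" using y by (intro minus_inverse_in_upper_half_plane) simp
    ultimately have "((\<lambda>x. g (- 1 / Complex x y)) has_vector_derivative
        of_real (Re (w\<^sup>2)) * partial_x g (- 1 / Complex x y) + of_real (Im (w\<^sup>2)) *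
          partial_y g (- 1 / Complex x y)) (at x)"
      by (intro has_vector_derivative_along[OF iterated_partial_smooth[OF g f]])
    moreover have Re_Im: "complex_of_real (Re (w\<^sup>2)) = (1 / 2) * (w * w + cnj w * cnj w)"
      "complex_of_real (Im (w\<^sup>2)) = (1 / (2 * \<i>)) * (w * w - cnj w * cnj w)"
      by (simp_all add: complex_eq_iff power2_eq_square)
    have "h' (Complex x y) =
        of_real (Re (w\<^sup>2)) * partial_x g (- 1 / Complex x y) + of_real (Im (w\<^sup>2)) * partial_y g (- 1 / Complex x y)"
      unfolding h'_def Re_Im w_def[symmetric] by (simp add: algebra_simps)
    ultimately show ?thesis by simp
  qed
  ultimately show ?thesis by blast
qed

lemma inverted_partial_deriv:
  assumes f: "smooth_on upper_half_plane f"
  shows "inverted_partial f h \<Longrightarrow> \<exists>h'. inverted_partial f h' \<and>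
    (\<forall>x y. y > 0 \<longrightarrow> ((\<lambda>x. h (Complex x y)) has_vector_derivative h' (Complex x y)) (at x))"
proof (induction rule: inverted_partial.induct)
  case (inverted_partial_base g)
  thus ?case by (rule inverted_partial_base_deriv[OF f])
next
  case (inverted_partial_inverse h \<sigma>)
  then obtain h' where h': "inverted_partial f h'"
    "\<And>x y. y > 0 \<Longrightarrow> ((\<lambda>x. h (Complex x y)) has_vector_derivative h' (Complex x y)) (at x)" by blast
  have \<sigma>: "\<sigma> \<in> {\<lambda>z. z, cnj}" by fact
  hence linear: "bounded_linear \<sigma>" and \<sigma>_power: "\<sigma> (- (w\<^sup>2)) = - (\<sigma> w * \<sigma> w)" for w
    by (auto intro: bounded_linear_ident bounded_linear_cnj simp: power2_eq_square)
  define k where "k = (\<lambda>z. \<sigma> (1 / z) * h' z + (-1) * (\<sigma> (1 / z) * (\<sigma> (1 / z) * h z)))"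
  have "inverted_partial f k"
    unfolding k_def by (intro inverted_partial.intros h' inverted_partial_inverse \<sigma>)
  moreover have "((\<lambda>x. \<sigma> (1 / Complex x y) * h (Complex x y)) has_vector_derivative k (Complex x y)) (at x)"
    if y: "y > 0" for x y
  proof -
    have "((\<lambda>x. \<sigma> (1 / Complex x y)) has_vector_derivative - (\<sigma> (1 / Complex x y) * \<sigma> (1 / Complex x y))) (at x)"
      using bounded_linear.has_vector_derivative[OF linear inverse_Complex_has_vector_derivative[OF y]]
      by (simp only: \<sigma>_power)
    from has_vector_derivative_mult[OF this h'(2)[OF y, of x]] show ?thesis
      by (simp add: k_def algebra_simps)
  qed
  ultimately show ?case by blast
next
  case (inverted_partial_add h k)
  then obtain h' k' where "inverted_partial f h'" "inverted_partial f k'"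
    "\<And>x y. y > 0 \<Longrightarrow> ((\<lambda>x. h (Complex x y)) has_vector_derivative h' (Complex x y)) (at x)"
    "\<And>x y. y > 0 \<Longrightarrow> ((\<lambda>x. k (Complex x y)) has_vector_derivative k' (Complex x y)) (at x)" by blast
  thus ?case
    by (intro exI[of _ "\<lambda>z. h' z + k' z"]) (auto intro: inverted_partial.intros has_vector_derivative_add)
next
  case (inverted_partial_cmult h c)
  then obtain h' where "inverted_partial f h'"
    "\<And>x y. y > 0 \<Longrightarrow> ((\<lambda>x. h (Complex x y)) has_vector_derivative h' (Complex x y)) (at x)" by blast
  thus ?case
    by (intro exI[of _ "\<lambda>z. c * h' z"]) (auto intro: inverted_partial.intros has_vector_derivative_mult_right)
qed

lemma exp_minus_le_inverse_power:
  fixes u :: real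
  assumes "u > 0"
  shows "exp (- u) \<le> real m ^ m * (1 / u) ^ m"
  using power_mult_exp_minus_le[of 1 u m] assms by (simp add: field_simps)

lemma continuous_on_vertical:
  assumes "continuous_on upper_half_plane g"
  shows "continuous_on A (\<lambda>t. g (Complex x (exp t)))"
  by (intro continuous_on_compose2[OF assms] continuous_intros) auto

context hecke_form
begin

lemma inverted_iterated_partial_bound:
  assumes "iterated_partial f g"
  shows "\<exists>C\<ge>0. \<forall>x y. 0 < y \<longrightarrow> y \<le> 1 \<longrightarrow> \<bar>x\<bar> \<le> y \<longrightarrow> norm (g (- 1 / Complex x y)) \<le> C * y ^ m"
proof -
  obtain C where C: "C \<ge> 0" "\<And>z. Im z \<ge> 1 / 2 \<Longrightarrow> norm (g z) \<le> C * exp (- Im z)"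
    using iterated_partial_exp_decay[OF assms, of "1 / 2"] by auto
  have "norm (g (- 1 / Complex x y)) \<le> C * (2 * real m) ^ m * y ^ m" if y: "0 < y" "y \<le> 1" "\<bar>x\<bar> \<le> y" for x y
  proof -
    define w where "w = - 1 / Complex x y"
    have "x\<^sup>2 \<le> y\<^sup>2" using y by (metis abs_le_square_iff abs_of_pos)
    have "Im w = y / (x\<^sup>2 + y\<^sup>2)"
      unfolding w_def using y by (subst minus_inverse_in_upper_half_plane) (auto simp: cmod_power2)
    also have "\<dots> \<ge> y / (2 * y\<^sup>2)"
      using y \<open>x\<^sup>2 \<le> y\<^sup>2\<close> by (intro divide_left_mono) (auto intro!: mult_pos_pos add_nonneg_pos)
    also have "y / (2 * y\<^sup>2) = 1 / (2 * y)" using y by (simp add: power2_eq_square)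
    finally have Im_w: "Im w \<ge> 1 / (2 * y)" .
    hence "Im w \<ge> 1 / 2" using y by (smt (verit) frac_le)
    hence "norm (g w) \<le> C * exp (- Im w)" by (rule C)
    also have "\<dots> \<le> C * exp (- (1 / (2 * y)))" using Im_w C by (intro mult_left_mono) auto
    also have "\<dots> \<le> C * (real m ^ m * (1 / (1 / (2 * y))) ^ m)"
      using C y by (intro mult_left_mono exp_minus_le_inverse_power) auto
    finally show ?thesis by (simp add: w_def power_mult_distrib mult_ac)
  qed
  thus ?thesis using C(1) by (intro exI[of _ "C * (2 * real m) ^ m"]) auto
qed

lemma inverted_partial_bound:
  "inverted_partial f h \<Longrightarrow> \<exists>C\<ge>0. \<forall>x y. 0 < y \<longrightarrow> y \<le> 1 \<longrightarrow> \<bar>x\<bar> \<le> y \<longrightarrow> norm (h (Complex x y)) \<le> C * y ^ m"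
proof (induction arbitrary: m rule: inverted_partial.induct)
  case (inverted_partial_base g)
  thus ?case by (rule inverted_iterated_partial_bound)
next
  case (inverted_partial_inverse h \<sigma>)
  then obtain C where C: "C \<ge> 0"
    "\<And>x y. 0 < y \<Longrightarrow> y \<le> 1 \<Longrightarrow> \<bar>x\<bar> \<le> y \<Longrightarrow> norm (h (Complex x y)) \<le> C * y ^ Suc m" by blast
  have "norm (\<sigma> (1 / Complex x y) * h (Complex x y)) \<le> C * y ^ m" if y: "0 < y" "y \<le> 1" "\<bar>x\<bar> \<le> y" for x y
  proof -
    have "norm (\<sigma> (1 / Complex x y)) = 1 / norm (Complex x y)"
      using inverted_partial_inverse(2) by (auto simp: norm_divide)
    also have "\<dots> \<le> 1 / y" using y abs_Im_le_cmod[of "Complex x y"] by (intro frac_le) auto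
    finally have "norm (\<sigma> (1 / Complex x y) * h (Complex x y)) \<le> 1 / y * (C * y ^ Suc m)"
      unfolding norm_mult using C(2)[OF y] y by (intro mult_mono) auto
    thus ?thesis using y by simp
  qed
  thus ?case using C(1) by blast
next
  case (inverted_partial_add h k)
  obtain C where C: "C \<ge> 0"
    "\<And>x y. 0 < y \<Longrightarrow> y \<le> 1 \<Longrightarrow> \<bar>x\<bar> \<le> y \<Longrightarrow> norm (h (Complex x y)) \<le> C * y ^ m"
    using inverted_partial_add.IH(1) by blast
  obtain D where D: "D \<ge> 0"
    "\<And>x y. 0 < y \<Longrightarrow> y \<le> 1 \<Longrightarrow> \<bar>x\<bar> \<le> y \<Longrightarrow> norm (k (Complex x y)) \<le> D * y ^ m"
    using inverted_partial_add.IH(2) by blast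
  have "norm (h (Complex x y) + k (Complex x y)) \<le> (C + D) * y ^ m" if y: "0 < y" "y \<le> 1" "\<bar>x\<bar> \<le> y" for x y
    using norm_triangle_ineq[of "h (Complex x y)" "k (Complex x y)"] C(2)[OF y] D(2)[OF y]
    by (simp add: algebra_simps)
  thus ?case using C(1) D(1) by (intro exI[of _ "C + D"]) auto
next
  case (inverted_partial_cmult h c)
  obtain C where "C \<ge> 0"
    "\<And>x y. 0 < y \<Longrightarrow> y \<le> 1 \<Longrightarrow> \<bar>x\<bar> \<le> y \<Longrightarrow> norm (h (Complex x y)) \<le> C * y ^ m"
    using inverted_partial_cmult.IH by blast
  thus ?case
    by (intro exI[of _ "norm c * C"]) (auto simp: norm_mult mult.assoc intro!: mult_left_mono)
qed

definition "deriv_x k = (partial_x ^^ k) f"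

lemma deriv_x_0 [simp]: "deriv_x 0 = f" and deriv_x_Suc: "deriv_x (Suc k) = partial_x (deriv_x k)"
  by (simp_all add: deriv_x_def)

lemma iterated_partial_deriv_x: "iterated_partial f (deriv_x k)"
  by (induction k) (auto simp: deriv_x_Suc intro: iterated_partial.intros)

lemma deriv_x_smooth: "smooth_on upper_half_plane (deriv_x k)"
  by (rule iterated_partial_smooth[OF iterated_partial_deriv_x smooth])

lemma deriv_x_inverted_partial: "\<exists>h. inverted_partial f h \<and> (\<forall>z\<in>upper_half_plane. deriv_x k z = h z)"
proof (induction k)
  case 0
  have "f z = f (- 1 / z)" if "z \<in> upper_half_plane" for z
    using invariant[of 0 0 "-1" 1 z] that by simp
  moreover have "inverted_partial f (\<lambda>z. f (- 1 / z))" by (intro inverted_partial.intros iterated_partial.intros)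
  ultimately show ?case by auto
next
  case (Suc k)
  then obtain h where h: "inverted_partial f h" "\<And>z. z \<in> upper_half_plane \<Longrightarrow> deriv_x k z = h z" by blast
  obtain h' where h': "inverted_partial f h'"
    "\<And>x y. y > 0 \<Longrightarrow> ((\<lambda>x. h (Complex x y)) has_vector_derivative h' (Complex x y)) (at x)"
    using inverted_partial_deriv[OF smooth h(1)] by blast
  have "deriv_x (Suc k) z = h' z" if z: "z \<in> upper_half_plane" for z
  proof -
    have y: "Im z > 0" using z by (simp add: upper_half_plane_def)
    have "((\<lambda>x. deriv_x k (Complex x (Im z))) has_vector_derivative partial_x (deriv_x k) (Complex (Re z) (Im z)))
        (at (Re z))"
      by (rule has_vector_derivative_x[OF deriv_x_smooth y])
    moreover have "(\<lambda>x. deriv_x k (Complex x (Im z))) = (\<lambda>x. h (Complex x (Im z)))" using h(2) y by auto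
    ultimately have "((\<lambda>x. h (Complex x (Im z))) has_vector_derivative deriv_x (Suc k) z) (at (Re z))"
      by (simp add: deriv_x_Suc)
    from vector_derivative_unique_at[OF this h'(2)[OF y]] show ?thesis by simp
  qed
  thus ?case using h'(1) by blast
qed

definition scaled_deriv :: "nat \<Rightarrow> real \<Rightarrow> real \<Rightarrow> complex" where
  "scaled_deriv k x t = deriv_x k (Complex x (exp t)) * of_real (exp (real k * t))"

lemma continuous_on_scaled_deriv: "continuous_on A (scaled_deriv k x)"
  unfolding scaled_deriv_def
  by (intro continuous_intros continuous_on_vertical smooth_on_continuous deriv_x_smooth)

lemma scaled_deriv_has_vector_derivative:
  "((\<lambda>x. scaled_deriv k x t) has_vector_derivative scaled_deriv (Suc k) x t * of_real (exp (- t))) (at x)"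
proof -
  have "exp (real k * t) = exp (real (Suc k) * t) * exp (- t)" by (simp add: algebra_simps flip: exp_add)
  moreover have "((\<lambda>x. scaled_deriv k x t) has_vector_derivative
      deriv_x (Suc k) (Complex x (exp t)) * of_real (exp (real k * t))) (at x)"
    unfolding scaled_deriv_def deriv_x_Suc
    by (intro has_vector_derivative_mult_left has_vector_derivative_x deriv_x_smooth exp_gt_zero)
  ultimately show ?thesis by (simp add: scaled_deriv_def mult.assoc)
qed

lemma scaled_deriv_bound_top:
  "\<exists>C\<ge>0. \<forall>x. \<forall>t\<ge>0. norm (scaled_deriv k x t) \<le> C * exp (- real m * t)"
proof -
  obtain C where C: "C \<ge> 0" "\<And>z. Im z \<ge> 1 \<Longrightarrow> norm (deriv_x k z) \<le> C * exp (- Im z)"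
    using iterated_partial_exp_decay[OF iterated_partial_deriv_x, of 1] by auto
  define D where "D = C * real (k + m) ^ (k + m)"
  have "norm (scaled_deriv k x t) \<le> D * exp (- real m * t)" if t: "t \<ge> 0" for x t
  proof -
    have "norm (deriv_x k (Complex x (exp t))) \<le> C * exp (- exp t)" using C(2)[of "Complex x (exp t)"] t by simp
    also have "\<dots> \<le> C * (real (k + m) ^ (k + m) * (1 / exp t) ^ (k + m))"
      using C by (intro mult_left_mono exp_minus_le_inverse_power) auto
    also have "(1 / exp t) ^ (k + m) = exp (- real (k + m) * t)"
      by (simp add: exp_minus exp_of_nat_mult divide_inverse power_inverse del: of_nat_add)
    finally have "norm (scaled_deriv k x t) \<le> D * exp (- real (k + m) * t) * exp (real k * t)"
      unfolding scaled_deriv_def norm_mult norm_of_real abs_exp_cancel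
      by (intro mult_right_mono) (simp_all add: D_def)
    thus ?thesis by (simp add: mult.assoc algebra_simps flip: exp_add)
  qed
  thus ?thesis using C(1) by (intro exI[of _ D]) (auto simp: D_def)
qed

lemma scaled_deriv_bound_cone:
  "\<exists>C\<ge>0. \<forall>x t. \<bar>x\<bar> \<le> exp t \<longrightarrow> norm (scaled_deriv k x t) \<le> C * exp (- real m * \<bar>t\<bar>)"
proof -
  obtain C where C: "C \<ge> 0" "\<And>x t. t \<ge> 0 \<Longrightarrow> norm (scaled_deriv k x t) \<le> C * exp (- real m * t)"
    using scaled_deriv_bound_top by blast
  obtain h where h: "inverted_partial f h" "\<And>z. z \<in> upper_half_plane \<Longrightarrow> deriv_x k z = h z"
    using deriv_x_inverted_partial by blast
  obtain D where D: "D \<ge> 0" "\<And>x y. 0 < y \<Longrightarrow> y \<le> 1 \<Longrightarrow> \<bar>x\<bar> \<le> y \<Longrightarrow> norm (h (Complex x y)) \<le> D * y ^ m"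
    using inverted_partial_bound[OF h(1)] by blast
  have "norm (scaled_deriv k x t) \<le> (C + D) * exp (- real m * \<bar>t\<bar>)" if x: "\<bar>x\<bar> \<le> exp t" for x t
  proof (cases "t \<ge> 0")
    case True
    have "C * exp (- real m * t) \<le> (C + D) * exp (- real m * t)" using D by (intro mult_right_mono) auto
    from order.trans[OF C(2)[OF True, of x] this] show ?thesis using True by simp
  next
    case False
    have "norm (scaled_deriv k x t) \<le> norm (h (Complex x (exp t))) * 1"
      unfolding scaled_deriv_def norm_mult norm_of_real abs_exp_cancel using False h(2)[of "Complex x (exp t)"]
      by (intro mult_mono) (auto simp: mult_nonneg_nonpos)
    also have "\<dots> \<le> D * exp t ^ m" using D(2)[of "exp t" x] x False by simp
    also have "exp t ^ m = exp (- real m * \<bar>t\<bar>)" using False by (simp flip: exp_of_nat_mult)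
    also have "D * exp (- real m * \<bar>t\<bar>) \<le> (C + D) * exp (- real m * \<bar>t\<bar>)" using C by (intro mult_right_mono) auto
    finally show ?thesis .
  qed
  thus ?thesis using C(1) D(1) by (intro exI[of _ "C + D"]) auto
qed

lemma partial_x_moebius:
  fixes a b c d :: int
  assumes det: "a * d - b * c = 1" and z: "z \<in> upper_half_plane"
  defines "w \<equiv> (of_int a * z + of_int b) / (of_int c * z + of_int d)"
    and "\<kappa> \<equiv> 1 / (of_int c * z + of_int d)\<^sup>2"
  assumes w: "w \<in> upper_half_plane" and denominator: "of_int c * z + of_int d \<noteq> 0"
  shows "partial_x f z = of_real (Re \<kappa>) * partial_x f w + of_real (Im \<kappa>) * partial_y f w"
proof -
  define M where "M = (\<lambda>z::complex. (of_int a * z + of_int b) / (of_int c * z + of_int d))"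
  have "(M has_field_derivative ((of_int a * (of_int c * z + of_int d) - (of_int a * z + of_int b) * of_int c) /
       ((of_int c * z + of_int d) * (of_int c * z + of_int d)))) (at z)"
    unfolding M_def using denominator by (auto intro!: derivative_eq_intros)
  also have "of_int a * (of_int c * z + of_int d) - (of_int a * z + of_int b) * of_int c =
       of_int (a * d - b * c)" by (simp add: algebra_simps)
  also have "\<dots> / ((of_int c * z + of_int d) * (of_int c * z + of_int d)) = \<kappa>"
    unfolding det by (simp add: \<kappa>_def power2_eq_square)
  finally have "(M has_field_derivative \<kappa>) (at (z + of_real 0))" by simp
  moreover have "((\<lambda>t. z + complex_of_real t) has_vector_derivative 1) (at 0)" by (auto intro!: derivative_eq_intros)
  ultimately have "((\<lambda>t. M (z + complex_of_real t)) has_vector_derivative \<kappa>) (at 0)"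
    using field_vector_diff_chain_at[of "\<lambda>t. z + complex_of_real t" 1 0 M \<kappa>] by (simp add: o_def)
  from has_vector_derivative_along[OF smooth _ this] w
  have "((\<lambda>t. f (M (z + complex_of_real t))) has_vector_derivative
        of_real (Re \<kappa>) * partial_x f w + of_real (Im \<kappa>) * partial_y f w) (at 0)" by (simp add: M_def w_def)
  moreover have "f (M (z + of_real t)) = f (z + of_real t)" for t
    unfolding M_def using z by (intro invariant det) (auto simp: upper_half_plane_def)
  ultimately show ?thesis unfolding partial_x_def by (intro vector_derivative_at) simp
qed

lemma moebius_at_rational_line:
  fixes p \<alpha> \<beta> :: int and q :: nat
  assumes det: "\<alpha> * p + \<beta> * int q = - 1" and q: "q > 0" and y: "y > 0"
  defines "z \<equiv> Complex (of_int p / real q) y"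
  shows "of_int (int q) * z + of_int (- p) = \<i> * of_real (real q * y)"
    and "(of_int \<alpha> * z + of_int \<beta>) / (of_int (int q) * z + of_int (- p)) =
        Complex (of_int \<alpha> / real q) (1 / ((real q)\<^sup>2 * y))"
proof -
  show denominator: "of_int (int q) * z + of_int (- p) = \<i> * of_real (real q * y)"
    using q by (simp add: z_def complex_eq_iff)
  have "real_of_int \<alpha> * real_of_int p + real_of_int \<beta> * real q = - 1"
    using det by (metis of_int_add of_int_mult of_int_of_nat_eq of_int_minus of_int_1)
  hence numerator: "of_int \<alpha> * z + of_int \<beta> = Complex (- 1 / real q) (of_int \<alpha> * y)"
    using q by (simp add: z_def complex_eq_iff field_simps)
  show "(of_int \<alpha> * z + of_int \<beta>) / (of_int (int q) * z + of_int (- p)) =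
      Complex (of_int \<alpha> / real q) (1 / ((real q)\<^sup>2 * y))"
    unfolding denominator numerator using q y
    by (simp add: complex_eq_iff Re_divide Im_divide power2_eq_square field_simps)
qed

lemma scaled_deriv_inversion:
  fixes p \<alpha> \<beta> :: int and q :: nat
  assumes det: "\<alpha> * p + \<beta> * int q = - 1" and q: "q > 0" and j: "j \<le> 1"
  shows "scaled_deriv j (of_int p / real q) t =
           (- 1) ^ j * scaled_deriv j (of_int \<alpha> / real q) (- 2 * ln (real q) - t)"
proof -
  define y where "y = exp t"
  define z where "z = Complex (of_int p / real q) y"
  define w where "w = Complex (of_int \<alpha> / real q) (1 / ((real q)\<^sup>2 * y))"
  have y: "y > 0" by (simp add: y_def)
  have z: "z \<in> upper_half_plane" and w: "w \<in> upper_half_plane" using y q by (auto simp: z_def w_def)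
  have exp_inverse: "exp (- 2 * ln (real q) - t) = 1 / ((real q)\<^sup>2 * y)"
    using q by (simp add: y_def exp_diff exp_minus exp_double field_simps)
  have matrix: "\<alpha> * (- p) - \<beta> * int q = 1" using det by (simp add: algebra_simps)
  note denominator = moebius_at_rational_line(1)[OF det q y, folded z_def]
    and image = moebius_at_rational_line(2)[OF det q y, folded z_def w_def]
  consider "j = 0" | "j = 1" using j by linarith
  thus ?thesis
  proof cases
    assume "j = 0"
    moreover have "f z = f w" using invariant[OF matrix z] by (simp only: image)
    ultimately show ?thesis unfolding scaled_deriv_def exp_inverse by (simp add: z_def w_def y_def)
  next
    assume "j = 1"
    define k where "k = - 1 / ((real q)\<^sup>2 * y\<^sup>2)"
    have \<kappa>: "1 / (of_int (int q) * z + of_int (- p))\<^sup>2 = complex_of_real k"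
      unfolding denominator by (simp add: k_def power_mult_distrib)
    have "of_int (int q) * z + of_int (- p) \<noteq> 0" unfolding denominator using q y by simp
    from partial_x_moebius[OF matrix z _ this, unfolded image \<kappa>, OF w]
    have "partial_x f z = of_real k * partial_x f w" by simp
    hence "scaled_deriv 1 (of_int p / real q) t = partial_x f w * of_real (k * y)"
      by (simp add: scaled_deriv_def deriv_x_Suc mult_ac flip: y_def z_def)
    also have "k * y = - 1 / ((real q)\<^sup>2 * y)" using y by (simp add: k_def power2_eq_square)
    also have "partial_x f w * of_real (- 1 / ((real q)\<^sup>2 * y)) =
        - scaled_deriv 1 (of_int \<alpha> / real q) (- 2 * ln (real q) - t)"
      unfolding scaled_deriv_def of_nat_1 mult_1 exp_inverse by (simp add: deriv_x_Suc w_def)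
    finally show ?thesis by (simp add: \<open>j = 1\<close>)
  qed
qed

lemma rapid_scaled_deriv:
  assumes x: "x \<in> \<rat>" and j: "j \<le> 1"
  shows "rapid (scaled_deriv j x)"
proof -
  obtain p b :: int where b: "b > 0" "coprime p b" "x = of_int p / of_int b" using x by (rule Rats_cases')
  define q where "q = nat b"
  have q: "q > 0" "b = int q" "x = of_int p / real q" using b by (simp_all add: q_def)
  obtain u v where "u * p + v * int q = 1"
    using bezout_int[of p "int q"] b(2) q by (auto simp: coprime_iff_gcd_eq_1)
  hence det: "(- u) * p + (- v) * int q = - 1" by (simp add: algebra_simps)
  define T where "T = 2 * ln (real q)"
  have T: "T \<ge> 0" using q by (simp add: T_def)
  show ?thesis
  proof (rule rapidI[OF continuous_on_scaled_deriv _ _ T])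
    fix m :: nat
    obtain C where C: "\<And>x t. t \<ge> 0 \<Longrightarrow> norm (scaled_deriv j x t) \<le> C * exp (- real m * t)"
      using scaled_deriv_bound_top by blast
    thus "\<exists>C. \<forall>t\<ge>0. norm (scaled_deriv j x t) \<le> C * exp (- real m * t)" by blast
    have "norm (scaled_deriv j x t) \<le> C * exp (real m * T) * exp (real m * t)" if "t \<le> - T" for t
    proof -
      have "norm (scaled_deriv j x t) = norm (scaled_deriv j (of_int (- u) / real q) (- T - t))"
        unfolding q(3) scaled_deriv_inversion[OF det q(1) j] by (simp add: norm_mult norm_power T_def)
      also have "\<dots> \<le> C * exp (- real m * (- T - t))" using that by (intro C) auto
      finally show ?thesis by (simp add: algebra_simps exp_add)
    qed
    thus "\<exists>C. \<forall>t\<le>-T. norm (scaled_deriv j x t) \<le> C * exp (real m * t)" by blast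
  qed
qed

end

section \<open>The archimedean factor\<close>

lemma of_nat_powr_conv_exp: "n > 0 \<Longrightarrow> of_nat n powr (s::complex) = exp (s * of_real (ln (real n)))"
  by (simp add: powr_def Ln_of_nat)

lemma of_real_sqrt_conv_powr:
  assumes "n > 0"
  shows "complex_of_real (sqrt (real n)) = of_nat n powr (1 / 2)"
proof -
  have "sqrt (real n) = exp (1 / 2 * ln (real n))"
    using assms by (simp add: powr_half_sqrt[symmetric] powr_def)
  hence "complex_of_real (sqrt (real n)) = exp (of_real (1 / 2 * ln (real n)))" by (simp only: exp_of_real)
  thus ?thesis using of_nat_powr_conv_exp[OF assms, of "1 / 2"] by simp
qed

context hecke_form
begin

definition archimedean_weight :: "nat \<Rightarrow> real \<Rightarrow> complex" where
  "archimedean_weight j t = W (exp t) * exp (of_nat j * of_real t)"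

definition inverse_gamma_factor :: "complex \<Rightarrow> complex" where
  "inverse_gamma_factor p = 4 * of_real pi powr (p + 1 / 2) *
     rGamma ((p + 1 / 2 + spectral_parameter) / 2) * rGamma ((p + 1 / 2 - spectral_parameter) / 2)"

lemma inverse_gamma_factor_holomorphic: "(\<lambda>s. inverse_gamma_factor (s + a)) holomorphic_on A"
  unfolding inverse_gamma_factor_def by (intro holomorphic_intros) auto

lemma W_exp_integrable:
  assumes \<sigma>: "\<sigma> > 0"
  shows "integrable lborel (\<lambda>t. norm (W (exp t)) * exp (\<sigma> * t))"
proof -
  obtain K where K: "K > 0" "\<And>y. y > 0 \<Longrightarrow> norm (W y) \<le> K * exp (- pi * y)" using W_exp_bound by blast
  let ?g = "\<lambda>t. complex_of_real (exp (- exp t)) * exp (of_real \<sigma> * of_real t)"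
  have g: "integrable lborel (\<lambda>t. K * norm (?g t))"
    using Gamma_eq_mellin(1)[of "of_real \<sigma>"] \<sigma> by (intro integrable_mult_right integrable_norm) auto
  show ?thesis
  proof (rule Bochner_Integration.integrable_bound[OF g])
    show "(\<lambda>t. norm (W (exp t)) * exp (\<sigma> * t)) \<in> borel_measurable lborel"
      using continuous_on_W_exp by (simp add: borel_measurable_continuous_onI continuous_intros)
    have "norm (norm (W (exp t)) * exp (\<sigma> * t)) \<le> norm (K * norm (?g t))" for t
    proof -
      have "norm (W (exp t)) \<le> K * exp (- pi * exp t)" by (rule K) simp
      also have "\<dots> \<le> K * exp (- exp t)"
        using K(1) pi_ge_two by (intro mult_left_mono) (auto simp: mult_le_cancel_right1)
      finally have "norm (W (exp t)) * exp (\<sigma> * t) \<le> K * exp (- exp t) * exp (\<sigma> * t)"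
        by (intro mult_right_mono) auto
      thus ?thesis using K(1) by (simp add: norm_mult mult.assoc)
    qed
    thus "AE t in lborel. norm (norm (W (exp t)) * exp (\<sigma> * t)) \<le> norm (K * norm (?g t))" by simp
  qed
qed

lemma mellin_W:
  assumes p: "Re p > 0"
  shows "inverse_gamma_factor p * mellin (\<lambda>t. W (exp t)) p = 1"
proof -
  define U where "U = {p. Re p > \<bar>Re spectral_parameter\<bar>}"
  have "inverse_gamma_factor z * mellin (\<lambda>t. W (exp t)) z = 1" if "z \<in> U" for z
  proof -
    define a b where "a = (z + 1 / 2 + spectral_parameter) / 2" and "b = (z + 1 / 2 - spectral_parameter) / 2"
    have z: "Re z + 1 / 2 > \<bar>Re spectral_parameter\<bar>" using that by (simp add: U_def)
    hence "Re a > 0" "Re b > 0" by (auto simp: a_def b_def)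
    hence "Gamma a * rGamma a = 1" "Gamma b * rGamma b = 1"
      using Gamma_nonzero_of_Re_pos by (simp_all add: Gamma_def)
    moreover have "of_real pi powr (z + 1 / 2) * of_real pi powr (- (z + 1 / 2)) = (1 :: complex)"
      by (simp flip: powr_add)
    moreover have mellin_eq: "mellin (\<lambda>t. W (exp t)) z = of_real pi powr (- (z + 1 / 2)) * Gamma a * Gamma b / 4"
      using mellin_whittaker[OF z] by (simp only: a_def b_def)
    have "inverse_gamma_factor z * mellin (\<lambda>t. W (exp t)) z =
        (of_real pi powr (z + 1 / 2) * of_real pi powr (- (z + 1 / 2))) * (Gamma a * rGamma a) * (Gamma b * rGamma b)"
      unfolding inverse_gamma_factor_def a_def[symmetric] b_def[symmetric] mellin_eq by simp
    ultimately show ?thesis by simp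
  qed
  moreover have "(\<lambda>z. inverse_gamma_factor z * mellin (\<lambda>t. W (exp t)) z) holomorphic_on {z. Re z > 0}"
    using inverse_gamma_factor_holomorphic[of 0 "{z. Re z > 0}"]
    by (intro holomorphic_intros mellin_holomorphic continuous_on_W_exp W_exp_integrable) simp_all
  moreover have "of_real (\<bar>Re spectral_parameter\<bar> + 1) \<in> U" by (simp add: U_def)
  moreover have "open U" "U \<subseteq> {z. Re z > 0}" by (auto simp: U_def open_halfspace_Re_gt)
  moreover have "open {z. Re z > 0}" "connected {z. Re z > 0}"
    by (auto simp: open_halfspace_Re_gt intro!: convex_connected convex_halfspace_Re_gt)
  ultimately show ?thesis
    using p analytic_continuation_open[of U "{z. Re z > 0}"
      "\<lambda>z. inverse_gamma_factor z * mellin (\<lambda>t. W (exp t)) z" "\<lambda>_. 1" p]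
    by (blast intro: holomorphic_on_const)
qed

lemma mellin_archimedean_weight: "mellin (archimedean_weight j) p = mellin (\<lambda>t. W (exp t)) (p + of_nat j)"
  unfolding archimedean_weight_def[abs_def] by (rule mellin_mult_exp)

lemma continuous_on_archimedean_weight: "continuous_on A (archimedean_weight j)"
  unfolding archimedean_weight_def[abs_def] by (intro continuous_intros continuous_on_W_exp)

lemma norm_archimedean_weight: "norm (archimedean_weight j t) = norm (W (exp t)) * exp (real j * t)"
  by (simp add: archimedean_weight_def norm_mult)

lemma archimedean_weight_integrable:
  assumes "\<sigma> > 0"
  shows "integrable lborel (\<lambda>t. norm (archimedean_weight j t) * exp (\<sigma> * t))"
  using W_exp_integrable[of "real j + \<sigma>"] assms
  by (simp add: norm_archimedean_weight mult.assoc distrib_right exp_add)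

lemma archimedean_weight_shift:
  assumes "n > 0"
  shows "archimedean_weight j (t + ln (real n)) = of_real (real n ^ j * exp (real j * t)) * W (real n * exp t)"
proof -
  have "exp (of_nat j * complex_of_real (t + ln (real n))) = of_real (exp (real j * (t + ln (real n))))"
    by (simp only: exp_of_real[symmetric] of_real_mult of_real_of_nat_eq)
  also have "exp (real j * (t + ln (real n))) = real n ^ j * exp (real j * t)"
    using assms by (simp add: exp_of_nat_mult exp_add power_mult_distrib)
  finally show ?thesis using assms by (simp add: archimedean_weight_def exp_add mult_ac)
qed

lemma archimedean_weight_summable:
  assumes c: "\<And>k. norm (c k) \<le> C * real (Suc k) ^ B"
  shows "summable (\<lambda>k. norm (c k * archimedean_weight j (t + ln (real (Suc k)))))"
proof -
  obtain K where K: "K > 0" "\<And>y. y > 0 \<Longrightarrow> norm (W y) \<le> K * exp (- pi * y)" using W_exp_bound by blast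
  define u where "u = (\<lambda>k. C * K * exp (real j * t) * (real (Suc k) ^ (B + j) * exp (- (pi * exp t) * real (Suc k))))"
  have le_u: "norm (c k * archimedean_weight j (t + ln (real (Suc k)))) \<le> u k" for k
  proof -
    have "norm (archimedean_weight j (t + ln (real (Suc k)))) =
        real (Suc k) ^ j * exp (real j * t) * norm (W (real (Suc k) * exp t))"
      unfolding archimedean_weight_shift[OF zero_less_Suc] norm_mult norm_of_real by simp
    also have "\<dots> \<le> real (Suc k) ^ j * exp (real j * t) * (K * exp (- pi * (real (Suc k) * exp t)))"
      by (intro mult_left_mono K) auto
    finally have "norm (c k) * norm (archimedean_weight j (t + ln (real (Suc k)))) \<le>
        (C * real (Suc k) ^ B) * (real (Suc k) ^ j * exp (real j * t) * (K * exp (- pi * (real (Suc k) * exp t))))"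
      by (intro mult_mono c order.trans[OF norm_ge_zero c]) auto
    thus ?thesis by (simp add: u_def norm_mult power_add mult_ac)
  qed
  have "summable u" unfolding u_def by (intro summable_mult summable_power_mult_exp) simp
  thus ?thesis by (rule summable_comparison_test'[of u 0]) (simp only: real_norm_def abs_norm_cancel le_u)
qed

end

lemma integral_norm_shift_mult_exp:
  fixes w :: "real \<Rightarrow> complex"
  shows "(\<integral>t. norm (w (t + c)) * exp (\<sigma> * t) \<partial>lborel) = exp (- \<sigma> * c) * (\<integral>t. norm (w t) * exp (\<sigma> * t) \<partial>lborel)"
proof -
  have "(\<integral>t. norm (w t) * exp (\<sigma> * t) \<partial>lborel) = (\<integral>t. norm (w (c + 1 * t)) * exp (\<sigma> * (c + 1 * t)) \<partial>lborel)"
    by (subst lborel_integral_real_affine[of 1 _ c]) auto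
  also have "\<dots> = (\<integral>t. exp (\<sigma> * c) * (norm (w (t + c)) * exp (\<sigma> * t)) \<partial>lborel)"
    by (intro Bochner_Integration.integral_cong refl) (simp add: algebra_simps exp_add)
  finally show ?thesis by (simp add: exp_minus)
qed

lemma mellin_dirichlet_series:
  fixes w h :: "real \<Rightarrow> complex" and c :: "nat \<Rightarrow> complex"
  assumes w: "continuous_on UNIV w" "integrable lborel (\<lambda>t. norm (w t) * exp (Re p * t))"
    and h: "\<And>t. (\<lambda>k. c k * w (t + ln (real (Suc k)))) sums h t"
    and abs_summable: "\<And>t. summable (\<lambda>k. norm (c k * w (t + ln (real (Suc k)))))"
    and c: "summable (\<lambda>k. norm (c k) / real (Suc k) powr Re p)"
  shows "(\<lambda>k. c k / of_nat (Suc k) powr p * mellin w p) sums mellin h p"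
proof -
  define g where "g = (\<lambda>k t. c k * w (t + ln (real (Suc k))) * exp (p * of_real t))"
  define I where "I = (\<integral>t. norm (w t) * exp (Re p * t) \<partial>lborel)"
  have shift: "w (t + ln (real (Suc k))) * exp (p * of_real t) =
      exp (- p * of_real (ln (real (Suc k)))) * ((\<lambda>t. w t * exp (p * of_real t)) (ln (real (Suc k)) + 1 * t))" for k t
    by (simp add: algebra_simps flip: exp_add)
  have g: "integrable lborel (g k)" for k
    unfolding g_def mult.assoc shift
    by (intro integrable_mult_right lborel_integrable_real_affine mellin_integrable w) auto
  have norm_g: "(\<integral>t. norm (g k t) \<partial>lborel) = norm (c k) / real (Suc k) powr Re p * I" for k
    using integral_norm_shift_mult_exp[of w "ln (real (Suc k))" "Re p"]
    by (simp add: g_def I_def norm_mult mult.assoc powr_def exp_minus divide_inverse)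
  have "(\<lambda>k. integral\<^sup>L lborel (g k)) sums (\<integral>t. (\<Sum>k. g k t) \<partial>lborel)"
  proof (rule sums_integral[OF g])
    have "summable (\<lambda>k. norm (g k t))" for t
      using summable_mult2[OF abs_summable[of t], of "norm (exp (p * of_real t))"] by (simp add: g_def norm_mult)
    thus "AE t in lborel. summable (\<lambda>k. norm (g k t))" by simp
    show "summable (\<lambda>k. \<integral>t. norm (g k t) \<partial>lborel)" unfolding norm_g by (rule summable_mult2[OF c])
  qed
  moreover have "(\<Sum>k. g k t) = h t * exp (p * of_real t)" for t
    using sums_mult2[OF h[of t], of "exp (p * of_real t)"] by (simp add: g_def sums_iff)
  moreover have "integral\<^sup>L lborel (g k) = c k / of_nat (Suc k) powr p * mellin w p" for k
  proof -
    have "integral\<^sup>L lborel (g k) = c k * mellin (\<lambda>t. w (t + ln (real (Suc k)))) p"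
      by (simp add: g_def mellin_def mult.assoc)
    also have "\<dots> = c k * (exp (- p * of_real (ln (real (Suc k)))) * mellin w p)"
      by (simp only: mellin_shift)
    also have "exp (- p * of_real (ln (real (Suc k)))) = 1 / of_nat (Suc k) powr p"
      using of_nat_powr_conv_exp[of "Suc k" p] by (simp add: exp_minus divide_inverse)
    finally show ?thesis by simp
  qed
  ultimately show ?thesis by (simp add: mellin_def)
qed

section \<open>Analytic continuation of additive twists\<close>

lemma entire_continuation_add:
  "entire_continuation a F \<Longrightarrow> entire_continuation b G \<Longrightarrow> entire_continuation (\<lambda>n. a n + b n) (\<lambda>s. F s + G s)"
  unfolding entire_continuation_def
  by (auto intro!: holomorphic_intros sums_add simp: add_divide_distrib)

lemma entire_continuation_cmult:
  assumes "entire_continuation a F"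
  shows "entire_continuation (\<lambda>n. c * a n) (\<lambda>s. c * F s)"
  unfolding entire_continuation_def
proof (intro conjI allI impI)
  show "(\<lambda>s. c * F s) holomorphic_on UNIV"
    using assms by (auto simp: entire_continuation_def intro!: holomorphic_intros)
  fix s :: complex assume "Re s > 1"
  with assms have "(\<lambda>n. a (Suc n) / of_nat (Suc n) powr s) sums F s" unfolding entire_continuation_def by blast
  from sums_mult[OF this, of c] show "(\<lambda>n. c * a (Suc n) / of_nat (Suc n) powr s) sums (c * F s)" by simp
qed

lemma entire_continuation_sum:
  assumes "finite S" "\<And>i. i \<in> S \<Longrightarrow> entire_continuation (a i) (F i)"
  shows "entire_continuation (\<lambda>n. \<Sum>i\<in>S. a i n) (\<lambda>s. \<Sum>i\<in>S. F i s)"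
  using assms
proof (induction S rule: finite_induct)
  case empty
  show ?case by (simp add: entire_continuation_def)
next
  case (insert i S)
  thus ?case using entire_continuation_add[of "a i" "F i"] by simp
qed

lemma L_series_eq: "entire_continuation a F \<Longrightarrow> L_series a = F"
  unfolding L_series_def using entire_continuation_unique by blast

lemma entire_continuation_L_series: "entire_continuation a F \<Longrightarrow> entire_continuation a (L_series a)"
  using L_series_eq by simp

definition additive_weight :: "complex \<Rightarrow> real \<Rightarrow> nat \<Rightarrow> complex" where
  "additive_weight \<nu> x n = cis (2 * pi * real n * x) + \<nu> * cis (- 2 * pi * real n * x)"

lemma norm_additive_weight_le: "norm \<nu> = 1 \<Longrightarrow> norm (additive_weight \<nu> x n) \<le> 2"
  unfolding additive_weight_def by (rule order.trans[OF norm_triangle_ineq]) (simp add: norm_mult)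

context hecke_form
begin

lemma horocycle_coeff_deriv_x:
  assumes y: "y > 0"
  shows "horocycle_coeff (deriv_x j) n y = (2 * of_real pi * \<i> * of_int n) ^ j * fcoeff n y"
proof (induction j)
  case (Suc j)
  have "one_periodic (deriv_x j)" by (rule iterated_partial_one_periodic[OF iterated_partial_deriv_x one_periodic])
  from horocycle_coeff_partial_x[OF deriv_x_smooth this y] Suc show ?case by (simp add: deriv_x_Suc)
qed (simp add: fcoeff_def)

lemma scaled_deriv_sums:
  "(\<lambda>k. (2 * of_real pi * \<i>) ^ j * (eigenvalue (Suc k) / of_real (sqrt (real (Suc k)))) *
        (first_coeff 1 * cis (2 * pi * real (Suc k) * x) + (- 1) ^ j * first_coeff (- 1) *
          cis (- 2 * pi * real (Suc k) * x)) *
        archimedean_weight j (t + ln (real (Suc k)))) sums scaled_deriv j x t"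
proof -
  define y where "y = exp t"
  have y: "y > 0" by (simp add: y_def)
  define v where "v = (\<lambda>k. horocycle_coeff (deriv_x j) (int (Suc k)) y * cis (2 * pi * real (Suc k) * x) +
      horocycle_coeff (deriv_x j) (- int (Suc k)) y * cis (- 2 * pi * real (Suc k) * x))"
  have "v sums deriv_x j (Complex x y)"
    unfolding v_def by (rule horocycle_fourier_series[OF deriv_x_smooth
        iterated_partial_one_periodic[OF iterated_partial_deriv_x one_periodic] y
        iterated_partial_coeff_0[OF iterated_partial_deriv_x y]])
  hence "(\<lambda>k. v k * of_real (exp (real j * t))) sums scaled_deriv j x t"
    unfolding scaled_deriv_def y_def by (rule sums_mult2)
  moreover have "v k * of_real (exp (real j * t)) =
      (2 * of_real pi * \<i>) ^ j * (eigenvalue (Suc k) / of_real (sqrt (real (Suc k)))) *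
        (first_coeff 1 * cis (2 * pi * real (Suc k) * x) + (- 1) ^ j * first_coeff (- 1) *
          cis (- 2 * pi * real (Suc k) * x)) *
        archimedean_weight j (t + ln (real (Suc k)))" for k
  proof -
    define n where "n = real (Suc k)"
    define l where "l = eigenvalue (Suc k) / of_real (sqrt n)"
    define r where "r = 2 * complex_of_real pi * \<i>"
    have coeff: "fcoeff (int (Suc k)) y = l * first_coeff 1 * W (n * y)" "fcoeff (- int (Suc k)) y =
        l * first_coeff (- 1) * W (n * y)"
      using fcoeff_whittaker[of "Suc k" y 1] fcoeff_whittaker[of "Suc k" y "- 1"] y by (simp_all add: l_def n_def)
    have deriv: "horocycle_coeff (deriv_x j) (int (Suc k)) y =
        r ^ j * of_real n ^ j * (l * first_coeff 1 * W (n * y))"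
      "horocycle_coeff (deriv_x j) (- int (Suc k)) y =
          r ^ j * (- 1) ^ j * of_real n ^ j * (l * first_coeff (- 1) * W (n * y))"
    proof -
      have "r * of_int (int (Suc k)) = r * of_real n" "r * of_int (- int (Suc k)) = r * (- 1) * of_real n"
        by (simp_all add: n_def algebra_simps)
      thus "horocycle_coeff (deriv_x j) (int (Suc k)) y = r ^ j * of_real n ^ j * (l * first_coeff 1 * W (n * y))"
        "horocycle_coeff (deriv_x j) (- int (Suc k)) y =
            r ^ j * (- 1) ^ j * of_real n ^ j * (l * first_coeff (- 1) * W (n * y))"
        unfolding horocycle_coeff_deriv_x[OF y] coeff r_def[symmetric] by (simp_all only: power_mult_distrib)
    qed
    have weight: "archimedean_weight j (t + ln n) = W (n * y) * (of_real n ^ j * of_real (exp (real j * t)))"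
      using archimedean_weight_shift[of "Suc k" j t] unfolding n_def y_def
      by (simp only: zero_less_Suc of_real_mult of_real_power mult.commute simp_thms)
    show ?thesis
      unfolding v_def n_def[symmetric] deriv weight l_def[symmetric] r_def[symmetric] by (simp add: algebra_simps)
  qed
  ultimately show ?thesis by simp
qed

end

text \<open>The sign separates the even from the odd part of the form under \<open>z \<mapsto> - cnj z\<close>.\<close>

locale signed_form = hecke_form +
  fixes e :: complex
  assumes sign: "e = 1 \<or> e = - 1"
    and signed_coeff_nonzero: "first_coeff 1 + e * first_coeff (- 1) \<noteq> 0"
begin

definition "signed_coeff = first_coeff 1 + e * first_coeff (- 1)"

lemma sign_square: "e * e = 1" and norm_sign: "norm e = 1" using sign by auto

definition signed_deriv :: "nat \<Rightarrow> real \<Rightarrow> real \<Rightarrow> complex" where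
  "signed_deriv j x t = scaled_deriv j x t + (- 1) ^ j * e * scaled_deriv j (- x) t"

definition twist_coeff :: "nat \<Rightarrow> real \<Rightarrow> nat \<Rightarrow> complex" where
  "twist_coeff j x k = (2 * of_real pi * \<i>) ^ j * signed_coeff *
      (eigenvalue (Suc k) / of_real (sqrt (real (Suc k)))) *
     additive_weight ((- 1) ^ j * e) x (Suc k)"

lemma signed_deriv_sums:
  "(\<lambda>k. twist_coeff j x k * archimedean_weight j (t + ln (real (Suc k)))) sums signed_deriv j x t"
proof -
  let ?term = "\<lambda>k x. (2 * of_real pi * \<i>) ^ j * (eigenvalue (Suc k) / of_real (sqrt (real (Suc k)))) *
        (first_coeff 1 * cis (2 * pi * real (Suc k) * x) + (- 1) ^ j * first_coeff (- 1) *
          cis (- 2 * pi * real (Suc k) * x)) *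
        archimedean_weight j (t + ln (real (Suc k)))"
  have "(\<lambda>k. ?term k x + (- 1) ^ j * e * ?term k (- x)) sums signed_deriv j x t"
    unfolding signed_deriv_def by (intro sums_add sums_mult scaled_deriv_sums)
  moreover have "?term k x + (- 1) ^ j * e * ?term k (- x) =
      twist_coeff j x k * archimedean_weight j (t + ln (real (Suc k)))" for k
  proof -
    define A B \<epsilon> where "A = first_coeff 1" and "B = first_coeff (- 1)" and "\<epsilon> = (- 1 :: complex) ^ j"
    define u v where "u = cis (2 * pi * real (Suc k) * x)" and "v = cis (- 2 * pi * real (Suc k) * x)"
    have "\<epsilon> * \<epsilon> = 1" by (simp add: \<epsilon>_def flip: power_add)
    hence "(A * u + \<epsilon> * B * v) + \<epsilon> * e * (A * v + \<epsilon> * B * u) = (A * u + \<epsilon> * B * v) + (\<epsilon> * e * A * v + e * B * u)"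
      by (simp add: algebra_simps)
    also have "\<dots> = (A + e * B) * (u + \<epsilon> * e * v)" using sign_square by (simp add: algebra_simps)
    finally have eq: "(A * u + \<epsilon> * B * v) + \<epsilon> * e * (A * v + \<epsilon> * B * u) = (A + e * B) * (u + \<epsilon> * e * v)" .
    have reflect: "cis (2 * pi * real (Suc k) * (- x)) = v" "cis (- 2 * pi * real (Suc k) * (- x)) = u"
      by (simp_all add: u_def v_def)
    define l where "l = (2 * of_real pi * \<i>) ^ j * (eigenvalue (Suc k) / of_real (sqrt (real (Suc k))))"
    define w where "w = archimedean_weight j (t + ln (real (Suc k)))"
    have "?term k x + (- 1) ^ j * e * ?term k (- x) =
        l * ((A * u + \<epsilon> * B * v) + \<epsilon> * e * (A * v + \<epsilon> * B * u)) * w"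
      unfolding reflect l_def[symmetric] w_def[symmetric] A_def[symmetric] B_def[symmetric] \<epsilon>_def[symmetric]
        u_def[symmetric] v_def[symmetric] by (simp only: distrib_left distrib_right mult_ac)
    thus ?thesis unfolding eq
      by (simp add: twist_coeff_def l_def w_def A_def B_def \<epsilon>_def u_def v_def signed_coeff_def additive_weight_def
        mult_ac)
  qed
  ultimately show ?thesis by simp
qed

lemma norm_twist_coeff_le:
  "norm (twist_coeff j x k) \<le>
     2 * norm ((2 * of_real pi * \<i>) ^ j * signed_coeff) * (norm (eigenvalue (Suc k)) / sqrt (real (Suc k)))"
proof -
  have "norm (additive_weight ((- 1) ^ j * e) x (Suc k)) \<le> 2"
    by (intro norm_additive_weight_le) (simp add: norm_mult norm_power norm_sign)
  from mult_left_mono[OF this, of "norm ((2 * of_real pi * \<i>) ^ j * signed_coeff *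
      (eigenvalue (Suc k) / of_real (sqrt (real (Suc k)))))"]
  show ?thesis unfolding twist_coeff_def norm_mult norm_divide norm_of_real by (simp add: mult_ac)
qed

lemma twist_coeff_weight_summable:
  "summable (\<lambda>k. norm (twist_coeff j x k * archimedean_weight j (t + ln (real (Suc k)))))"
proof -
  obtain C B where C: "\<And>n. n \<ge> 1 \<Longrightarrow> norm (eigenvalue n) / sqrt (real n) \<le> C * real n ^ B"
    using eigenvalue_div_sqrt_poly_bound by blast
  define r where "r = 2 * norm ((2 * complex_of_real pi * \<i>) ^ j * signed_coeff)"
  have "norm (twist_coeff j x k) \<le> (r * C) * real (Suc k) ^ B" for k
  proof -
    have "r * (norm (eigenvalue (Suc k)) / sqrt (real (Suc k))) \<le> r * (C * real (Suc k) ^ B)"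
      using C[of "Suc k"] by (intro mult_left_mono) (auto simp: r_def)
    with norm_twist_coeff_le[of j x k] show ?thesis by (simp only: r_def mult.assoc)
  qed
  thus ?thesis by (rule archimedean_weight_summable)
qed

lemma twist_coeff_summable:
  assumes s: "Re s > 1"
  shows "summable (\<lambda>k. norm (twist_coeff j x k) / real (Suc k) powr Re (s - 1 / 2))"
proof (rule summable_comparison_test)
  define r where "r = 2 * norm ((2 * complex_of_real pi * \<i>) ^ j * signed_coeff)"
  show "summable (\<lambda>k. r * (norm (eigenvalue (Suc k)) / real (Suc k) powr Re s))"
    by (intro summable_mult eigenvalue_abs_summable s)
  have "norm (norm (twist_coeff j x k) / real (Suc k) powr Re (s - 1 / 2)) \<le>
      r * (norm (eigenvalue (Suc k)) / real (Suc k) powr Re s)" for k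
  proof -
    have "sqrt (real (Suc k)) * real (Suc k) powr Re (s - 1 / 2) = real (Suc k) powr Re s"
      by (simp add: powr_half_sqrt[symmetric] flip: powr_add)
    thus ?thesis
      using divide_right_mono[OF norm_twist_coeff_le[of j x k], of "real (Suc k) powr Re (s - 1 / 2)"]
      by (simp add: r_def mult.assoc)
  qed
  thus "\<exists>N. \<forall>k\<ge>N. norm (norm (twist_coeff j x k) / real (Suc k) powr Re (s - 1 / 2)) \<le>
      r * (norm (eigenvalue (Suc k)) / real (Suc k) powr Re s)" by blast
qed

definition twist_value :: "nat \<Rightarrow> real \<Rightarrow> complex \<Rightarrow> complex" where
  "twist_value j x s = inverse_gamma_factor (s - 1 / 2 + of_nat j) / ((2 * of_real pi * \<i>) ^ j * signed_coeff) *
     mellin (signed_deriv j x) (s - 1 / 2)"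

lemma twist_value_sums:
  assumes s: "Re s > 1"
  shows "(\<lambda>k. eigenvalue (Suc k) * additive_weight ((- 1) ^ j * e) x (Suc k) / of_nat (Suc k) powr s) sums
      twist_value j x s"
proof -
  define r where "r = (2 * complex_of_real pi * \<i>) ^ j * signed_coeff"
  define p where "p = s - 1 / 2"
  have p: "Re p > 0" using s by (simp add: p_def)
  have r: "r \<noteq> 0" using signed_coeff_nonzero by (simp add: r_def signed_coeff_def)
  have "(\<lambda>k. twist_coeff j x k / of_nat (Suc k) powr p * mellin (archimedean_weight j) p) sums
      mellin (signed_deriv j x) p"
    using twist_coeff_summable[OF s] unfolding p_def[symmetric]
    by (intro mellin_dirichlet_series continuous_on_archimedean_weight archimedean_weight_integrable p
          signed_deriv_sums twist_coeff_weight_summable)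
  from sums_mult[OF this, of "inverse_gamma_factor (p + of_nat j) / r"]
  have "(\<lambda>k. inverse_gamma_factor (p + of_nat j) / r *
      (twist_coeff j x k / of_nat (Suc k) powr p * mellin (archimedean_weight j) p))
      sums twist_value j x s"
    by (simp add: twist_value_def p_def r_def)
  moreover have "inverse_gamma_factor (p + of_nat j) / r *
      (twist_coeff j x k / of_nat (Suc k) powr p * mellin (archimedean_weight j) p) =
      eigenvalue (Suc k) * additive_weight ((- 1) ^ j * e) x (Suc k) / of_nat (Suc k) powr s" for k
  proof -
    have "of_real (sqrt (real (Suc k))) * of_nat (Suc k) powr p = (of_nat (Suc k) powr s :: complex)"
      using of_real_sqrt_conv_powr[of "Suc k"] by (simp add: p_def flip: powr_add)
    moreover have "inverse_gamma_factor (p + of_nat j) / r *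
        (twist_coeff j x k / of_nat (Suc k) powr p * mellin (archimedean_weight j) p) =
        (inverse_gamma_factor (p + of_nat j) * mellin (\<lambda>t. W (exp t)) (p + of_nat j)) *
          (twist_coeff j x k / r / of_nat (Suc k) powr p)"
      by (simp add: mellin_archimedean_weight)
    ultimately show ?thesis
      using mellin_W[of "p + of_nat j"] p r unfolding twist_coeff_def r_def[symmetric] by simp
  qed
  ultimately show ?thesis by simp
qed

lemma rapid_signed_deriv:
  assumes "x \<in> \<rat>" "j \<le> 1"
  shows "rapid (signed_deriv j x)"
  unfolding signed_deriv_def[abs_def] using assms by (intro rapid_add rapid_cmult rapid_scaled_deriv) auto

lemma twist_value_continuation:
  assumes "x \<in> \<rat>" "j \<le> 1"
  shows "entire_continuation (\<lambda>n. eigenvalue n * additive_weight ((- 1) ^ j * e) x n) (twist_value j x)"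
  unfolding entire_continuation_def
proof (intro conjI allI impI twist_value_sums)
  have "mellin (signed_deriv j x) holomorphic_on UNIV"
    by (rule rapid_mellin_holomorphic[OF rapid_signed_deriv[OF assms]])
  moreover have "(\<lambda>s. s - 1 / 2 :: complex) holomorphic_on UNIV" by (intro holomorphic_intros)
  ultimately have "(\<lambda>s. mellin (signed_deriv j x) (s - 1 / 2)) holomorphic_on UNIV"
    using holomorphic_on_compose_gen[of "\<lambda>s. s - 1 / 2" UNIV "mellin (signed_deriv j x)" UNIV] by (simp add: o_def)
  thus "twist_value j x holomorphic_on UNIV"
    using inverse_gamma_factor_holomorphic[of "- 1 / 2 + of_nat j"]
    unfolding twist_value_def[abs_def] by (auto intro!: holomorphic_intros simp: algebra_simps)
qed

lemma ex_parity: "\<nu> = 1 \<or> \<nu> = - 1 \<Longrightarrow> \<exists>j\<le>1. (- 1) ^ j * e = \<nu>"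
  using sign by (intro exI[of _ "if \<nu> = e then 0 else 1"]) auto

end

context hecke_form
begin

lemma ex_signed_form: "\<exists>e. signed_form f e"
proof -
  obtain s where "\<bar>s\<bar> = 1" "first_coeff s \<noteq> 0" using first_coeff_nonzero by blast
  hence "first_coeff 1 \<noteq> 0 \<or> first_coeff (- 1) \<noteq> 0" by (metis abs_eq_iff abs_1)
  hence "first_coeff 1 + 1 * first_coeff (- 1) \<noteq> 0 \<or> first_coeff 1 + (- 1) * first_coeff (- 1) \<noteq> 0"
    by (auto simp: add_eq_0_iff)
  moreover have "signed_form f e" if "e = 1 \<or> e = - 1" "first_coeff 1 + e * first_coeff (- 1) \<noteq> 0" for e
    using that by unfold_locales
  ultimately show ?thesis by blast
qed

lemma ex_additive_twist_continuation:
  assumes x: "x \<in> \<rat>" and \<nu>: "\<nu> = 1 \<or> \<nu> = - 1"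
  shows "\<exists>F. entire_continuation (\<lambda>n. eigenvalue n * additive_weight \<nu> x n) F"
proof -
  obtain e where "signed_form f e" using ex_signed_form by blast
  then interpret signed_form f e .
  obtain j where "j \<le> 1" "(- 1) ^ j * e = \<nu>" using ex_parity[OF \<nu>] by blast
  thus ?thesis using twist_value_continuation[OF x, of j] by auto
qed

lemma ex_cis_twist_continuation:
  assumes x: "x \<in> \<rat>"
  shows "\<exists>F. entire_continuation (\<lambda>n. eigenvalue n * cis (2 * pi * real n * x)) F"
proof -
  obtain F G where F: "entire_continuation (\<lambda>n. eigenvalue n * additive_weight 1 x n) F"
    and G: "entire_continuation (\<lambda>n. eigenvalue n * additive_weight (- 1) x n) G"
    using ex_additive_twist_continuation[OF x] by blast
  have "(\<lambda>n. 1 / 2 * (eigenvalue n * additive_weight 1 x n + eigenvalue n * additive_weight (- 1) x n)) =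
      (\<lambda>n. eigenvalue n * cis (2 * pi * real n * x))"
    by (simp add: additive_weight_def fun_eq_iff algebra_simps)
  with entire_continuation_cmult[OF entire_continuation_add[OF F G], of "1 / 2"] show ?thesis by auto
qed

lemma L_form_continuation: "entire_continuation eigenvalue (L_form f)"
proof -
  obtain F where "entire_continuation eigenvalue F" using ex_cis_twist_continuation[of 0] by auto
  from entire_continuation_L_series[OF this] show ?thesis by (simp add: L_form_def[abs_def])
qed

end

lemma finite_fourier_expansion:
  fixes \<psi> :: "int \<Rightarrow> complex"
  assumes q: "q > 0" and periodic: "\<And>n. \<psi> (n + int q) = \<psi> n"
  shows "\<psi> n = (\<Sum>b<q. (\<Sum>m<q. \<psi> (int m) * cis (- 2 * pi * (real b * real m / real q))) / of_nat q
               * cis (2 * pi * (of_int n * real b / real q)))"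
proof -
  interpret periodic_fun_simple \<psi> "int q" by unfold_locales (rule periodic)
  define r where "r = nat (n mod int q)"
  have r: "r < q" "int r = n mod int q" using q by (simp_all add: r_def nat_less_iff)
  have "\<psi> n = \<psi> (n mod int q)"
    using plus_of_int[of "n mod int q" "n div int q"] by (simp add: mult.commute)
  also have "\<dots> = (\<Sum>m<q. if m = r then \<psi> (int m) else 0)"
    using r by (subst sum.delta) auto
  also have "\<dots> = (\<Sum>m<q. \<psi> (int m) / of_nat q * (\<Sum>b<q. cis (2 * pi * (of_int (n - int m) * real b / real q))))"
  proof (intro sum.cong refl)
    fix m assume "m \<in> {..<q}"
    hence "int q dvd n - int m \<longleftrightarrow> m = r"
      using r q by (auto simp: mod_eq_dvd_iff[symmetric])
    thus "(if m = r then \<psi> (int m) else 0) =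
        \<psi> (int m) / of_nat q * (\<Sum>b<q. cis (2 * pi * (of_int (n - int m) * real b / real q)))"
      unfolding sum_cis_roots[OF q] using q by simp
  qed
  also have "\<dots> = (\<Sum>m<q. \<Sum>b<q. \<psi> (int m) * cis (- 2 * pi * (real b * real m / real q)) / of_nat q *
      cis (2 * pi * (of_int n * real b / real q)))"
    unfolding sum_distrib_left
    by (intro sum.cong refl) (simp add: cis_mult diff_divide_distrib algebra_simps)
  also have "\<dots> = (\<Sum>b<q. \<Sum>m<q. \<psi> (int m) * cis (- 2 * pi * (real b * real m / real q)) / of_nat q *
      cis (2 * pi * (of_int n * real b / real q)))"
    by (rule sum.swap)
  finally show ?thesis by (simp add: sum_distrib_right sum_divide_distrib)
qed

context hecke_form
begin

lemma ex_periodic_twist_continuation: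
  fixes \<psi> :: "int \<Rightarrow> complex"
  assumes q: "q > 0" and periodic: "\<And>n. \<psi> (n + int q) = \<psi> n"
  shows "\<exists>F. entire_continuation (\<lambda>n. eigenvalue n * \<psi> (int n)) F"
proof -
  have "\<exists>F. entire_continuation (\<lambda>n. eigenvalue n * cis (2 * pi * real n * (real b / real q))) F" for b
    by (intro ex_cis_twist_continuation) auto
  then obtain F where F: "\<And>b. entire_continuation (\<lambda>n. eigenvalue n * cis (2 * pi * real n * (real b / real q)))
      (F b)"
    by metis
  define c where "c = (\<lambda>b. (\<Sum>m<q. \<psi> (int m) * cis (- 2 * pi * (real b * real m / real q))) / of_nat q)"
  have "entire_continuation (\<lambda>n. \<Sum>b<q. c b * (eigenvalue n * cis (2 * pi * real n * (real b / real q))))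
      (\<lambda>s. \<Sum>b<q. c b * F b s)"
    by (intro entire_continuation_sum entire_continuation_cmult F) simp
  moreover have "(\<Sum>b<q. c b * (eigenvalue n * cis (2 * pi * real n * (real b / real q)))) =
      eigenvalue n * \<psi> (int n)" for n
    unfolding finite_fourier_expansion[where \<psi> = \<psi> and n = "int n", OF q periodic] c_def sum_distrib_left
    by (intro sum.cong refl) (simp add: mult_ac)
  ultimately show ?thesis by auto
qed

end

section \<open>Sums over Dirichlet characters to a prime modulus\<close>

lemma gauss_sum_cis: "gauss_sum q \<xi> = (\<Sum>k=1..q - 1. cis (2 * pi * (real k / real q)) * \<xi> (int k))"
  unfolding gauss_sum_def by (intro sum.cong refl) (simp add: cis_conv_exp mult_ac)

lemma cis_mod:
  assumes "q > 0"
  shows "cis (2 * pi * (of_int (n mod int q) / real q)) = cis (2 * pi * (of_int n / real q))"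
proof -
  have "real_of_int (n mod int q) = of_int (n - int q * (n div int q))" by (simp add: minus_mult_div_eq_mod)
  hence "of_int (n mod int q) / real q = of_int n / real q - of_int (n div int q)"
    using assms by (simp add: field_simps)
  hence "2 * pi * (of_int (n mod int q) / real q) = 2 * pi * (of_int n / real q) - 2 * pi * of_int (n div int q)"
    by (simp only: right_diff_distrib)
  hence "cis (2 * pi * (of_int (n mod int q) / real q)) =
      cis (2 * pi * (of_int n / real q)) / cis (2 * pi * of_int (n div int q))"
    by (simp only: cis_divide)
  also have "cis (2 * pi * of_int (n div int q)) = 1"
    using cis_2pi_eq_1_iff[of "of_int (n div int q)"] by simp
  finally show ?thesis by simp
qed

locale prime_modulus =
  fixes q :: nat
  assumes prime: "prime q"
begin

lemma q_gt_1: "q > 1" using prime prime_gt_1_nat by blast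

lemma coprime_iff: "coprime n (int q) \<longleftrightarrow> \<not> int q dvd n"
proof
  assume "coprime n (int q)"
  thus "\<not> int q dvd n" using q_gt_1 coprime_common_divisor[of n "int q" "int q"] by auto
next
  assume "\<not> int q dvd n"
  hence "coprime (int q) n" using prime by (intro prime_imp_coprime) auto
  thus "coprime n (int q)" by (simp add: coprime_commute)
qed

definition "chars = {\<xi>. dirichlet_char q \<xi>}"

lemma finite_chars: "finite chars"
  unfolding chars_def using q_gt_1 by (intro finite_dirichlet_chars) auto

context
  fixes \<xi> assumes \<xi>: "\<xi> \<in> chars"
begin

lemma char_mult: "\<xi> (m * n) = \<xi> m * \<xi> n" using \<xi> by (simp add: chars_def dirichlet_char_def)

lemma char_nonzero_iff: "\<xi> n \<noteq> 0 \<longleftrightarrow> \<not> int q dvd n"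
  using \<xi> by (simp add: chars_def dirichlet_char_def coprime_iff)

lemma char_1: "\<xi> 1 = 1"
proof -
  have "\<xi> 1 \<noteq> 0" using q_gt_1 by (simp add: char_nonzero_iff)
  thus ?thesis using char_mult[of 1 1] by simp
qed

lemma char_power: "\<xi> (n ^ k) = \<xi> n ^ k"
  by (induction k) (simp_all add: char_1 char_mult)

lemma char_cong:
  assumes "[m = n] (mod int q)"
  shows "\<xi> m = \<xi> n"
proof -
  interpret periodic_fun_simple \<xi> "int q"
    using \<xi> by unfold_locales (simp add: chars_def dirichlet_char_def)
  obtain k where "n = m + int q * k" using assms by (auto simp: cong_iff_lin)
  thus ?thesis using plus_of_int[of m k] by (simp add: mult.commute)
qed

lemma char_root_of_unity:
  assumes "\<not> int q dvd n"
  shows "\<xi> n ^ (q - 1) = 1"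
proof -
  define m where "m = nat (n mod int q)"
  have m: "int m = n mod int q" using q_gt_1 by (simp add: m_def)
  hence "\<not> int q dvd int m" using assms by (simp add: dvd_mod_iff)
  hence "[m ^ (q - 1) = 1] (mod q)" using prime by (intro fermat_theorem) auto
  hence "[int m ^ (q - 1) = 1] (mod int q)" by (metis cong_int_iff of_nat_1 of_nat_power)
  moreover have "[n ^ (q - 1) = int m ^ (q - 1)] (mod int q)"
    by (intro cong_pow) (simp add: m cong_def)
  ultimately have "[n ^ (q - 1) = 1] (mod int q)" using cong_trans by blast
  from char_cong[OF this] show ?thesis by (simp add: char_power char_1)
qed

lemma norm_char:
  assumes "\<not> int q dvd n"
  shows "norm (\<xi> n) = 1"
proof -
  have "norm (\<xi> n) ^ (q - 1) = 1 ^ (q - 1)" using char_root_of_unity[OF assms] by (simp flip: norm_power)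
  thus ?thesis by (rule power_eq_imp_eq_base) (use q_gt_1 in auto)
qed

lemma char_minus_1: "\<xi> (- 1) = 1 \<or> \<xi> (- 1) = - 1"
proof -
  have "(\<xi> (- 1))\<^sup>2 = 1" using char_mult[of "-1" "-1"] char_1 by (simp add: power2_eq_square)
  thus ?thesis by (simp add: power2_eq_1_iff)
qed

end

definition "generator = (SOME g. residue_primroot q g)"

lemma residue_primroot_generator: "residue_primroot q generator"
  unfolding generator_def by (rule someI_ex) (use prime_primitive_root_exists[of q] prime q_gt_1 in auto)

lemma generator_power_not_dvd: "\<not> int q dvd int generator ^ k"
proof -
  have "coprime (int generator) (int q)"
    using residue_primroot_generator by (simp add: residue_primroot_def coprime_commute)
  hence "coprime (int generator ^ k) (int q)" by simp
  thus ?thesis using coprime_iff by blast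
qed

lemma ex1_discrete_log:
  assumes "\<not> int q dvd n"
  shows "\<exists>!i. i < q - 1 \<and> [int generator ^ i = n] (mod int q)"
proof -
  define m where "m = nat (n mod int q)"
  have m: "int m = n mod int q" using q_gt_1 by (simp add: m_def)
  have "m \<noteq> 0" using assms m by (metis dvd_eq_mod_eq_0 of_nat_0)
  moreover have "int m < int q" unfolding m using q_gt_1 by simp
  ultimately have "m \<in> totatives q" using prime by (auto simp: totatives_prime)
  moreover have "bij_betw (\<lambda>i. generator ^ i mod q) {..<q - 1} (totatives q)"
    using residue_primroot_is_generator[OF q_gt_1 residue_primroot_generator] prime by (simp add: totient_prime)
  ultimately have inj: "inj_on (\<lambda>i. generator ^ i mod q) {..<q - 1}" and "m \<in> (\<lambda>i. generator ^ i mod q) ` {..<q - 1}"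
    by (simp_all add: bij_betw_def)
  then obtain i where i: "i < q - 1" "generator ^ i mod q = m" by (elim imageE) simp
  have "[int generator ^ i = n] (mod int q) \<longleftrightarrow> int (generator ^ i mod q) = int m" for i
    unfolding cong_def m by (simp add: zmod_int)
  hence cong_iff: "[int generator ^ i = n] (mod int q) \<longleftrightarrow> generator ^ i mod q = m" for i by simp
  show ?thesis unfolding cong_iff
  proof (rule ex1I[of _ i])
    show "k = i" if "k < q - 1 \<and> generator ^ k mod q = m" for k
      using inj_onD[OF inj, of k i] that i by simp
  qed (use i in simp)
qed

definition "discrete_log n = (THE i. i < q - 1 \<and> [int generator ^ i = n] (mod int q))"

lemma discrete_log:
  assumes "\<not> int q dvd n"
  shows "discrete_log n < q - 1" "[int generator ^ discrete_log n = n] (mod int q)"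
  using theI'[OF ex1_discrete_log[OF assms], folded discrete_log_def] by blast+

lemma discrete_log_unique:
  assumes "i < q - 1" "[int generator ^ i = n] (mod int q)"
  shows "discrete_log n = i"
proof -
  have "\<not> int q dvd n" using assms(2) generator_power_not_dvd[of i] by (metis cong_dvd_iff)
  from ex1_discrete_log[OF this] discrete_log[OF this] assms show ?thesis by blast
qed

lemma discrete_log_mult:
  assumes "\<not> int q dvd m" "\<not> int q dvd n"
  shows "[discrete_log (m * n) = discrete_log m + discrete_log n] (mod (q - 1))"
proof -
  define i where "i = discrete_log m + discrete_log n"
  have fermat: "[int generator ^ (q - 1) = 1] (mod int q)"
    using fermat_theorem[of q generator] prime generator_power_not_dvd[of 1]
    by (metis cong_int_iff int_dvd_int_iff of_nat_1 of_nat_power power_one_right)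
  have "[(int generator ^ (q - 1)) ^ (i div (q - 1)) * int generator ^ (i mod (q - 1)) =
         1 ^ (i div (q - 1)) * int generator ^ (i mod (q - 1))] (mod int q)"
    by (intro cong_mult cong_pow fermat cong_refl)
  hence "[int generator ^ i = int generator ^ (i mod (q - 1))] (mod int q)"
    by (simp flip: power_mult power_add)
  moreover have "[int generator ^ i = m * n] (mod int q)"
    unfolding i_def power_add by (intro cong_mult discrete_log assms)
  ultimately have "discrete_log (m * n) = i mod (q - 1)"
    using q_gt_1 by (intro discrete_log_unique) (auto intro: cong_trans cong_sym)
  thus ?thesis by (simp add: i_def cong_def)
qed

definition char_of_root :: "complex \<Rightarrow> int \<Rightarrow> complex" where
  "char_of_root z n = (if int q dvd n then 0 else z ^ discrete_log n)"

lemma power_root_of_unity_cong: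
  fixes z :: complex
  assumes "z ^ (q - 1) = 1" "[i = j] (mod (q - 1))"
  shows "z ^ i = z ^ j"
proof -
  have "z ^ i = z ^ (i mod (q - 1))" for i
    by (metis assms(1) mult_div_mod_eq power_add power_mult power_one mult_1)
  thus ?thesis using assms(2) by (metis cong_def)
qed

lemma char_of_root_in_chars:
  assumes z: "z ^ (q - 1) = 1"
  shows "char_of_root z \<in> chars"
proof -
  have "z \<noteq> 0" using z q_gt_1 by (auto simp: power_0_left)
  hence "char_of_root z n \<noteq> 0 \<longleftrightarrow> coprime n (int q)" for n
    by (simp add: char_of_root_def coprime_iff)
  moreover have "char_of_root z (m * n) = char_of_root z m * char_of_root z n" for m n
  proof (cases "int q dvd m \<or> int q dvd n")
    case False
    hence "\<not> int q dvd m * n" using prime by (simp add: prime_dvd_mult_iff)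
    moreover have "z ^ discrete_log (m * n) = z ^ (discrete_log m + discrete_log n)"
      using False by (intro power_root_of_unity_cong z discrete_log_mult) auto
    ultimately show ?thesis using False by (simp add: char_of_root_def power_add)
  qed (auto simp: char_of_root_def)
  moreover have "char_of_root z (n + int q) = char_of_root z n" for n
  proof -
    have "discrete_log (n + int q) = discrete_log n" by (simp add: discrete_log_def cong_def)
    thus ?thesis by (simp add: char_of_root_def)
  qed
  ultimately show ?thesis unfolding chars_def dirichlet_char_def by blast
qed

lemma char_of_root_char:
  assumes "\<xi> \<in> chars"
  shows "char_of_root (\<xi> (int generator)) = \<xi>"
proof
  fix n
  show "char_of_root (\<xi> (int generator)) n = \<xi> n"
  proof (cases "int q dvd n")
    case False
    from char_cong[OF assms discrete_log(2)[OF False]] char_power[OF assms, of "int generator" "discrete_log n"]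
    show ?thesis using False by (simp add: char_of_root_def)
  qed (use char_nonzero_iff[OF assms, of n] in \<open>simp add: char_of_root_def\<close>)
qed

lemma char_of_root_generator:
  assumes z: "z ^ (q - 1) = 1"
  shows "char_of_root z (int generator) = z"
proof (cases "q = 2")
  case True
  hence "z = 1" using z by simp
  thus ?thesis using generator_power_not_dvd[of 1] by (simp add: char_of_root_def)
next
  case False
  hence "discrete_log (int generator) = 1" using q_gt_1 by (intro discrete_log_unique) auto
  thus ?thesis using generator_power_not_dvd[of 1] by (simp add: char_of_root_def)
qed

lemma bij_betw_chars_roots: "bij_betw (\<lambda>\<xi>. \<xi> (int generator)) chars {z. z ^ (q - 1) = 1}"
proof (rule bij_betw_byWitness[where f' = char_of_root])
  show "(\<lambda>\<xi>. \<xi> (int generator)) ` chars \<subseteq> {z. z ^ (q - 1) = 1}"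
    using char_root_of_unity generator_power_not_dvd[of 1] by auto
qed (auto simp: char_of_root_char char_of_root_generator char_of_root_in_chars)

lemma sum_chars:
  assumes m: "\<not> int q dvd m"
  shows "(\<Sum>\<xi>\<in>chars. \<xi> m) = (if [m = 1] (mod int q) then of_nat (q - 1) else 0)"
proof -
  have pos: "q - 1 > 0" using q_gt_1 by simp
  have "(\<Sum>\<xi>\<in>chars. \<xi> m) = (\<Sum>\<xi>\<in>chars. char_of_root (\<xi> (int generator)) m)"
    by (intro sum.cong refl) (simp add: char_of_root_char)
  also have "\<dots> = (\<Sum>z | z ^ (q - 1) = 1. char_of_root z m)"
    by (rule sum.reindex_bij_betw[OF bij_betw_chars_roots])
  also have "\<dots> = (\<Sum>z | z ^ (q - 1) = 1. z ^ discrete_log m)" using m by (simp add: char_of_root_def)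
  also have "\<dots> = (\<Sum>k<q - 1. cis (2 * pi * real k / real (q - 1)) ^ discrete_log m)"
    by (rule sum.reindex_bij_betw[OF Complex.bij_betw_roots_unity[OF pos], symmetric])
  also have "\<dots> = (\<Sum>k<q - 1. cis (2 * pi * (of_int (int (discrete_log m)) * real k / real (q - 1))))"
    by (simp add: Complex.DeMoivre mult_ac)
  also have "\<dots> = (if int (q - 1) dvd int (discrete_log m) then of_nat (q - 1) else 0)"
    by (rule sum_cis_roots[OF pos])
  also have "int (q - 1) dvd int (discrete_log m) \<longleftrightarrow> discrete_log m = 0"
    unfolding int_dvd_int_iff using discrete_log(1)[OF m] by (auto dest: dvd_imp_le)
  also have "discrete_log m = 0 \<longleftrightarrow> [m = 1] (mod int q)"
    using discrete_log(2)[OF m] discrete_log_unique[of 0 m] pos by (auto simp: cong_sym_eq)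
  finally show ?thesis .
qed

lemma sum_chars_mult_cnj:
  "(\<Sum>\<xi>\<in>chars. \<xi> m * cnj (\<xi> n)) = (if [m = n] (mod int q) \<and> \<not> int q dvd n then of_nat (q - 1) else 0)"
proof (cases "int q dvd m \<or> int q dvd n")
  case True
  hence "\<xi> m * cnj (\<xi> n) = 0" if "\<xi> \<in> chars" for \<xi>
    using char_nonzero_iff[OF that, of m] char_nonzero_iff[OF that, of n] by auto
  hence "(\<Sum>\<xi>\<in>chars. \<xi> m * cnj (\<xi> n)) = 0" by (intro sum.neutral ballI)
  moreover have "\<not> ([m = n] (mod int q) \<and> \<not> int q dvd n)" using True by (metis cong_dvd_iff)
  ultimately show ?thesis by auto
next
  case False
  then obtain n' where n': "[n * n' = 1] (mod int q)"
    using cong_solve_coprime_int[of n "int q"] coprime_iff by blast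
  have "\<not> int q dvd n * n'" using cong_dvd_iff[OF n'] q_gt_1 by simp
  hence "\<not> int q dvd n'" by auto
  have "cnj (\<xi> n) = \<xi> n'" if "\<xi> \<in> chars" for \<xi>
  proof -
    have "\<xi> n * \<xi> n' = 1" using char_cong[OF that n'] char_mult[OF that] char_1[OF that] by simp
    moreover have "\<xi> n * cnj (\<xi> n) = 1"
      using norm_char[OF that] False complex_norm_square[of "\<xi> n"] by simp
    ultimately show ?thesis using char_nonzero_iff[OF that, of n] False by (metis mult_left_cancel)
  qed
  hence "(\<Sum>\<xi>\<in>chars. \<xi> m * cnj (\<xi> n)) = (\<Sum>\<xi>\<in>chars. \<xi> (m * n'))"
    by (intro sum.cong refl) (simp add: char_mult)
  also have "\<dots> = (if [m * n' = 1] (mod int q) then of_nat (q - 1) else 0)"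
    using False \<open>\<not> int q dvd n'\<close> prime by (intro sum_chars) (simp add: prime_dvd_mult_iff)
  also have "[m * n' = 1] (mod int q) \<longleftrightarrow> [m * n' = n * n'] (mod int q)"
    using n' by (metis cong_sym cong_trans)
  also have "\<dots> \<longleftrightarrow> [m = n] (mod int q)"
    using \<open>\<not> int q dvd n'\<close> by (intro cong_mult_rcancel) (simp add: coprime_iff)
  finally show ?thesis using False by simp
qed

lemma sum_gauss_sum_mult_cnj:
  "(\<Sum>\<xi>\<in>chars. gauss_sum q \<xi> * cnj (\<xi> n)) =
     (if int q dvd n then 0 else of_nat (q - 1) * cis (2 * pi * (of_int n / real q)))"
proof -
  define r where "r = nat (n mod int q)"
  have r: "int r = n mod int q" using q_gt_1 by (simp add: r_def)
  have "(\<Sum>\<xi>\<in>chars. gauss_sum q \<xi> * cnj (\<xi> n)) =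
        (\<Sum>k=1..q - 1. \<Sum>\<xi>\<in>chars. cis (2 * pi * (real k / real q)) * (\<xi> (int k) * cnj (\<xi> n)))"
    unfolding gauss_sum_cis sum_distrib_right mult.assoc by (rule sum.swap)
  also have "\<dots> = (\<Sum>k=1..q - 1. if k = r then (if int q dvd n then 0 else of_nat (q - 1) *
      cis (2 * pi * (real k / real q))) else 0)"
    unfolding sum_distrib_left[symmetric] sum_chars_mult_cnj
  proof (intro sum.cong refl)
    fix k assume "k \<in> {1..q - 1}"
    hence "[int k = n] (mod int q) \<longleftrightarrow> k = r" unfolding cong_def r[symmetric] by (subst mod_pos_pos_trivial) auto
    thus "cis (2 * pi * (real k / real q)) * (if [int k = n] (mod int q) \<and> \<not> int q dvd n then of_nat (q - 1) else 0) =
        (if k = r then (if int q dvd n then 0 else of_nat (q - 1) * cis (2 * pi * (real k / real q))) else 0)"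
      by auto
  qed
  also have "\<dots> = (if int q dvd n then 0 else of_nat (q - 1) * cis (2 * pi * (real r / real q)))"
  proof (cases "int q dvd n")
    case False
    hence "r \<noteq> 0" using r by (metis dvd_eq_mod_eq_0 of_nat_0)
    moreover have "int r < int q" unfolding r using q_gt_1 by simp
    ultimately have "r \<in> {1..q - 1}" by auto
    thus ?thesis by (simp add: sum.delta)
  qed simp
  also have "cis (2 * pi * (real r / real q)) = cis (2 * pi * (of_int n / real q))"
    using cis_mod[of q n] q_gt_1 by (simp flip: r)
  finally show ?thesis .
qed

definition "principal_char = (\<lambda>n. if int q dvd n then 0 else 1 :: complex)"

lemma principal_char_in_chars: "principal_char \<in> chars"
proof -
  have "principal_char = char_of_root 1" by (simp add: principal_char_def char_of_root_def fun_eq_iff)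
  thus ?thesis using char_of_root_in_chars[of 1] by simp
qed

lemma dirichlet_char_1:
  assumes "dirichlet_char 1 \<psi>"
  shows "\<psi> n = 1"
proof -
  interpret periodic_fun_simple' \<psi>
    using assms by unfold_locales (simp add: dirichlet_char_def)
  have "\<psi> (0 * 0) = \<psi> 0 * \<psi> 0" "\<psi> 0 \<noteq> 0" using assms unfolding dirichlet_char_def by (blast, simp)
  hence "\<psi> 0 = 1" by simp
  thus ?thesis using plus_of_int[of 0 n] by simp
qed

lemma primitive_char_iff: "primitive_char q \<xi> \<longleftrightarrow> \<xi> \<in> chars \<and> \<xi> \<noteq> principal_char"
proof
  assume "primitive_char q \<xi>"
  moreover have "dirichlet_char 1 (\<lambda>_. 1)" by (simp add: dirichlet_char_def)
  ultimately have "\<not> (\<forall>n. coprime n (int q) \<longrightarrow> \<xi> n = 1)"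
    using q_gt_1 unfolding primitive_char_def by (metis one_dvd)
  hence "\<xi> \<noteq> principal_char" by (auto simp: principal_char_def coprime_iff)
  with \<open>primitive_char q \<xi>\<close> show "\<xi> \<in> chars \<and> \<xi> \<noteq> principal_char" by (simp add: primitive_char_def chars_def)
next
  assume \<xi>: "\<xi> \<in> chars \<and> \<xi> \<noteq> principal_char"
  have False if d: "d dvd q" "d < q" and \<psi>: "dirichlet_char d \<psi>" "\<And>n. coprime n (int q) \<Longrightarrow> \<xi> n = \<psi> n" for d \<psi>
  proof -
    have "d = 1" using d prime by (auto simp: prime_nat_iff)
    hence "\<xi> n = principal_char n" for n
      using \<psi>(2)[of n] dirichlet_char_1[of \<psi> n] \<psi>(1) char_nonzero_iff[of \<xi> n] \<xi>
      by (auto simp: principal_char_def coprime_iff)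
    with \<xi> show False by blast
  qed
  thus "primitive_char q \<xi>" using \<xi> by (auto simp: primitive_char_def chars_def)
qed

lemma gauss_sum_principal_char: "gauss_sum q principal_char = - 1"
proof -
  have "gauss_sum q principal_char = (\<Sum>k=1..q - 1. cis (2 * pi * (of_int 1 * real k / real q)))"
    unfolding gauss_sum_cis
  proof (intro sum.cong refl)
    fix k assume "k \<in> {1..q - 1}"
    hence "\<not> int q dvd int k" by (auto dest: dvd_imp_le)
    thus "cis (2 * pi * (real k / real q)) * principal_char (int k) = cis (2 * pi * (of_int 1 * real k / real q))"
      by (simp add: principal_char_def)
  qed
  also have "\<dots> = (\<Sum>k<q. cis (2 * pi * (of_int 1 * real k / real q))) - 1"
  proof -
    have "{..<q} = insert 0 {1..q - 1}" using q_gt_1 by auto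
    thus ?thesis by simp
  qed
  also have "(\<Sum>k<q. cis (2 * pi * (of_int 1 * real k / real q))) = 0"
    using q_gt_1 by (subst sum_cis_roots) auto
  finally show ?thesis by simp
qed

lemma additive_weight_multiple:
  assumes "q dvd n"
  shows "additive_weight \<nu> (1 / real q) n = 1 + \<nu>"
proof -
  have "real n * (1 / real q) \<in> \<int>" using assms q_gt_1 by (auto simp: dvd_def)
  hence "cis (2 * pi * (real n * (1 / real q))) = 1" "cis (2 * pi * (- (real n * (1 / real q)))) = 1"
    by (simp_all only: cis_2pi_eq_1_iff Ints_minus)
  thus ?thesis by (simp add: additive_weight_def)
qed

lemma sum_gauss_sum_parity:
  assumes \<nu>: "\<nu> = 1 \<or> \<nu> = - 1"
  shows "(\<Sum>\<xi>\<in>{\<xi>\<in>chars. \<xi> (- 1) = \<nu>}. gauss_sum q \<xi> * cnj (\<xi> (int n))) =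
     of_nat (q - 1) / 2 * (additive_weight \<nu> (1 / real q) n - (if q dvd n then 1 + \<nu> else 0))"
proof -
  have "(\<Sum>\<xi>\<in>{\<xi>\<in>chars. \<xi> (- 1) = \<nu>}. gauss_sum q \<xi> * cnj (\<xi> (int n))) =
        (\<Sum>\<xi>\<in>chars. if \<xi> (- 1) = \<nu> then gauss_sum q \<xi> * cnj (\<xi> (int n)) else 0)"
    using finite_chars by (intro sum.inter_filter)
  also have "\<dots> = (\<Sum>\<xi>\<in>chars. 1 / 2 * (gauss_sum q \<xi> * cnj (\<xi> (int n))) + \<nu> / 2 * (gauss_sum q \<xi> * cnj (\<xi> (- int n))))"
  proof (intro sum.cong refl)
    fix \<xi> assume \<xi>: "\<xi> \<in> chars"
    have "\<xi> (- int n) = \<xi> (- 1) * \<xi> (int n)" using char_mult[OF \<xi>, of "-1" "int n"] by simp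
    thus "(if \<xi> (- 1) = \<nu> then gauss_sum q \<xi> * cnj (\<xi> (int n)) else 0) =
       1 / 2 * (gauss_sum q \<xi> * cnj (\<xi> (int n))) + \<nu> / 2 * (gauss_sum q \<xi> * cnj (\<xi> (- int n)))"
      using char_minus_1[OF \<xi>] \<nu> by auto
  qed
  also have "\<dots> = 1 / 2 * (\<Sum>\<xi>\<in>chars. gauss_sum q \<xi> * cnj (\<xi> (int n))) + \<nu> / 2 *
      (\<Sum>\<xi>\<in>chars. gauss_sum q \<xi> * cnj (\<xi> (- int n)))"
    by (simp only: sum.distrib sum_distrib_left)
  also have "\<dots> = (if q dvd n then 0 else of_nat (q - 1) / 2 * additive_weight \<nu> (1 / real q) n)"
    unfolding sum_gauss_sum_mult_cnj by (auto simp: additive_weight_def field_simps)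
  finally show ?thesis using additive_weight_multiple[of n \<nu>] by simp
qed

lemma sum_even_primitive_chars:
  "(\<Sum>\<xi>\<in>even_primitive_chars q. gauss_sum q \<xi> * conj_char \<xi> (int n)) =
     of_nat (q - 1) / 2 * additive_weight 1 (1 / real q) n + 1 - (if q dvd n then of_nat q else 0)"
proof -
  have "even_primitive_chars q = {\<xi>\<in>chars. \<xi> (- 1) = 1} - {principal_char}"
    by (auto simp: even_primitive_chars_def primitive_char_iff)
  moreover have "principal_char \<in> {\<xi>\<in>chars. \<xi> (- 1) = 1}"
    using principal_char_in_chars q_gt_1 by (simp add: principal_char_def)
  ultimately have "(\<Sum>\<xi>\<in>even_primitive_chars q. gauss_sum q \<xi> * conj_char \<xi> (int n)) =
     (\<Sum>\<xi>\<in>{\<xi>\<in>chars. \<xi> (- 1) = 1}. gauss_sum q \<xi> * cnj (\<xi> (int n))) - gauss_sum q principal_char *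
       cnj (principal_char (int n))"
    unfolding conj_char_def using finite_chars by (simp add: sum_diff1)
  also have "\<dots> = of_nat (q - 1) / 2 * additive_weight 1 (1 / real q) n + 1 - (if q dvd n then of_nat q else 0)"
    unfolding gauss_sum_principal_char sum_gauss_sum_parity[OF disjI1[OF refl]] using q_gt_1
    by (simp add: principal_char_def of_nat_diff field_simps)
  finally show ?thesis .
qed

lemma sum_odd_primitive_chars:
  "(\<Sum>\<xi>\<in>odd_primitive_chars q. gauss_sum q \<xi> * conj_char \<xi> (int n)) =
     of_nat (q - 1) / 2 * additive_weight (- 1) (1 / real q) n"
proof -
  have "principal_char (- 1) = 1" using q_gt_1 by (simp add: principal_char_def)
  hence "odd_primitive_chars q = {\<xi>\<in>chars. \<xi> (- 1) = - 1}"
    by (auto simp: odd_primitive_chars_def primitive_char_iff)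
  thus ?thesis unfolding conj_char_def using sum_gauss_sum_parity[of "-1" n] by simp
qed

end

section \<open>Expansion of the additive twists at the central point\<close>

lemma vector_taylor_bound:
  fixes D :: "nat \<Rightarrow> real \<Rightarrow> 'a :: real_normed_vector"
  assumes "\<And>k u. (D k has_vector_derivative D (Suc k) u) (at u)"
    and "\<And>u. \<bar>u\<bar> \<le> \<bar>x\<bar> \<Longrightarrow> norm (D K u) \<le> B"
  shows "norm (D 0 x - (\<Sum>k<K. (x ^ k / fact k) *\<^sub>R D k 0)) \<le> B * \<bar>x\<bar> ^ K"
  using assms
proof (induction K arbitrary: D x)
  case (Suc K)
  define g where "g = (\<lambda>u. D 0 u - (\<Sum>k<Suc K. (u ^ k / fact k) *\<^sub>R D k 0))"
  define g' where "g' = (\<lambda>u. D 1 u - (\<Sum>k<K. (u ^ k / fact k) *\<^sub>R D (Suc k) 0))"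
  have g_eq: "g u = D 0 u - (D 0 0 + (\<Sum>k<K. (u ^ Suc k / fact (Suc k)) *\<^sub>R D (Suc k) 0))" for u
    by (simp add: g_def sum.lessThan_Suc_shift del: sum.lessThan_Suc fact_Suc)
  have "((\<lambda>u. u ^ Suc k / fact (Suc k)) has_real_derivative u ^ k / fact k) (at u)" for k and u :: real
    using DERIV_cdivide[OF DERIV_pow[of "Suc k" u], of "fact (Suc k)"] by (simp del: of_nat_Suc)
  hence term_deriv: "((\<lambda>u. (u ^ Suc k / fact (Suc k)) *\<^sub>R D (Suc k) 0) has_vector_derivative (u ^ k / fact k)
      *\<^sub>R D (Suc k) 0) (at u)" for k u
    using has_vector_derivative_scaleR[OF _ has_vector_derivative_const] by fastforce
  have "(g has_vector_derivative D (Suc 0) u - (0 + (\<Sum>k<K. (u ^ k / fact k) *\<^sub>R D (Suc k) 0))) (at u)" for u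
    unfolding g_eq[abs_def]
    by (intro has_vector_derivative_diff has_vector_derivative_add has_vector_derivative_sum
      has_vector_derivative_const
          Suc.prems(1) term_deriv)
  hence g: "(g has_derivative (\<lambda>h. h *\<^sub>R g' u)) (at u within {- \<bar>x\<bar>..\<bar>x\<bar>})" for u
    by (simp add: g'_def has_vector_derivative_def has_derivative_at_withinI)
  have "onorm (\<lambda>h. h *\<^sub>R g' u) \<le> B * \<bar>x\<bar> ^ K" if u: "u \<in> {- \<bar>x\<bar>..\<bar>x\<bar>}" for u
  proof (rule onorm_le)
    have B: "B \<ge> 0" using Suc.prems(2)[of 0] norm_ge_zero[of "D (Suc K) 0"] by linarith
    have "norm (g' u) \<le> B * \<bar>u\<bar> ^ K"
      unfolding g'_def One_nat_def using u by (intro Suc.IH Suc.prems) auto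
    also have "\<dots> \<le> B * \<bar>x\<bar> ^ K" using u B by (intro mult_left_mono power_mono) auto
    finally show "norm (h *\<^sub>R g' u) \<le> B * \<bar>x\<bar> ^ K * norm h" for h
      by (simp add: mult.commute[of _ "\<bar>h\<bar>"] mult_left_mono)
  qed
  from differentiable_bound[OF _ g this, of x 0]
  have "norm (g x - g 0) \<le> B * \<bar>x\<bar> ^ K * norm (x - 0)" by (auto simp: minus_le_iff abs_ge_minus_self)
  moreover have "g 0 = 0" unfolding g_eq by simp
  ultimately show ?case by (simp add: g_def mult_ac)
qed simp

lemma integral_reflect_line:
  fixes \<phi> :: "real \<Rightarrow> complex"
  shows "(\<integral>t. \<phi> (c - t) \<partial>lborel) = (\<integral>t. \<phi> t \<partial>lborel)"
  using lborel_integral_real_affine[of "-1" \<phi> c] by simp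

definition power_expansion :: "(nat \<Rightarrow> real) \<Rightarrow> (nat \<Rightarrow> complex) \<Rightarrow> (nat \<Rightarrow> complex) \<Rightarrow> bool" where
  "power_expansion u F c \<longleftrightarrow>
     (\<forall>K. \<exists>C. \<forall>q>0. norm (F q - (\<Sum>k<K. c k * of_real (u q ^ k))) \<le> C * u q ^ K)"

lemma power_expansion_cong:
  assumes "\<And>q. q > 0 \<Longrightarrow> F q = G q"
  shows "power_expansion u F c \<longleftrightarrow> power_expansion u G c"
  unfolding power_expansion_def using assms by simp

lemma power_expansion_add:
  assumes F: "power_expansion u F c" and G: "power_expansion u G d"
  shows "power_expansion u (\<lambda>q. F q + G q) (\<lambda>k. c k + d k)"
  unfolding power_expansion_def
proof
  fix K
  obtain C where C: "\<And>q. q > 0 \<Longrightarrow> norm (F q - (\<Sum>k<K. c k * of_real (u q ^ k))) \<le> C * u q ^ K"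
    using F unfolding power_expansion_def by blast
  obtain D where D: "\<And>q. q > 0 \<Longrightarrow> norm (G q - (\<Sum>k<K. d k * of_real (u q ^ k))) \<le> D * u q ^ K"
    using G unfolding power_expansion_def by blast
  have "norm (F q + G q - (\<Sum>k<K. (c k + d k) * of_real (u q ^ k))) \<le> (C + D) * u q ^ K" if "q > 0" for q
  proof -
    have "F q + G q - (\<Sum>k<K. (c k + d k) * of_real (u q ^ k)) =
        (F q - (\<Sum>k<K. c k * of_real (u q ^ k))) + (G q - (\<Sum>k<K. d k * of_real (u q ^ k)))"
      by (simp add: distrib_right sum.distrib)
    thus ?thesis using norm_triangle_le[OF add_mono[OF C[OF that] D[OF that]]] by (simp only: distrib_right)
  qed
  thus "\<exists>C. \<forall>q>0. norm (F q + G q - (\<Sum>k<K. (c k + d k) * of_real (u q ^ k))) \<le> C * u q ^ K" by blast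
qed

lemma power_expansion_cmult:
  assumes F: "power_expansion u F c"
  shows "power_expansion u (\<lambda>q. a * F q) (\<lambda>k. a * c k)"
  unfolding power_expansion_def
proof
  fix K
  obtain C where C: "\<And>q. q > 0 \<Longrightarrow> norm (F q - (\<Sum>k<K. c k * of_real (u q ^ k))) \<le> C * u q ^ K"
    using F unfolding power_expansion_def by blast
  have "norm (a * F q - (\<Sum>k<K. a * c k * of_real (u q ^ k))) \<le> norm a * C * u q ^ K" if "q > 0" for q
    using mult_left_mono[OF C[OF that], of "norm a"]
    by (simp add: norm_mult[symmetric] right_diff_distrib sum_distrib_left mult.assoc)
  thus "\<exists>C. \<forall>q>0. norm (a * F q - (\<Sum>k<K. a * c k * of_real (u q ^ k))) \<le> C * u q ^ K" by blast
qed

lemma power_expansion_const: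
  assumes u: "\<And>q. q > 0 \<Longrightarrow> u q \<ge> 0"
  shows "power_expansion u (\<lambda>q. a) (\<lambda>k. if k = 0 then a else 0)"
  unfolding power_expansion_def
proof
  fix K
  have "(\<Sum>k<K. (if k = 0 then a else 0) * of_real (u q ^ k)) = (if K = 0 then 0 else a)" for q
    by (simp add: if_distrib[of "\<lambda>x. x * _"] sum.delta cong: if_cong)
  thus "\<exists>C. \<forall>q>0. norm (a - (\<Sum>k<K. (if k = 0 then a else 0) * of_real (u q ^ k))) \<le> C * u q ^ K"
    using u by (intro exI[of _ "norm a"]) auto
qed

lemma power_expansion_divide:
  assumes u: "\<And>q. q > 0 \<Longrightarrow> u q > 0" and F: "power_expansion u F c" and "c 0 = 0"
  shows "power_expansion u (\<lambda>q. F q / of_real (u q)) (\<lambda>k. c (Suc k))"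
  unfolding power_expansion_def
proof
  fix K
  obtain C where C: "\<And>q. q > 0 \<Longrightarrow> norm (F q - (\<Sum>k<Suc K. c k * of_real (u q ^ k))) \<le> C * u q ^ Suc K"
    using F unfolding power_expansion_def by blast
  have "norm (F q / of_real (u q) - (\<Sum>k<K. c (Suc k) * of_real (u q ^ k))) \<le> C * u q ^ K" if q: "q > 0" for q
  proof -
    have "(\<Sum>k<Suc K. c k * of_real (u q ^ k)) = of_real (u q) * (\<Sum>k<K. c (Suc k) * of_real (u q ^ k))"
      using \<open>c 0 = 0\<close> by (simp add: sum.lessThan_Suc_shift sum_distrib_left mult_ac del: sum.lessThan_Suc)
    hence "F q / of_real (u q) - (\<Sum>k<K. c (Suc k) * of_real (u q ^ k)) =
        (F q - (\<Sum>k<Suc K. c k * of_real (u q ^ k))) / of_real (u q)"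
      using u[OF q] by (simp add: field_simps)
    hence "norm (F q / of_real (u q) - (\<Sum>k<K. c (Suc k) * of_real (u q ^ k))) =
        norm (F q - (\<Sum>k<Suc K. c k * of_real (u q ^ k))) / u q"
      using u[OF q] by (simp only: norm_divide norm_of_real abs_of_pos)
    also have "\<dots> \<le> C * u q ^ Suc K / u q" using C[OF q] u[OF q] by (intro divide_right_mono) auto
    finally show ?thesis using u[OF q] by simp
  qed
  thus "\<exists>C. \<forall>q>0. norm (F q / of_real (u q) - (\<Sum>k<K. c (Suc k) * of_real (u q ^ k))) \<le> C * u q ^ K" by blast
qed

lemma power_expansion_mult:
  assumes u: "\<And>q. q > 0 \<Longrightarrow> 0 < u q \<and> u q \<le> 1" and F: "power_expansion u F c"
  shows "power_expansion u (\<lambda>q. of_real (u q) * F q) (\<lambda>k. case k of 0 \<Rightarrow> 0 | Suc k \<Rightarrow> c k)"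
  unfolding power_expansion_def
proof
  fix K
  obtain C where C: "\<And>q. q > 0 \<Longrightarrow> norm (F q - (\<Sum>k<K - 1. c k * of_real (u q ^ k))) \<le> C * u q ^ (K - 1)"
    using F unfolding power_expansion_def by blast
  have "norm (of_real (u q) * F q - (\<Sum>k<K. (case k of 0 \<Rightarrow> 0 | Suc k \<Rightarrow> c k) * of_real (u q ^ k))) \<le> C * u q ^ K"
    if q: "q > 0" for q
  proof -
    have scaled_remainder: "u q * norm (F q - (\<Sum>k<K - 1. c k * of_real (u q ^ k))) \<le> u q * (C * u q ^ (K - 1))"
      using C[OF q] u[OF q] by (intro mult_left_mono) auto
    show ?thesis
    proof (cases K)
      case 0
      have "norm (F q) \<le> C" using C[OF q] 0 by simp
      hence "u q * norm (F q) \<le> 1 * C" using u[OF q] by (intro mult_mono) auto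
      thus ?thesis using 0 u[OF q] by (simp add: norm_mult)
    next
      case (Suc K')
      have "of_real (u q) * F q - (\<Sum>k<K. (case k of 0 \<Rightarrow> 0 | Suc k \<Rightarrow> c k) * of_real (u q ^ k)) =
          of_real (u q) * (F q - (\<Sum>k<K - 1. c k * of_real (u q ^ k)))"
        by (simp add: Suc sum.lessThan_Suc_shift sum_distrib_left right_diff_distrib mult_ac del: sum.lessThan_Suc)
      thus ?thesis using scaled_remainder u[OF q] by (simp add: Suc norm_mult mult_ac)
    qed
  qed
  thus "\<exists>C. \<forall>q>0. norm (of_real (u q) * F q - (\<Sum>k<K. (case k of 0 \<Rightarrow> 0 | Suc k \<Rightarrow> c k) * of_real (u q ^ k))) \<le>
      C * u q ^ K"
    by blast
qed

lemma power_expansion_square: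
  assumes u: "\<And>q. q > 0 \<Longrightarrow> 0 < u q \<and> u q \<le> 1" and F: "power_expansion (\<lambda>q. (u q)\<^sup>2) F c"
  shows "power_expansion u F (\<lambda>k. if even k then c (k div 2) else 0)"
  unfolding power_expansion_def
proof
  fix K :: nat
  define L where "L = (K + 1) div 2"
  have L: "K \<le> 2 * L" by (simp add: L_def)
  obtain C where C: "\<And>q. q > 0 \<Longrightarrow> norm (F q - (\<Sum>k<L. c k * of_real ((u q)\<^sup>2 ^ k))) \<le> C * (u q)\<^sup>2 ^ L"
    using F unfolding power_expansion_def by blast
  have sum_even: "(\<Sum>k<K. (if even k then c (k div 2) else 0) * of_real (u q ^ k)) =
      (\<Sum>k<L. c k * of_real ((u q)\<^sup>2 ^ k))" for q
    unfolding L_def by (induction K) (auto simp: power_mult[symmetric] elim!: evenE oddE)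
  have "norm (F q - (\<Sum>k<K. (if even k then c (k div 2) else 0) * of_real (u q ^ k))) \<le> \<bar>C\<bar> * u q ^ K"
    if q: "q > 0" for q
  proof -
    have "norm (F q - (\<Sum>k<L. c k * of_real ((u q)\<^sup>2 ^ k))) \<le> C * u q ^ (2 * L)"
      using C[OF q] by (simp add: power_mult)
    also have "\<dots> \<le> \<bar>C\<bar> * u q ^ K"
      using u[OF q] L by (intro mult_mono power_decreasing) auto
    finally show ?thesis unfolding sum_even .
  qed
  thus "\<exists>C. \<forall>q>0. norm (F q - (\<Sum>k<K. (if even k then c (k div 2) else 0) * of_real (u q ^ k))) \<le> C * u q ^ K" by blast
qed

context hecke_form
begin

lemma rapid_scaled_deriv_axis: "rapid (scaled_deriv k 0)"
  unfolding rapid_def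
proof (intro conjI allI continuous_on_scaled_deriv)
  fix m :: nat
  obtain C where "\<And>x t. \<bar>x\<bar> \<le> exp t \<Longrightarrow> norm (scaled_deriv k x t) \<le> C * exp (- real m * \<bar>t\<bar>)"
    using scaled_deriv_bound_cone by blast
  from this[of 0] show "\<exists>C. \<forall>t. norm (scaled_deriv k 0 t) \<le> C * exp (- real m * \<bar>t\<bar>)" by auto
qed

definition taylor_term :: "nat \<Rightarrow> nat \<Rightarrow> real \<Rightarrow> complex" where
  "taylor_term j k t = scaled_deriv (j + k) 0 t * exp (- of_nat k * of_real t) / fact k"

definition "moment j k = (\<integral>t. taylor_term j k t \<partial>lborel)"

lemma taylor_term_integrable: "integrable lborel (taylor_term j k)"
proof -
  have "integrable lborel (\<lambda>t. scaled_deriv (j + k) 0 t * exp (- of_nat k * of_real t))"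
    by (rule rapid_mellin_integrable[OF rapid_scaled_deriv_axis])
  thus ?thesis unfolding taylor_term_def[abs_def] by (rule integrable_divide_zero) 
qed

lemma scaled_deriv_taylor:
  assumes "\<And>u. \<bar>u\<bar> \<le> \<bar>x\<bar> \<Longrightarrow> norm (scaled_deriv (j + K) u t) \<le> B"
  shows "norm (scaled_deriv j x t - (\<Sum>k<K. of_real (x ^ k) * taylor_term j k t)) \<le> B * exp (- real K * t) * \<bar>x\<bar> ^ K"
proof -
  define D where "D = (\<lambda>k u. scaled_deriv (j + k) u t * of_real (exp (- real k * t)))"
  have "(D k has_vector_derivative D (Suc k) u) (at u)" for k u
  proof -
    have "exp (- real (Suc k) * t) = exp (- t) * exp (- real k * t)" by (simp add: algebra_simps flip: exp_add)
    thus ?thesis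
      using has_vector_derivative_mult_left[OF scaled_deriv_has_vector_derivative[of "j + k" t u], of
        "of_real (exp (- real k * t))"]
      by (simp only: D_def add_Suc_right of_real_mult mult.assoc)
  qed
  moreover have "norm (D K u) \<le> B * exp (- real K * t)" if "\<bar>u\<bar> \<le> \<bar>x\<bar>" for u
    unfolding D_def norm_mult norm_of_real abs_exp_cancel using assms[OF that] by (intro mult_right_mono) auto
  ultimately have "norm (D 0 x - (\<Sum>k<K. (x ^ k / fact k) *\<^sub>R D k 0)) \<le> B * exp (- real K * t) * \<bar>x\<bar> ^ K"
    by (rule vector_taylor_bound)
  moreover have "(x ^ k / fact k) *\<^sub>R D k 0 = of_real (x ^ k) * taylor_term j k t" for k
    by (simp add: D_def taylor_term_def scaleR_conv_of_real flip: exp_of_real)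
  ultimately show ?thesis by (simp add: D_def)
qed

lemma exp_minus_absorb:
  assumes "k \<le> K"
  shows "exp (- real (2 * K + 1) * \<bar>t\<bar>) * exp (- real k * t) \<le> exp (- real K * \<bar>t\<bar>) * exp (- \<bar>t\<bar>)"
proof -
  have "real k * - t \<le> real k * \<bar>t\<bar>" by (intro mult_left_mono) auto
  also have "\<dots> \<le> real K * \<bar>t\<bar>" using assms by (intro mult_right_mono) auto
  finally show ?thesis unfolding exp_add[symmetric] by (simp add: algebra_simps)
qed

lemma taylor_remainder_inside_cone:
  "\<exists>C\<ge>0. \<forall>x t. \<bar>x\<bar> \<le> exp t \<longrightarrow>
     norm (scaled_deriv j x t - (\<Sum>k<K. of_real (x ^ k) * taylor_term j k t)) \<le> C * \<bar>x\<bar> ^ K * exp (- \<bar>t\<bar>)"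
proof -
  obtain C where C: "C \<ge> 0"
    "\<And>x t. \<bar>x\<bar> \<le> exp t \<Longrightarrow> norm (scaled_deriv (j + K) x t) \<le> C * exp (- real (2 * K + 1) * \<bar>t\<bar>)"
    using scaled_deriv_bound_cone by blast
  have "norm (scaled_deriv j x t - (\<Sum>k<K. of_real (x ^ k) * taylor_term j k t)) \<le> C * \<bar>x\<bar> ^ K * exp (- \<bar>t\<bar>)"
    if x: "\<bar>x\<bar> \<le> exp t" for x t
  proof -
    have "norm (scaled_deriv j x t - (\<Sum>k<K. of_real (x ^ k) * taylor_term j k t)) \<le>
        C * exp (- real (2 * K + 1) * \<bar>t\<bar>) * exp (- real K * t) * \<bar>x\<bar> ^ K"
      using x by (intro scaled_deriv_taylor C(2)) auto
    also have "\<dots> = C * \<bar>x\<bar> ^ K * (exp (- real (2 * K + 1) * \<bar>t\<bar>) * exp (- real K * t))" by (simp only: mult_ac)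
    also have "\<dots> \<le> C * \<bar>x\<bar> ^ K * (exp (- real K * \<bar>t\<bar>) * exp (- \<bar>t\<bar>))"
      using C(1) by (intro mult_left_mono exp_minus_absorb) auto
    also have "\<dots> \<le> C * \<bar>x\<bar> ^ K * (1 * exp (- \<bar>t\<bar>))"
      using C(1) by (intro mult_left_mono mult_right_mono) auto
    finally show ?thesis by simp
  qed
  thus ?thesis using C(1) by blast
qed

lemma taylor_term_outside_cone:
  "\<exists>C\<ge>0. \<forall>x t. exp t \<le> \<bar>x\<bar> \<longrightarrow> \<bar>x\<bar> \<le> 1 \<longrightarrow> norm (of_real (x ^ k) * taylor_term j k t) \<le> C * \<bar>x\<bar> ^ (k + n) * exp (- \<bar>t\<bar>)"
proof -
  define K where "K = k + n"
  obtain C where C: "C \<ge> 0"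
    "\<And>x t. \<bar>x\<bar> \<le> exp t \<Longrightarrow> norm (scaled_deriv (j + k) x t) \<le> C * exp (- real (2 * K + 1) * \<bar>t\<bar>)"
    using scaled_deriv_bound_cone by blast
  have "norm (of_real (x ^ k) * taylor_term j k t) \<le> C * \<bar>x\<bar> ^ K * exp (- \<bar>t\<bar>)" if x: "exp t \<le> \<bar>x\<bar>" "\<bar>x\<bar> \<le> 1" for x t
  proof -
    have "t \<le> 0" using x by (metis exp_le_one_iff order.trans)
    have "norm (of_real (x ^ k) * taylor_term j k t) =
        \<bar>x\<bar> ^ k / fact k * (norm (scaled_deriv (j + k) 0 t) * exp (- real k * t))"
      by (simp add: taylor_term_def norm_mult norm_divide norm_power)
    also have "\<dots> \<le> 1 * (C * exp (- real (2 * K + 1) * \<bar>t\<bar>) * exp (- real k * t))"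
    proof (intro mult_mono mult_right_mono)
      have "\<bar>x\<bar> ^ k / fact k \<le> 1 / 1" using x by (intro frac_le) (auto simp: power_le_one)
      thus "\<bar>x\<bar> ^ k / fact k \<le> 1" by simp
      show "norm (scaled_deriv (j + k) 0 t) \<le> C * exp (- real (2 * K + 1) * \<bar>t\<bar>)" by (rule C(2)) simp
    qed (use C(1) in auto)
    also have "\<dots> \<le> C * (exp (- real K * \<bar>t\<bar>) * exp (- \<bar>t\<bar>))"
      unfolding mult_1 mult.assoc using C(1) by (intro mult_left_mono exp_minus_absorb) (auto simp: K_def)
    also have "exp (- real K * \<bar>t\<bar>) = exp t ^ K" using \<open>t \<le> 0\<close> by (simp flip: exp_of_nat_mult)
    also have "C * (exp t ^ K * exp (- \<bar>t\<bar>)) \<le> C * (\<bar>x\<bar> ^ K * exp (- \<bar>t\<bar>))"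
      using C(1) x by (intro mult_left_mono mult_right_mono power_mono) auto
    finally show ?thesis by simp
  qed
  thus ?thesis using C(1) unfolding K_def by blast
qed

text \<open>
  The Taylor expansion at \<open>x = 0\<close> is only valid inside the cone \<open>\<bar>x\<bar> \<le> exp t\<close>; outside, both the
  truncated integrand and the Taylor polynomial are small.
\<close>

lemma truncated_taylor_bound:
  "\<exists>C. \<forall>x t. 0 < \<bar>x\<bar> \<longrightarrow> \<bar>x\<bar> \<le> 1 \<longrightarrow>
     norm (indicator {ln \<bar>x\<bar>..} t *\<^sub>R scaled_deriv j x t - (\<Sum>k<K. of_real (x ^ k) * taylor_term j k t))
       \<le> C * \<bar>x\<bar> ^ K * exp (- \<bar>t\<bar>)"
proof -
  obtain C where C: "C \<ge> 0" "\<And>x t. \<bar>x\<bar> \<le> exp t \<Longrightarrow>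
      norm (scaled_deriv j x t - (\<Sum>k<K. of_real (x ^ k) * taylor_term j k t)) \<le> C * \<bar>x\<bar> ^ K * exp (- \<bar>t\<bar>)"
    using taylor_remainder_inside_cone by blast
  have "\<forall>k. \<exists>D\<ge>0. \<forall>x t. exp t \<le> \<bar>x\<bar> \<longrightarrow> \<bar>x\<bar> \<le> 1 \<longrightarrow>
      norm (of_real (x ^ k) * taylor_term j k t) \<le> D * \<bar>x\<bar> ^ (k + (K - k)) * exp (- \<bar>t\<bar>)"
    using taylor_term_outside_cone by blast
  then obtain D where D: "\<And>k. D k \<ge> 0" "\<And>k x t. exp t \<le> \<bar>x\<bar> \<Longrightarrow> \<bar>x\<bar> \<le> 1 \<Longrightarrow>
      norm (of_real (x ^ k) * taylor_term j k t) \<le> D k * \<bar>x\<bar> ^ (k + (K - k)) * exp (- \<bar>t\<bar>)" by metis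
  have sum_D: "(\<Sum>k<K. D k) \<ge> 0" by (intro sum_nonneg D)
  have "norm (indicator {ln \<bar>x\<bar>..} t *\<^sub>R scaled_deriv j x t - (\<Sum>k<K. of_real (x ^ k) * taylor_term j k t))
      \<le> (C + (\<Sum>k<K. D k)) * \<bar>x\<bar> ^ K * exp (- \<bar>t\<bar>)" if x: "0 < \<bar>x\<bar>" "\<bar>x\<bar> \<le> 1" for x t
  proof (cases "ln \<bar>x\<bar> \<le> t")
    case True
    hence "\<bar>x\<bar> \<le> exp t" using x by (metis exp_le_cancel_iff exp_ln)
    note C(2)[OF this]
    also have "C * \<bar>x\<bar> ^ K * exp (- \<bar>t\<bar>) \<le> (C + (\<Sum>k<K. D k)) * \<bar>x\<bar> ^ K * exp (- \<bar>t\<bar>)"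
      using sum_D by (intro mult_right_mono) auto
    finally show ?thesis using True by simp
  next
    case False
    hence "exp t \<le> \<bar>x\<bar>" using x by (metis exp_le_cancel_iff exp_ln less_imp_le not_le)
    have "norm (\<Sum>k<K. of_real (x ^ k) * taylor_term j k t) \<le> (\<Sum>k<K. D k * \<bar>x\<bar> ^ K * exp (- \<bar>t\<bar>))"
    proof (rule sum_norm_le)
      fix k assume "k \<in> {..<K}"
      thus "norm (of_real (x ^ k) * taylor_term j k t) \<le> D k * \<bar>x\<bar> ^ K * exp (- \<bar>t\<bar>)"
        using D(2)[OF \<open>exp t \<le> \<bar>x\<bar>\<close> x(2), of k] by simp
    qed
    also have "\<dots> = (\<Sum>k<K. D k) * \<bar>x\<bar> ^ K * exp (- \<bar>t\<bar>)" by (simp only: sum_distrib_right)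
    also have "\<dots> \<le> (C + (\<Sum>k<K. D k)) * \<bar>x\<bar> ^ K * exp (- \<bar>t\<bar>)" using C(1) by (intro mult_right_mono) auto
    finally show ?thesis using False by simp
  qed
  thus ?thesis by blast
qed

definition "truncated_moment j x = (\<integral>t. indicator {ln \<bar>x\<bar>..} t *\<^sub>R scaled_deriv j x t \<partial>lborel)"

lemma truncated_moment_expansion:
  assumes j: "j \<le> 1"
  shows "\<exists>C. \<forall>x\<in>\<rat>. 0 < \<bar>x\<bar> \<longrightarrow> \<bar>x\<bar> \<le> 1 \<longrightarrow>
    norm (truncated_moment j x - (\<Sum>k<K. of_real (x ^ k) * moment j k)) \<le> C * \<bar>x\<bar> ^ K"
proof -
  obtain C where C: "\<And>x t. 0 < \<bar>x\<bar> \<Longrightarrow> \<bar>x\<bar> \<le> 1 \<Longrightarrow>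
      norm (indicator {ln \<bar>x\<bar>..} t *\<^sub>R scaled_deriv j x t - (\<Sum>k<K. of_real (x ^ k) * taylor_term j k t))
        \<le> C * \<bar>x\<bar> ^ K * exp (- \<bar>t\<bar>)"
    using truncated_taylor_bound by blast
  have "norm (truncated_moment j x - (\<Sum>k<K. of_real (x ^ k) * moment j k)) \<le>
      C * (\<integral>t. exp (- \<bar>t\<bar>) \<partial>lborel) * \<bar>x\<bar> ^ K" if x: "x \<in> \<rat>" "0 < \<bar>x\<bar>" "\<bar>x\<bar> \<le> 1" for x
  proof -
    let ?g = "\<lambda>t. indicator {ln \<bar>x\<bar>..} t *\<^sub>R scaled_deriv j x t"
    let ?S = "\<lambda>t. \<Sum>k<K. of_real (x ^ k) * taylor_term j k t"
    have g: "integrable lborel ?g"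
      by (intro integrable_mult_indicator rapid_integrable rapid_scaled_deriv x j) auto
    have S: "integrable lborel ?S"
      by (intro Bochner_Integration.integrable_sum integrable_mult_right taylor_term_integrable)
    have "(\<integral>t. ?S t \<partial>lborel) = (\<Sum>k<K. of_real (x ^ k) * moment j k)"
      using taylor_term_integrable by (subst Bochner_Integration.integral_sum) (auto simp: moment_def)
    hence "norm (truncated_moment j x - (\<Sum>k<K. of_real (x ^ k) * moment j k)) = norm (\<integral>t. ?g t - ?S t \<partial>lborel)"
      unfolding truncated_moment_def Bochner_Integration.integral_diff[OF g S] by simp
    also have "\<dots> \<le> (\<integral>t. C * \<bar>x\<bar> ^ K * exp (- \<bar>t\<bar>) \<partial>lborel)"
      by (intro Bochner_Integration.integral_norm_bound_integral Bochner_Integration.integrable_diff g S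
            integrable_mult_right integrable_exp_minus_abs C x)
    finally show ?thesis by (simp add: mult_ac)
  qed
  thus ?thesis by blast
qed

definition "line_moment j x = (\<integral>t. scaled_deriv j x t \<partial>lborel)"

lemma scaled_deriv_reflect:
  assumes "q > 0" "j \<le> 1"
  shows "scaled_deriv j (1 / real q) t = (- 1) ^ j * scaled_deriv j (- (1 / real q)) (- 2 * ln (real q) - t)"
  using scaled_deriv_inversion[of "-1" 1 0 q j t] assms by simp

lemma line_moment_reflect:
  assumes "q > 0" "j \<le> 1"
  shows "line_moment j (1 / real q) = (- 1) ^ j * line_moment j (- (1 / real q))"
  unfolding line_moment_def scaled_deriv_reflect[OF assms]
  using integral_reflect_line[of "scaled_deriv j (- (1 / real q))"] by simp

lemma line_moment_0:
  assumes "j \<le> 1"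
  shows "line_moment j 0 = (- 1) ^ j * line_moment j 0"
proof -
  have reflect: "scaled_deriv j 0 t = (- 1) ^ j * scaled_deriv j 0 (0 - t)" for t
    using scaled_deriv_inversion[of 0 0 "-1" 1 j t] assms by simp
  have "line_moment j 0 = (\<integral>t. (- 1) ^ j * scaled_deriv j 0 (0 - t) \<partial>lborel)"
    unfolding line_moment_def by (intro Bochner_Integration.integral_cong refl reflect)
  also have "\<dots> = (- 1) ^ j * (\<integral>t. scaled_deriv j 0 (0 - t) \<partial>lborel)" by simp
  finally show ?thesis unfolding integral_reflect_line line_moment_def .
qed

lemma moment_0: "moment j 0 = line_moment j 0"
  by (simp add: moment_def line_moment_def taylor_term_def)

lemma line_moment_split:
  assumes q: "q > 0" and j: "j \<le> 1"
  shows "line_moment j (1 / real q) = truncated_moment j (1 / real q) + (- 1) ^ j *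
      truncated_moment j (- (1 / real q))"
proof -
  define x where "x = 1 / real q"
  define L where "L = ln x"
  have L: "- 2 * ln (real q) = 2 * L" using q by (simp add: L_def x_def ln_div)
  have "x \<in> \<rat>" by (simp add: x_def)
  hence integrable: "integrable lborel (scaled_deriv j x)" by (intro rapid_integrable rapid_scaled_deriv j)
  have "line_moment j x = (\<integral>t. indicator {L..} t *\<^sub>R scaled_deriv j x t + indicator {..<L} t
      *\<^sub>R scaled_deriv j x t \<partial>lborel)"
    unfolding line_moment_def by (intro Bochner_Integration.integral_cong refl) (auto simp: indicator_def)
  also have "\<dots> = (\<integral>t. indicator {L..} t *\<^sub>R scaled_deriv j x t \<partial>lborel) +
      (\<integral>t. indicator {..<L} t *\<^sub>R scaled_deriv j x t \<partial>lborel)"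
    using integrable by (intro Bochner_Integration.integral_add integrable_mult_indicator) auto
  also have "(\<integral>t. indicator {..<L} t *\<^sub>R scaled_deriv j x t \<partial>lborel) =
      (\<integral>t. (\<lambda>t. (- 1) ^ j * (indicator {L<..} t *\<^sub>R scaled_deriv j (- x) t)) (2 * L - t) \<partial>lborel)"
  proof (intro Bochner_Integration.integral_cong refl)
    fix t
    have "scaled_deriv j x t = (- 1) ^ j * scaled_deriv j (- x) (2 * L - t)"
      using scaled_deriv_reflect[OF q j, of t] unfolding L x_def .
    thus "indicator {..<L} t *\<^sub>R scaled_deriv j x t =
        (- 1) ^ j * (indicator {L<..} (2 * L - t) *\<^sub>R scaled_deriv j (- x) (2 * L - t))"
      by (auto simp: indicator_def)
  qed
  also have "\<dots> = (- 1) ^ j * (\<integral>t. indicator {L<..} t *\<^sub>R scaled_deriv j (- x) t \<partial>lborel)"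
    by (subst integral_reflect_line) (simp only: integral_mult_right_zero)
  also have "(\<integral>t. indicator {L<..} t *\<^sub>R scaled_deriv j (- x) t \<partial>lborel) =
      (\<integral>t. indicator {L..} t *\<^sub>R scaled_deriv j (- x) t \<partial>lborel)"
  proof (rule integral_cong_AE)
    show "AE t in lborel. indicator {L<..} t *\<^sub>R scaled_deriv j (- x) t = indicator {L..} t
        *\<^sub>R scaled_deriv j (- x) t"
      using AE_lborel_singleton[of L] by eventually_elim (auto simp: indicator_def)
  qed (use borel_measurable_continuous_onI[OF continuous_on_scaled_deriv] in simp_all)
  finally show ?thesis using q by (simp add: truncated_moment_def L_def x_def)
qed

lemma line_moment_expansion:
  assumes j: "j \<le> 1"
  shows "power_expansion (\<lambda>q. 1 / real q) (\<lambda>q. line_moment j (1 / real q)) (\<lambda>k. (1 + (- 1) ^ (j + k)) * moment j k)"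
  unfolding power_expansion_def
proof
  fix K
  obtain C where C: "\<And>x. x \<in> \<rat> \<Longrightarrow> 0 < \<bar>x\<bar> \<Longrightarrow> \<bar>x\<bar> \<le> 1 \<Longrightarrow>
      norm (truncated_moment j x - (\<Sum>k<K. of_real (x ^ k) * moment j k)) \<le> C * \<bar>x\<bar> ^ K"
    using truncated_moment_expansion[OF j] by blast
  have "norm (line_moment j (1 / real q) - (\<Sum>k<K. (1 + (- 1) ^ (j + k)) * moment j k * of_real ((1 / real q) ^ k))) \<le>
      (2 * C) * (1 / real q) ^ K" if q: "q > 0" for q
  proof -
    define x where "x = 1 / real q"
    have x: "x \<in> \<rat>" "0 < x" "x \<le> 1" using q by (auto simp: x_def)
    define P where "P = (\<lambda>x. truncated_moment j x - (\<Sum>k<K. of_real (x ^ k) * moment j k))"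
    have P: "norm (P x) \<le> C * x ^ K" "norm (P (- x)) \<le> C * x ^ K"
      using C[of x] C[of "- x"] x by (simp_all add: P_def)
    have coeff: "(1 + (- 1) ^ (j + k)) * moment j k * of_real (x ^ k) =
        of_real (x ^ k) * moment j k + (- 1) ^ j * (of_real ((- x) ^ k) * moment j k)" for k
    proof -
      have "complex_of_real ((- x) ^ k) = (- 1) ^ k * of_real (x ^ k)" by (subst power_minus) simp
      thus ?thesis by (simp only: power_add) (simp add: algebra_simps)
    qed
    have "line_moment j x = truncated_moment j x + (- 1) ^ j * truncated_moment j (- x)"
      unfolding x_def by (rule line_moment_split[OF q j])
    hence "line_moment j x - (\<Sum>k<K. (1 + (- 1) ^ (j + k)) * moment j k * of_real (x ^ k)) = P x + (- 1) ^ j * P (- x)"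
      unfolding coeff P_def sum.distrib sum_distrib_left[symmetric] by (simp add: right_diff_distrib)
    also have "norm \<dots> \<le> C * x ^ K + C * x ^ K"
      using P by (intro norm_triangle_le add_mono) (auto simp: norm_mult norm_power)
    finally show ?thesis by (simp add: x_def)
  qed
  thus "\<exists>C. \<forall>q>0. norm (line_moment j (1 / real q) -
      (\<Sum>k<K. (1 + (- 1) ^ (j + k)) * moment j k * of_real ((1 / real q) ^ k))) \<le> C * (1 / real q) ^ K" by blast
qed

definition "additive_twist \<nu> x = L_series (\<lambda>n. eigenvalue n * additive_weight \<nu> x n) (1 / 2)"

end

context signed_form
begin

lemma additive_twist_eq_line_moments:
  assumes x: "x \<in> \<rat>" and j: "j \<le> 1"
  shows "additive_twist ((- 1) ^ j * e) x =
    inverse_gamma_factor (of_nat j) / ((2 * of_real pi * \<i>) ^ j * signed_coeff) *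
      (line_moment j x + (- 1) ^ j * e * line_moment j (- x))"
proof -
  have "integrable lborel (scaled_deriv j x)" "integrable lborel (scaled_deriv j (- x))"
    using x j by (auto intro!: rapid_integrable rapid_scaled_deriv)
  hence "mellin (signed_deriv j x) 0 = line_moment j x + (- 1) ^ j * e * line_moment j (- x)"
    by (simp add: mellin_def signed_deriv_def line_moment_def)
  thus ?thesis
    using L_series_eq[OF twist_value_continuation[OF assms]] by (simp add: additive_twist_def twist_value_def)
qed

end

context hecke_form
begin

lemma additive_twist_expansion:
  assumes \<nu>: "\<nu> = 1 \<or> \<nu> = - 1"
  shows "\<exists>c. c 0 = 2 * additive_twist \<nu> 0 \<and>
    power_expansion (\<lambda>q. 1 / real q) (\<lambda>q. additive_twist \<nu> (1 / real q)) c"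
proof -
  obtain e where "signed_form f e" using ex_signed_form by blast
  then interpret signed_form f e .
  obtain j where j: "j \<le> 1" "(- 1) ^ j * e = \<nu>" using ex_parity[OF \<nu>] by blast
  define G where "G = inverse_gamma_factor (of_nat j) / ((2 * of_real pi * \<i>) ^ j * signed_coeff)"
  define c where "c = (\<lambda>k. G * (1 + e) * ((1 + (- 1) ^ (j + k)) * moment j k))"
  have twist: "additive_twist \<nu> x = G * (line_moment j x + \<nu> * line_moment j (- x))" if "x \<in> \<rat>" for x
    using additive_twist_eq_line_moments[OF that j(1)] unfolding j(2) G_def .
  have sign_\<nu>: "\<nu> * (- 1) ^ j = e" unfolding j(2)[symmetric] by (simp add: mult_ac flip: power_add)
  have "additive_twist \<nu> (1 / real q) = G * (1 + e) * line_moment j (1 / real q)" if "q > 0" for q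
  proof -
    have "line_moment j (- (1 / real q)) = (- 1) ^ j * line_moment j (1 / real q)"
      unfolding line_moment_reflect[OF that j(1)] by (simp flip: power_add mult.assoc)
    hence "additive_twist \<nu> (1 / real q) = G *
        (line_moment j (1 / real q) + (\<nu> * (- 1) ^ j) * line_moment j (1 / real q))"
      by (simp add: twist mult.assoc)
    thus ?thesis unfolding sign_\<nu> by (simp add: algebra_simps)
  qed
  hence "power_expansion (\<lambda>q. 1 / real q) (\<lambda>q. additive_twist \<nu> (1 / real q)) c \<longleftrightarrow>
      power_expansion (\<lambda>q. 1 / real q) (\<lambda>q. G * (1 + e) * line_moment j (1 / real q)) c"
    by (rule power_expansion_cong)
  hence "power_expansion (\<lambda>q. 1 / real q) (\<lambda>q. additive_twist \<nu> (1 / real q)) c"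
    unfolding c_def by (simp only: power_expansion_cmult[OF line_moment_expansion[OF j(1)]])
  moreover have "c 0 = 2 * additive_twist \<nu> 0"
  proof -
    define m where "m = line_moment j 0"
    have m: "(- 1) ^ j * m = m" using line_moment_0[OF j(1)] by (simp add: m_def)
    have "e * m = \<nu> * ((- 1) ^ j * m)" by (simp flip: sign_\<nu>)
    hence "e * m = \<nu> * m" by (simp only: m)
    have "c 0 = G * ((m + e * m) + (((- 1) ^ j * m) + e * ((- 1) ^ j * m)))"
      by (simp add: c_def moment_0 m_def algebra_simps)
    also have "\<dots> = 2 * (G * (m + \<nu> * m))" unfolding m \<open>e * m = \<nu> * m\<close> by simp
    finally show ?thesis by (simp add: twist m_def)
  qed
  ultimately show ?thesis by blast
qed

end

section \<open>The moments of twisted central values\<close>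

lemma has_sum_from_1_iff: "(v has_sum S) {1..} \<longleftrightarrow> ((\<lambda>n. v (Suc n)) has_sum S) UNIV"
proof -
  have "range Suc = {1..}" by (auto simp: image_iff Suc_le_eq gr0_conv_Suc)
  thus ?thesis using has_sum_reindex[of Suc UNIV v S] by (simp add: o_def)
qed

lemma of_nat_mult_powr: "of_nat (q * n) powr s = of_nat q powr s * (of_nat n powr s :: complex)"
proof (cases "q = 0 \<or> n = 0")
  case False
  thus ?thesis by (subst (1 2 3) of_nat_powr_conv_exp) (auto simp: ln_mult ring_distribs simp flip: exp_add)
qed auto

lemma dirichlet_series_dilate:
  fixes a :: "nat \<Rightarrow> complex"
  assumes q: "q > 0" and a: "((\<lambda>n. a n / of_nat n powr s) has_sum S) {1..}"
  shows "((\<lambda>n. (if q dvd n then a (n div q) else 0) / of_nat n powr s) has_sum of_nat q powr (- s) * S) {1..}"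
proof -
  define v where "v = (\<lambda>n. (if q dvd n then a (n div q) else 0) / of_nat n powr s)"
  have "((\<lambda>n. of_nat q powr (- s) * (a n / of_nat n powr s)) has_sum of_nat q powr (- s) * S) {1..}"
    by (rule has_sum_cmult_right[OF a])
  moreover have "of_nat q powr (- s) * (a n / of_nat n powr s) = v (q * n)" for n
    using q by (simp add: v_def of_nat_mult_powr powr_minus divide_inverse del: of_nat_mult)
  moreover have "inj_on ((*) q) {1..}" using q by (auto simp: inj_on_def)
  ultimately have "(v has_sum of_nat q powr (- s) * S) ((*) q ` {1..})"
    using has_sum_reindex[of "(*) q" "{1..}" v] by (simp add: o_def)
  also have "?this \<longleftrightarrow> (v has_sum of_nat q powr (- s) * S) {1..}"
  proof (rule has_sum_cong_neutral)
    fix n assume "n \<in> {1..} - (*) q ` {1..}"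
    hence "\<not> q dvd n" by (auto simp: dvd_def image_iff)
    thus "v n = 0" by (simp add: v_def)
  qed (use q in auto)
  finally show ?thesis unfolding v_def .
qed

context hecke_form
begin

lemma eigenvalue_multiples_continuation:
  assumes q: "prime q" and L: "entire_continuation eigenvalue L"
  shows "entire_continuation (\<lambda>n. if q dvd n then eigenvalue n else 0)
     (\<lambda>s. of_nat q powr (- s) * (eigenvalue q - of_nat q powr (- s)) * L s)"
  unfolding entire_continuation_def
proof (intro conjI allI impI)
  have q0: "q > 0" using q prime_gt_0_nat by blast
  have "L holomorphic_on UNIV" using L by (simp add: entire_continuation_def)
  thus "(\<lambda>s. of_nat q powr (- s) * (eigenvalue q - of_nat q powr (- s)) * L s) holomorphic_on UNIV"
    using q0 by (intro holomorphic_intros) auto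
  fix s :: complex assume s: "Re s > 1"
  define Q where "Q = of_nat q powr (- s)"
  have "(\<lambda>n. eigenvalue (Suc n) / of_nat (Suc n) powr s) sums L s"
    using L s unfolding entire_continuation_def by blast
  moreover have "norm (eigenvalue (Suc n) / of_nat (Suc n) powr s) =
      norm (eigenvalue (Suc n)) / real (Suc n) powr Re s" for n
    by (simp add: norm_divide norm_powr_real_powr del: of_nat_Suc)
  hence "summable (\<lambda>n. norm (eigenvalue (Suc n) / of_nat (Suc n) powr s))"
    using eigenvalue_abs_summable[OF s] by (simp only:)
  ultimately have eigenvalue_sum: "((\<lambda>n. eigenvalue n / of_nat n powr s) has_sum L s) {1..}"
    unfolding has_sum_from_1_iff by (intro norm_summable_imp_has_sum)
  have "((\<lambda>n. eigenvalue q * (eigenvalue n / of_nat n powr s) +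
      - ((if q dvd n then eigenvalue (n div q) else 0) / of_nat n powr s)) has_sum
        (eigenvalue q * L s + - (Q * L s))) {1..}"
    using dirichlet_series_dilate[OF q0 eigenvalue_sum]
    by (intro has_sum_add has_sum_cmult_right eigenvalue_sum) (simp only: has_sum_uminus minus_minus Q_def)
  also have "?this \<longleftrightarrow> ((\<lambda>n. eigenvalue (q * n) / of_nat n powr s) has_sum (eigenvalue q * L s + - (Q * L s))) {1..}"
  proof (rule has_sum_cong)
    fix n :: nat assume "n \<in> {1..}"
    thus "eigenvalue q * (eigenvalue n / of_nat n powr s) + -
        ((if q dvd n then eigenvalue (n div q) else 0) / of_nat n powr s) =
        eigenvalue (q * n) / of_nat n powr s"
      using eigenvalue_mult[OF q, of n] by (simp flip: diff_divide_distrib)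
  qed
  finally have "((\<lambda>n. eigenvalue (q * n) / of_nat n powr s) has_sum (eigenvalue q * L s + - (Q * L s))) {1..}" .
  from dirichlet_series_dilate[OF q0 this]
  have "((\<lambda>n. (if q dvd n then eigenvalue (q * (n div q)) else 0) / of_nat n powr s) has_sum
      Q * (eigenvalue q * L s + - (Q * L s))) {1..}" unfolding Q_def .
  moreover have "(if q dvd n then eigenvalue (q * (n div q)) else 0) = (if q dvd n then eigenvalue n else 0)"
    for n by simp
  ultimately have "((\<lambda>n. (if q dvd n then eigenvalue n else 0) / of_nat n powr s) has_sum
      Q * (eigenvalue q * L s + - (Q * L s))) {1..}" by (simp only:)
  from has_sum_imp_sums[OF this[unfolded has_sum_from_1_iff]]
  show "(\<lambda>n. (if q dvd Suc n then eigenvalue (Suc n) else 0) / of_nat (Suc n) powr s) sums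
      (of_nat q powr (- s) * (eigenvalue q - of_nat q powr (- s)) * L s)"
    by (simp only: Q_def) (simp add: algebra_simps)
qed

lemma L_twist_continuation:
  assumes "q > 0" "dirichlet_char q \<xi>"
  shows "entire_continuation (\<lambda>n. eigenvalue n * conj_char \<xi> (int n)) (L_twist f (conj_char \<xi>))"
proof -
  have "conj_char \<xi> (n + int q) = conj_char \<xi> n" for n
    using assms(2) by (simp add: conj_char_def dirichlet_char_def)
  then obtain F where F: "entire_continuation (\<lambda>n. eigenvalue n * conj_char \<xi> (int n)) F"
    using ex_periodic_twist_continuation[OF assms(1)] by metis
  from entire_continuation_L_series[OF this] show ?thesis by (simp add: L_twist_def[abs_def])
qed

lemma sum_gauss_sum_L_twist:
  assumes q: "q > 0" and S: "S \<subseteq> {\<xi>. dirichlet_char q \<xi>}"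
    and F: "entire_continuation (\<lambda>n. eigenvalue n * (\<Sum>\<xi>\<in>S. gauss_sum q \<xi> * conj_char \<xi> (int n))) F"
  shows "(\<Sum>\<xi>\<in>S. gauss_sum q \<xi> / of_real (sqrt (real q)) * L_twist f (conj_char \<xi>) s) = F s / of_real (sqrt (real q))"
proof -
  have "finite S" using S finite_dirichlet_chars[OF q] finite_subset by blast
  hence "entire_continuation (\<lambda>n. \<Sum>\<xi>\<in>S. gauss_sum q \<xi> * (eigenvalue n * conj_char \<xi> (int n)))
     (\<lambda>s. \<Sum>\<xi>\<in>S. gauss_sum q \<xi> * L_twist f (conj_char \<xi>) s)"
    using S by (intro entire_continuation_sum entire_continuation_cmult L_twist_continuation[OF q]) auto
  moreover have "(\<Sum>\<xi>\<in>S. gauss_sum q \<xi> * (eigenvalue n * conj_char \<xi> (int n))) =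
      eigenvalue n * (\<Sum>\<xi>\<in>S. gauss_sum q \<xi> * conj_char \<xi> (int n))" for n
    unfolding sum_distrib_left by (intro sum.cong refl) simp
  ultimately have "(\<lambda>s. \<Sum>\<xi>\<in>S. gauss_sum q \<xi> * L_twist f (conj_char \<xi>) s) = F"
    using F by (intro entire_continuation_unique) (simp_all only:)
  from fun_cong[OF this, of s] show ?thesis by (simp flip: sum_divide_distrib)
qed

lemma additive_twist_continuation:
  assumes "x \<in> \<rat>" "\<nu> = 1 \<or> \<nu> = - 1"
  obtains F where "entire_continuation (\<lambda>n. eigenvalue n * additive_weight \<nu> x n) F" "F (1 / 2) = additive_twist \<nu> x"
  using ex_additive_twist_continuation[OF assms] entire_continuation_L_series additive_twist_def by metis

lemma additive_twist_0: "additive_twist \<nu> 0 = (1 + \<nu>) * L_form f (1 / 2)"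
proof -
  have "(\<lambda>n. eigenvalue n * additive_weight \<nu> 0 n) = (\<lambda>n. (1 + \<nu>) * eigenvalue n)"
    by (simp add: additive_weight_def mult.commute)
  thus ?thesis
    using L_series_eq[OF entire_continuation_cmult[OF L_form_continuation]] by (simp add: additive_twist_def)
qed

definition "twist_error \<nu> q =
  (of_nat q - 1) / (2 * of_real (sqrt (real q))) * (additive_twist \<nu> (1 / real q) - 2 * additive_twist \<nu> 0)"

lemma even_moment:
  assumes q: "prime q"
  shows "(\<Sum>\<xi>\<in>even_primitive_chars q. gauss_sum q \<xi> / of_real (sqrt (real q)) * L_twist f (conj_char \<xi>) (1 / 2)) =
     2 * L_form f (1 / 2) * of_real (sqrt (real q)) - eigenvalue q * L_form f (1 / 2) + twist_error 1 q"
proof -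
  interpret prime_modulus q by unfold_locales (rule q)
  have q0: "q > 0" using q_gt_1 by simp
  define r where "r = complex_of_real (sqrt (real q))"
  have r: "r \<noteq> 0" "of_nat q = r * r" using q0 by (auto simp: r_def simp flip: of_real_mult)
  obtain F where F: "entire_continuation (\<lambda>n. eigenvalue n * additive_weight 1 (1 / real q) n) F"
    "F (1 / 2) = additive_twist 1 (1 / real q)" by (rule additive_twist_continuation[of "1 / real q" 1]) auto
  define G where "G = (\<lambda>s. of_nat q powr (- s) * (eigenvalue q - of_nat q powr (- s)) * L_form f s)"
  have G: "entire_continuation (\<lambda>n. if q dvd n then eigenvalue n else 0) G"
    unfolding G_def by (rule eigenvalue_multiples_continuation[OF q L_form_continuation])
  have G_half: "G (1 / 2) = 1 / r * (eigenvalue q - 1 / r) * L_form f (1 / 2)"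
    using of_real_sqrt_conv_powr[OF q0] by (simp add: G_def r_def powr_minus inverse_eq_divide)
  have "entire_continuation (\<lambda>n. (of_nat (q - 1) / 2 * (eigenvalue n * additive_weight 1 (1 / real q) n) +
      eigenvalue n) +
      (- of_nat q) * (if q dvd n then eigenvalue n else 0)) (\<lambda>s. (of_nat (q - 1) / 2 * F s + L_form f s) +
        (- of_nat q) * G s)"
    by (intro entire_continuation_add entire_continuation_cmult F G L_form_continuation)
  moreover have coeff: "(of_nat (q - 1) / 2 * (eigenvalue n * additive_weight 1 (1 / real q) n) + eigenvalue n) +
      (- of_nat q) * (if q dvd n then eigenvalue n else 0) =
      eigenvalue n * (\<Sum>\<xi>\<in>even_primitive_chars q. gauss_sum q \<xi> * conj_char \<xi> (int n))" for n
    unfolding sum_even_primitive_chars by (auto simp: algebra_simps)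
  moreover have "even_primitive_chars q \<subseteq> {\<xi>. dirichlet_char q \<xi>}"
    by (auto simp: even_primitive_chars_def primitive_char_def)
  ultimately have "(\<Sum>\<xi>\<in>even_primitive_chars q. gauss_sum q \<xi> / r * L_twist f (conj_char \<xi>) (1 / 2)) =
      ((of_nat (q - 1) / 2 * F (1 / 2) + L_form f (1 / 2)) + (- of_nat q) * G (1 / 2)) / r"
    unfolding r_def coeff by (intro sum_gauss_sum_L_twist[OF q0])
  also have "of_nat (q - 1) = r * r - 1" using q0 by (simp add: of_nat_diff r(2))
  also have "(((r * r - 1) / 2 * F (1 / 2) + L_form f (1 / 2)) + (- of_nat q) * G (1 / 2)) / r =
      2 * L_form f (1 / 2) * r - eigenvalue q * L_form f (1 / 2) + twist_error 1 q"
    unfolding F(2) G_half twist_error_def additive_twist_0 r_def[symmetric] r(2) using r(1) by (simp add: field_simps)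
  finally show ?thesis by (simp add: r_def)
qed

lemma odd_moment:
  assumes q: "prime q"
  shows "(\<Sum>\<xi>\<in>odd_primitive_chars q. gauss_sum q \<xi> / of_real (sqrt (real q)) * L_twist f (conj_char \<xi>) (1 / 2)) =
     twist_error (- 1) q"
proof -
  interpret prime_modulus q by unfold_locales (rule q)
  have q0: "q > 0" using q_gt_1 by simp
  obtain F where F: "entire_continuation (\<lambda>n. eigenvalue n * additive_weight (- 1) (1 / real q) n) F"
    "F (1 / 2) = additive_twist (- 1) (1 / real q)" by (rule additive_twist_continuation[of "1 / real q" "- 1"]) auto
  have "entire_continuation (\<lambda>n. of_nat (q - 1) / 2 * (eigenvalue n * additive_weight (- 1) (1 / real q) n))
      (\<lambda>s. of_nat (q - 1) / 2 * F s)"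
    by (intro entire_continuation_cmult F)
  moreover have coeff: "of_nat (q - 1) / 2 * (eigenvalue n * additive_weight (- 1) (1 / real q) n) =
      eigenvalue n * (\<Sum>\<xi>\<in>odd_primitive_chars q. gauss_sum q \<xi> * conj_char \<xi> (int n))" for n
    unfolding sum_odd_primitive_chars by simp
  moreover have "odd_primitive_chars q \<subseteq> {\<xi>. dirichlet_char q \<xi>}"
    by (auto simp: odd_primitive_chars_def primitive_char_def)
  ultimately have "(\<Sum>\<xi>\<in>odd_primitive_chars q. gauss_sum q \<xi> / of_real (sqrt (real q)) *
      L_twist f (conj_char \<xi>) (1 / 2)) =
      of_nat (q - 1) / 2 * F (1 / 2) / of_real (sqrt (real q))"
    unfolding coeff by (intro sum_gauss_sum_L_twist[OF q0])
  thus ?thesis using q0 by (simp add: F(2) twist_error_def additive_twist_0 of_nat_diff)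
qed

lemma twist_error_expansion:
  assumes \<nu>: "\<nu> = 1 \<or> \<nu> = - 1"
  shows "\<exists>c. c 0 = 0 \<and> power_expansion (\<lambda>q. real q powr (- 1 / 2)) (twist_error \<nu>) c"
proof -
  define u where "u = (\<lambda>q. real q powr (- 1 / 2))"
  have u: "0 < u q \<and> u q \<le> 1" if "q > 0" for q
    using that powr_mono[of "- 1 / 2" 0 "real q"] by (simp add: u_def)
  have u_square: "(\<lambda>q. (u q)\<^sup>2) = (\<lambda>q. 1 / real q)"
    by (simp add: u_def fun_eq_iff powr_minus_divide powr_half_sqrt power_divide)
  define E where "E = (\<lambda>q. additive_twist \<nu> (1 / real q) - 2 * additive_twist \<nu> 0)"
  obtain c where c: "c 0 = 2 * additive_twist \<nu> 0"
    "power_expansion (\<lambda>q. 1 / real q) (\<lambda>q. additive_twist \<nu> (1 / real q)) c"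
    using additive_twist_expansion[OF \<nu>] by blast
  define d where "d = (\<lambda>k. c k + (if k = 0 then - c 0 else 0))"
  have "power_expansion (\<lambda>q. (u q)\<^sup>2) E d"
    unfolding u_square E_def d_def c(1)[symmetric]
    using power_expansion_add[OF c(2) power_expansion_const[of "\<lambda>q. 1 / real q" "- c 0"]] by simp
  from power_expansion_square[OF u this]
  have E: "power_expansion u E (\<lambda>k. if even k then d (k div 2) else 0)" (is "power_expansion u E ?b") .
  have "power_expansion u (\<lambda>q. E q / of_real (u q)) (\<lambda>k. ?b (Suc k))"
    by (rule power_expansion_divide[OF _ E]) (use u in \<open>auto simp: d_def\<close>)
  moreover have "power_expansion u (\<lambda>q. of_real (u q) * E q) (\<lambda>k. case k of 0 \<Rightarrow> 0 | Suc k \<Rightarrow> ?b k)"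
    by (rule power_expansion_mult[OF u E])
  ultimately have "power_expansion u (\<lambda>q. 1 / 2 * (E q / of_real (u q) + (- 1) * (of_real (u q) * E q)))
      (\<lambda>k. 1 / 2 * (?b (Suc k) + (- 1) * (case k of 0 \<Rightarrow> 0 | Suc k \<Rightarrow> ?b k)))" (is "power_expansion u ?F ?a")
    by (intro power_expansion_cmult power_expansion_add)
  also have "?this \<longleftrightarrow> power_expansion u (twist_error \<nu>) ?a"
  proof (rule power_expansion_cong)
    fix q :: nat assume "q > 0"
    define r where "r = complex_of_real (sqrt (real q))"
    have "r \<noteq> 0" and "of_nat q = r * r" using \<open>q > 0\<close> by (auto simp: r_def simp flip: of_real_mult)
    moreover have "u q = 1 / sqrt (real q)" by (simp add: u_def powr_minus_divide powr_half_sqrt)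
    hence "complex_of_real (u q) = 1 / r" by (simp add: r_def)
    moreover have "1 / 2 * (x / (1 / r) + (- 1) * (1 / r * x)) = (r * r - 1) / (2 * r) * x" for x
      using \<open>r \<noteq> 0\<close> by (simp add: field_simps)
    ultimately show "?F q = twist_error \<nu> q"
      by (simp only: twist_error_def E_def r_def[symmetric])
  qed
  finally show ?thesis unfolding u_def by (intro exI[of _ ?a]) simp
qed

end

lemma power_expansion_powr:
  assumes F: "power_expansion (\<lambda>q. real q powr (- 1 / 2)) F c" and "c 0 = 0"
  shows "\<exists>C. \<forall>q>0. norm (F q - (\<Sum>n=1..N. c n * of_real (real q powr (- real n / 2)))) \<le>
      C * real q powr (- (real N + 1) / 2)"
proof -
  obtain C where C: "\<And>q. q > 0 \<Longrightarrow>
      norm (F q - (\<Sum>k<Suc N. c k * of_real ((real q powr (- 1 / 2)) ^ k))) \<le> C * (real q powr (- 1 / 2)) ^ Suc N"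
    using F unfolding power_expansion_def by blast
  have power: "(real q powr (- 1 / 2)) ^ n = real q powr (- real n / 2)" if "q > 0" for q n
    using that by (simp add: powr_power)
  have "norm (F q - (\<Sum>n=1..N. c n * of_real (real q powr (- real n / 2)))) \<le> C * real q powr (- (real N + 1) / 2)"
    if "q > 0" for q
  proof -
    have "{..<Suc N} = insert 0 {1..N}" by auto
    hence "(\<Sum>k<Suc N. c k * of_real (real q powr (- real k / 2))) =
        (\<Sum>n=1..N. c n * of_real (real q powr (- real n / 2)))"
      using \<open>c 0 = 0\<close> by (simp del: sum.lessThan_Suc)
    thus ?thesis using C[OF that] unfolding power[OF that] by (simp add: add_ac)
  qed
  thus ?thesis by blast
qed

lemma (in hecke_form) twist_error_asymptotics:
  assumes "\<nu> = 1 \<or> \<nu> = - 1"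
  obtains c :: "nat \<Rightarrow> complex" and C :: "nat \<Rightarrow> real" where
    "\<And>N q. q > 0 \<Longrightarrow> norm (twist_error \<nu> q - (\<Sum>n=1..N. c n * of_real (real q powr (- real n / 2))))
       \<le> C N * real q powr (- (real N + 1) / 2)"
proof -
  obtain c where "c 0 = 0" "power_expansion (\<lambda>q. real q powr (- 1 / 2)) (twist_error \<nu>) c"
    using twist_error_expansion[OF assms] by blast
  hence "\<forall>N. \<exists>C. \<forall>q>0. norm (twist_error \<nu> q - (\<Sum>n=1..N. c n * of_real (real q powr (- real n / 2))))
       \<le> C * real q powr (- (real N + 1) / 2)"
    using power_expansion_powr by blast
  from choice[OF this] show thesis using that by blast
qed

theorem theorem1p2:
  fixes f :: "complex \<Rightarrow> complex"
  assumes "hecke_maass_cusp_form f"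
  shows "\<exists>c c' :: nat \<Rightarrow> complex. \<forall>N::nat. N \<ge> 1 \<longrightarrow>
    (\<exists>C::real. \<forall>q::nat. prime q \<and> odd q \<longrightarrow>
      norm ((\<Sum>\<xi>\<in>even_primitive_chars q.
               gauss_sum q \<xi> / of_real (sqrt (real q)) * L_twist f (conj_char \<xi>) (1/2))
            - (2 * L_form f (1/2) * of_real (sqrt (real q))
               - hecke_eigenvalue f q * L_form f (1/2)
               + (\<Sum>n = 1..N. c n * of_real (real q powr (- real n / 2)))))
        \<le> C * real q powr (- (real N + 1) / 2) \<and>
      norm ((\<Sum>\<xi>\<in>odd_primitive_chars q.
               gauss_sum q \<xi> / of_real (sqrt (real q)) * L_twist f (conj_char \<xi>) (1/2))
            - (\<Sum>n = 1..N. c' n * of_real (real q powr (- real n / 2))))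
        \<le> C * real q powr (- (real N + 1) / 2))"
proof -
  interpret hecke_form f by unfold_locales (rule assms)
  let ?expansion = "\<lambda>c N q. \<Sum>n=1..N. c n * of_real (real q powr (- real n / 2))"
  let ?error = "\<lambda>N q. real q powr (- (real N + 1) / 2)"
  obtain c C where even: "\<And>N q. q > 0 \<Longrightarrow> norm (twist_error 1 q - ?expansion c N q) \<le> C N * ?error N q"
    by (rule twist_error_asymptotics[of 1]) auto
  obtain c' C' where odd: "\<And>N q. q > 0 \<Longrightarrow> norm (twist_error (- 1) q - ?expansion c' N q) \<le> C' N * ?error N q"
    by (rule twist_error_asymptotics[of "- 1"]) auto
  have error_bound: "\<exists>C. \<forall>q. prime q \<and> odd q \<longrightarrow> norm (twist_error 1 q - ?expansion c N q) \<le> C * ?error N q \<and>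
      norm (twist_error (- 1) q - ?expansion c' N q) \<le> C * ?error N q" for N
  proof (intro exI[of _ "max (C N) (C' N)"] allI impI conjI)
    fix q :: nat assume "prime q \<and> odd q"
    hence "q > 0" using prime_gt_0_nat by blast
    note even[OF this, of N]
    also have "C N * ?error N q \<le> max (C N) (C' N) * ?error N q" by (intro mult_right_mono) auto
    finally show "norm (twist_error 1 q - ?expansion c N q) \<le> max (C N) (C' N) * ?error N q" .
    note odd[OF \<open>q > 0\<close>, of N]
    also have "C' N * ?error N q \<le> max (C N) (C' N) * ?error N q" by (intro mult_right_mono) auto
    finally show "norm (twist_error (- 1) q - ?expansion c' N q) \<le> max (C N) (C' N) * ?error N q" .
  qed
  show ?thesis
    by (rule exI[of _ c], rule exI[of _ c'])
       (simp only: even_moment odd_moment add_diff_cancel_left error_bound simp_thms cong: imp_cong conj_cong)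
qed

end
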